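(* Let $M$ be an $n$-dimensional manifold, let $q\in\{0,1,2,n-1,n\}$, and let $\zeta$ be an algebraically constant differential $q$-form on $M$. If $\zeta$ is closed, $d\zeta=0$, then $\zeta$ is locally constant.
   Context: Manifolds are smooth and connected; differential forms are smooth. A tensor field $\Theta$ (in particular, a differential form) on $M$ is algebraically constant if for any $x,y\in M$ some linear isomorphism $T_xM\to T_yM$ sends $\Theta_x$ to $\Theta_y$; it is locally constant if around each point there are local coordinates in which it has constant components. *)

theory Defs
  imports "HOL-Analysis.Analysis"
begin

section \<open>Smooth maps between normed spaces\<close>

primrec Ck_on :: "nat \<Rightarrow> ('e::real_normed_vector \<Rightarrow> 'f::real_normed_vector) \<Rightarrow> 'e set \<Rightarrow> bool"
  where
  "Ck_on 0 f S \<longleftrightarrow> continuous_on S f"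
| "Ck_on (Suc k) f S \<longleftrightarrow>
     (\<forall>x\<in>S. f differentiable (at x)) \<and> (\<forall>v. Ck_on k (\<lambda>x. frechet_derivative f (at x) v) S)"

text \<open>Only used for open \<open>S\<close> and a finite-dimensional domain, where this is the usual notion.\<close>

definition smooth_on :: "('e::real_normed_vector \<Rightarrow> 'f::real_normed_vector) \<Rightarrow> 'e set \<Rightarrow> bool"
  where "smooth_on f S \<longleftrightarrow> (\<forall>k. Ck_on k f S)"


section \<open>Smooth manifolds\<close>

text \<open>
  A chart is a pair \<open>(U, \<phi>)\<close>; the values of \<open>\<phi>\<close> outside \<open>U\<close> are irrelevant.
  A smooth structure is a maximal smooth atlas, so its members are all the local coordinate
  systems of the manifold.
\<close>

type_synonym ('a, 'n) chart = "'a set \<times> ('a \<Rightarrow> real ^ 'n)"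

abbreviation chart_dom :: "('a, 'n::finite) chart \<Rightarrow> 'a set"
  where "chart_dom c \<equiv> fst c"

abbreviation chart_map :: "('a, 'n::finite) chart \<Rightarrow> 'a \<Rightarrow> real ^ 'n"
  where "chart_map c \<equiv> snd c"

definition chart_inv :: "('a, 'n::finite) chart \<Rightarrow> real ^ 'n \<Rightarrow> 'a"
  where "chart_inv c = inv_into (chart_dom c) (chart_map c)"

definition transition :: "('a, 'n::finite) chart \<Rightarrow> ('a, 'n) chart \<Rightarrow> real ^ 'n \<Rightarrow> real ^ 'n"
  where "transition c d = chart_map d \<circ> chart_inv c"

definition is_chart :: "'a topology \<Rightarrow> ('a, 'n::finite) chart \<Rightarrow> bool"
  where "is_chart X c \<longleftrightarrow>
    openin X (chart_dom c) \<and> open (chart_map c ` chart_dom c) \<and>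
    homeomorphic_map (subtopology X (chart_dom c)) (top_of_set (chart_map c ` chart_dom c))
      (chart_map c)"

definition compatible :: "('a, 'n::finite) chart \<Rightarrow> ('a, 'n) chart \<Rightarrow> bool"
  where "compatible c d \<longleftrightarrow>
    smooth_on (transition c d) (chart_map c ` (chart_dom c \<inter> chart_dom d)) \<and>
    smooth_on (transition d c) (chart_map d ` (chart_dom c \<inter> chart_dom d))"

definition smooth_structure :: "'a topology \<Rightarrow> ('a, 'n::finite) chart set \<Rightarrow> bool"
  where "smooth_structure X A \<longleftrightarrow>
    (\<forall>c\<in>A. is_chart X c) \<and>
    (\<Union>c\<in>A. chart_dom c) = topspace X \<and>
    (\<forall>c\<in>A. \<forall>d\<in>A. compatible c d) \<and>
    (\<forall>c. is_chart X c \<and> (\<forall>d\<in>A. compatible c d) \<longrightarrow> c \<in> A)"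

definition smooth_manifold :: "'a topology \<Rightarrow> ('a, 'n::finite) chart set \<Rightarrow> bool"
  where "smooth_manifold X A \<longleftrightarrow>
    Hausdorff_space X \<and> second_countable X \<and> smooth_structure X A"


section \<open>Tangent spaces\<close>

text \<open>
  A tangent vector at \<open>x\<close> is a family of vectors in \<open>\<real>\<^sup>n\<close>, one for each chart around \<open>x\<close>,
  that transforms by the derivatives of the transition maps. It is set to \<open>0\<close> on all other
  charts, which makes it unique as a function. The vector space operations are pointwise; they
  are spelled out because functions are not an instance of \<^class>\<open>real_vector\<close>.
\<close>

type_synonym ('a, 'n) tangent = "('a, 'n) chart \<Rightarrow> real ^ 'n"

definition charts_at :: "('a, 'n::finite) chart set \<Rightarrow> 'a \<Rightarrow> ('a, 'n) chart set"
  where "charts_at A x = {c \<in> A. x \<in> chart_dom c}"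

definition tangent_space ::
    "('a, 'n::finite) chart set \<Rightarrow> 'a \<Rightarrow> ('a, 'n) tangent set"
  where "tangent_space A x =
    {v. (\<forall>c. c \<notin> charts_at A x \<longrightarrow> v c = 0) \<and>
        (\<forall>c\<in>charts_at A x. \<forall>d\<in>charts_at A x.
           v d = frechet_derivative (transition c d) (at (chart_map c x)) (v c))}"

definition tlincomb ::
    "real \<Rightarrow> ('a, 'n::finite) tangent \<Rightarrow> real \<Rightarrow> ('a, 'n) tangent \<Rightarrow> ('a, 'n) tangent"
  where "tlincomb s v t w = (\<lambda>c. s *\<^sub>R v c + t *\<^sub>R w c)"

definition tangent_iso ::
    "('a, 'n::finite) chart set \<Rightarrow> 'a \<Rightarrow> 'a \<Rightarrow> (('a, 'n) tangent \<Rightarrow> ('a, 'n) tangent) \<Rightarrow> bool"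
  where "tangent_iso A x y L \<longleftrightarrow>
    bij_betw L (tangent_space A x) (tangent_space A y) \<and>
    (\<forall>v\<in>tangent_space A x. \<forall>w\<in>tangent_space A x. \<forall>s t.
       L (tlincomb s v t w) = tlincomb s (L v) t (L w))"

text \<open>The tangent vector at \<open>x\<close> whose components in the chart \<open>c\<close> are \<open>w\<close>.\<close>

definition tangent_of ::
    "('a, 'n::finite) chart set \<Rightarrow> ('a, 'n) chart \<Rightarrow> 'a \<Rightarrow> real ^ 'n \<Rightarrow> ('a, 'n) tangent"
  where "tangent_of A c x w =
    (\<lambda>d. if d \<in> charts_at A x
         then frechet_derivative (transition c d) (at (chart_map c x)) w else 0)"

definition coord_vector ::
    "('a, 'n::finite) chart set \<Rightarrow> ('a, 'n) chart \<Rightarrow> 'n \<Rightarrow> 'a \<Rightarrow> ('a, 'n) tangent"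
  where "coord_vector A c i x = tangent_of A c x (axis i 1)"

lemma chart_inv_map:
  assumes "is_chart X c" "x \<in> chart_dom c"
  shows "chart_inv c (chart_map c x) = x"
proof -
  have "topspace (subtopology X (chart_dom c)) = chart_dom c"
    using assms(1) openin_subset[of X "chart_dom c"]
    by (simp add: is_chart_def Int_absorb1)
  moreover have "inj_on (chart_map c) (topspace (subtopology X (chart_dom c)))"
    using assms(1) unfolding is_chart_def by (elim conjE) (rule homeomorphic_imp_injective_map)
  ultimately have "inj_on (chart_map c) (chart_dom c)"
    by simp
  then show ?thesis using assms by (simp add: chart_inv_def)
qed

lemma open_chart_image:
  assumes c: "is_chart X c"
    and W: "openin X W"
  shows "open (chart_map c ` (chart_dom c \<inter> W))"
proof -
  have "open_map (subtopology X (chart_dom c)) (top_of_set (chart_map c ` chart_dom c)) (chart_map c)"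
    using c unfolding is_chart_def by (elim conjE) (rule homeomorphic_imp_open_map)
  moreover have "openin (subtopology X (chart_dom c)) (chart_dom c \<inter> W)"
    using W by (simp add: openin_subtopology_Int2)
  ultimately have "openin (top_of_set (chart_map c ` chart_dom c)) (chart_map c ` (chart_dom c \<inter> W))"
    unfolding open_map_def by blast
  moreover have "open (chart_map c ` chart_dom c)"
    using c by (simp add: is_chart_def)
  ultimately show ?thesis by (rule openin_open_trans)
qed

lemma smooth_structure_chart: "smooth_structure X A \<Longrightarrow> c \<in> A \<Longrightarrow> is_chart X c"
  unfolding smooth_structure_def by (elim conjE) (erule bspec)

lemma smooth_structure_compatible:
  assumes "smooth_structure X A" "c \<in> A" "d \<in> A"
  shows "compatible c d"
proof -
  have "\<forall>c\<in>A. \<forall>d\<in>A. compatible c d"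
    using assms(1) unfolding smooth_structure_def by (elim conjE)
  then show ?thesis using assms(2,3) by simp
qed

lemma transition_differentiable:
  assumes "smooth_structure X A" "c \<in> charts_at A x" "d \<in> charts_at A x"
  shows "transition c d differentiable (at (chart_map c x))"
proof -
  have cd: "c \<in> A" "d \<in> A" "x \<in> chart_dom c \<inter> chart_dom d"
    using assms(2,3) by (simp_all add: charts_at_def)
  have "smooth_on (transition c d) (chart_map c ` (chart_dom c \<inter> chart_dom d))"
    using smooth_structure_compatible[OF assms(1) cd(1,2)] by (simp add: compatible_def)
  then have "Ck_on (Suc 0) (transition c d) (chart_map c ` (chart_dom c \<inter> chart_dom d))"
    unfolding smooth_on_def by blast
  then show ?thesis using cd(3) by (simp only: Ck_on.simps) blast
qed

lemma transition_cocycle: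
  assumes S: "smooth_structure X A"
    and c: "c \<in> charts_at A x" and d: "d \<in> charts_at A x" and e: "e \<in> charts_at A x"
  shows "frechet_derivative (transition c e) (at (chart_map c x)) =
         frechet_derivative (transition d e) (at (chart_map d x)) \<circ>
         frechet_derivative (transition c d) (at (chart_map c x))"
proof -
  have ch: "is_chart X c" "is_chart X d" "is_chart X e"
    and x: "x \<in> chart_dom c" "x \<in> chart_dom d" "x \<in> chart_dom e"
    using smooth_structure_chart[OF S] c d e by (simp_all add: charts_at_def)
  have tx: "transition c d (chart_map c x) = chart_map d x"
    using chart_inv_map[OF ch(1) x(1)] by (simp add: transition_def)
  let ?W = "chart_map c ` (chart_dom c \<inter> chart_dom d)"
  have o: "open ?W" using open_chart_image[OF ch(1)] ch(2) by (simp add: is_chart_def)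
  let ?u = "chart_map c x"
  let ?F = "frechet_derivative (transition c d) (at ?u)"
  let ?G = "frechet_derivative (transition d e) (at (chart_map d x))"
  have "(transition c d has_derivative ?F) (at ?u)"
    using transition_differentiable[OF S c d] by (simp add: frechet_derivative_works)
  moreover have "(transition d e has_derivative ?G) (at (transition c d ?u))"
    using transition_differentiable[OF S d e] by (simp add: tx frechet_derivative_works)
  ultimately have "(transition d e \<circ> transition c d has_derivative ?G \<circ> ?F) (at ?u)"
    by (rule diff_chain_at)
  then have "(transition c e has_derivative ?G \<circ> ?F) (at ?u)"
  proof (rule has_derivative_transform_within_open[OF _ o])
    show "chart_map c x \<in> ?W" using x by blast
    fix u assume "u \<in> ?W"
    then obtain y where "u = chart_map c y" "y \<in> chart_dom c" "y \<in> chart_dom d" by blast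
    then show "(transition d e \<circ> transition c d) u = transition c e u"
      using chart_inv_map[OF ch(1)] chart_inv_map[OF ch(2)] by (simp add: transition_def)
  qed
  then show ?thesis by (rule frechet_derivative_at[symmetric])
qed

lemma transition_refl:
  assumes S: "smooth_structure X A" and c: "c \<in> charts_at A x"
  shows "frechet_derivative (transition c c) (at (chart_map c x)) = id"
proof -
  have ch: "is_chart X c" and x: "x \<in> chart_dom c"
    using smooth_structure_chart[OF S] c by (simp_all add: charts_at_def)
  have "(id has_derivative id) (at (chart_map c x))" by (simp add: id_def)
  then have "(transition c c has_derivative id) (at (chart_map c x))"
  proof (rule has_derivative_transform_within_open)
    show "open (chart_map c ` chart_dom c)" using ch by (simp add: is_chart_def)
    show "chart_map c x \<in> chart_map c ` chart_dom c" using x by blast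
    fix u assume "u \<in> chart_map c ` chart_dom c"
    then show "id u = transition c c u" using chart_inv_map[OF ch] by (auto simp: transition_def)
  qed
  then show ?thesis by (rule frechet_derivative_at[symmetric])
qed

text \<open>Each chart around \<open>x\<close> identifies the tangent space with \<open>\<real>\<^sup>n\<close>.\<close>

lemma tangent_of_bij:
  assumes S: "smooth_structure X A" and c: "c \<in> charts_at A x"
  shows "bij_betw (tangent_of A c x) UNIV (tangent_space A x)"
proof (rule bij_betw_byWitness[where f' = "\<lambda>v. v c"])
  show "\<forall>w\<in>UNIV. tangent_of A c x w c = w"
    using c transition_refl[OF S c] by (simp add: tangent_of_def)
  show "\<forall>v\<in>tangent_space A x. tangent_of A c x (v c) = v"
  proof (intro ballI ext)
    fix v d assume v: "v \<in> tangent_space A x"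
    show "tangent_of A c x (v c) d = v d"
    proof (cases "d \<in> charts_at A x")
      case True
      then have "v d = frechet_derivative (transition c d) (at (chart_map c x)) (v c)"
        using v c unfolding tangent_space_def by blast
      with True show ?thesis by (simp add: tangent_of_def)
    next
      case False
      then have "v d = 0" using v unfolding tangent_space_def by blast
      with False show ?thesis by (simp add: tangent_of_def)
    qed
  qed
  show "tangent_of A c x ` UNIV \<subseteq> tangent_space A x"
  proof (intro image_subsetI)
    fix w
    have "tangent_of A c x w e =
        frechet_derivative (transition d e) (at (chart_map d x)) (tangent_of A c x w d)"
      if "d \<in> charts_at A x" "e \<in> charts_at A x" for d e
      using transition_cocycle[OF S c that] that by (simp add: tangent_of_def)
    moreover have "tangent_of A c x w d = 0" if "d \<notin> charts_at A x" for d
      using that by (simp add: tangent_of_def)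
    ultimately show "tangent_of A c x w \<in> tangent_space A x"
      unfolding tangent_space_def by blast
  qed
  show "(\<lambda>v. v c) ` tangent_space A x \<subseteq> UNIV" by simp
qed


section \<open>Differential forms\<close>

text \<open>
  The value of a \<open>q\<close>-form at a point is a function on lists of tangent vectors; only its values
  on lists of length \<open>q\<close> of vectors tangent at that point matter.
\<close>

type_synonym ('a, 'n) form = "'a \<Rightarrow> ('a, 'n) tangent list \<Rightarrow> real"

definition tangent_lists ::
    "('a, 'n::finite) chart set \<Rightarrow> nat \<Rightarrow> 'a \<Rightarrow> ('a, 'n) tangent list set"
  where "tangent_lists A q x = {vs. length vs = q \<and> set vs \<subseteq> tangent_space A x}"

definition alternating_at ::
    "('a, 'n::finite) chart set \<Rightarrow> nat \<Rightarrow> 'a \<Rightarrow> (('a, 'n) tangent list \<Rightarrow> real) \<Rightarrow> bool"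
  where "alternating_at A q x \<omega> \<longleftrightarrow>
    (\<forall>vs\<in>tangent_lists A q x. \<forall>i<q. \<forall>v\<in>tangent_space A x. \<forall>w\<in>tangent_space A x. \<forall>s t.
       \<omega> (vs[i := tlincomb s v t w]) = s * \<omega> (vs[i := v]) + t * \<omega> (vs[i := w])) \<and>
    (\<forall>vs\<in>tangent_lists A q x. \<forall>i<q. \<forall>j<q. i \<noteq> j \<and> vs ! i = vs ! j \<longrightarrow> \<omega> vs = 0)"

definition component ::
    "('a, 'n::finite) chart set \<Rightarrow> ('a, 'n) form \<Rightarrow> ('a, 'n) chart \<Rightarrow> 'n list \<Rightarrow> 'a \<Rightarrow> real"
  where "component A \<zeta> c is x = \<zeta> x (map (\<lambda>i. coord_vector A c i x) is)"

definition differential_form ::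
    "'a topology \<Rightarrow> ('a, 'n::finite) chart set \<Rightarrow> nat \<Rightarrow> ('a, 'n) form \<Rightarrow> bool"
  where "differential_form X A q \<zeta> \<longleftrightarrow>
    (\<forall>x\<in>topspace X. alternating_at A q x (\<zeta> x)) \<and>
    (\<forall>c\<in>A. \<forall>is. length is = q \<longrightarrow>
       smooth_on (component A \<zeta> c is \<circ> chart_inv c) (chart_map c ` chart_dom c))"

text \<open>
  The exterior derivative of a form on an open subset of \<open>\<real>\<^sup>n\<close>, evaluated on constant vector
  fields (whose Lie brackets vanish).
\<close>

definition euclidean_d ::
    "(real ^ 'n \<Rightarrow> (real ^ 'n::finite) list \<Rightarrow> real) \<Rightarrow> real ^ 'n \<Rightarrow> (real ^ 'n) list \<Rightarrow> real"
  where "euclidean_d \<omega> u ws =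
    (\<Sum>i<length ws. (-1) ^ i *
       frechet_derivative (\<lambda>y. \<omega> y (take i ws @ drop (Suc i) ws)) (at u) (ws ! i))"

definition local_form ::
    "('a, 'n::finite) chart set \<Rightarrow> ('a, 'n) form \<Rightarrow> ('a, 'n) chart
      \<Rightarrow> real ^ 'n \<Rightarrow> (real ^ 'n) list \<Rightarrow> real"
  where "local_form A \<zeta> c u ws = \<zeta> (chart_inv c u) (map (tangent_of A c (chart_inv c u)) ws)"

text \<open>\<open>\<eta> = d\<zeta>\<close>: in every chart, \<open>\<eta>\<close> is given by the coordinate formula for the derivative.\<close>

definition is_exterior_derivative ::
    "'a topology \<Rightarrow> ('a, 'n::finite) chart set \<Rightarrow> nat \<Rightarrow> ('a, 'n) form \<Rightarrow> ('a, 'n) form \<Rightarrow> bool"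
  where "is_exterior_derivative X A q \<zeta> \<eta> \<longleftrightarrow>
    differential_form X A (Suc q) \<eta> \<and>
    (\<forall>c\<in>A. \<forall>u\<in>chart_map c ` chart_dom c. \<forall>ws. length ws = Suc q \<longrightarrow>
       local_form A \<eta> c u ws = euclidean_d (local_form A \<zeta> c) u ws)"

definition closed_form ::
    "'a topology \<Rightarrow> ('a, 'n::finite) chart set \<Rightarrow> nat \<Rightarrow> ('a, 'n) form \<Rightarrow> bool"
  where "closed_form X A q \<zeta> \<longleftrightarrow> is_exterior_derivative X A q \<zeta> (\<lambda>x vs. 0)"

definition algebraically_constant ::
    "'a topology \<Rightarrow> ('a, 'n::finite) chart set \<Rightarrow> nat \<Rightarrow> ('a, 'n) form \<Rightarrow> bool"
  where "algebraically_constant X A q \<zeta> \<longleftrightarrow>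
    (\<forall>x\<in>topspace X. \<forall>y\<in>topspace X. \<exists>L. tangent_iso A x y L \<and>
       (\<forall>vs\<in>tangent_lists A q x. \<zeta> y (map L vs) = \<zeta> x vs))"

definition locally_constant_form ::
    "'a topology \<Rightarrow> ('a, 'n::finite) chart set \<Rightarrow> nat \<Rightarrow> ('a, 'n) form \<Rightarrow> bool"
  where "locally_constant_form X A q \<zeta> \<longleftrightarrow>
    (\<forall>p\<in>topspace X. \<exists>c\<in>charts_at A p. \<forall>is. length is = q \<longrightarrow>
       (\<forall>x\<in>chart_dom c. \<forall>y\<in>chart_dom c. component A \<zeta> c is x = component A \<zeta> c is y))"

end

theory Submission
  imports Defs
begin

text \<open>
  The vectors \<open>v\<close> with \<open>\<iota>\<^sub>v \<zeta> = 0\<close> form a distribution of constant rank, since \<open>\<zeta>\<close> is algebraically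
  constant. If \<open>\<partial>\<^sub>j\<close>, \<open>j \<in> J\<close>, lie in the kernel, then \<open>d\<zeta> = 0\<close> makes the components of \<open>\<zeta>\<close> independent of
  these coordinates; a further kernel field can therefore be chosen independent of them, and its flow box
  adds one more coordinate vector to the kernel. In this way the kernel is spanned by \<open>\<partial>\<^sub>j\<close>, \<open>j \<in> J\<close>.

  For \<open>q \<in> {1, n - 1, n}\<close> and \<open>\<zeta> \<noteq> 0\<close> the kernel has rank \<open>n - q\<close>, so \<open>\<zeta>\<close> has a single component \<open>f\<close>, which is
  turned into \<open>1\<close> by replacing one transversal coordinate \<open>x\<^sub>i\<close> by a primitive of \<open>f\<close> along \<open>x\<^sub>i\<close>.

  For \<open>q = 2\<close>, let \<open>X\<close> be the Hamiltonian field of a transversal coordinate \<open>x\<^sub>i\<close> and \<open>t\<close> a coordinate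
  with \<open>X = \<partial>\<^sub>t\<close> that is constant on the kernel. Then \<open>\<zeta> + dx\<^sub>i \<and> dt\<close> is closed of rank smaller by two, and
  induction gives \<open>\<zeta> = \<Sum> df\<^sub>k \<and> dg\<^sub>k\<close> with as many independent differentials as the rank of \<open>\<zeta>\<close>.
\<close>

section \<open>Sequences of smooth maps\<close>

text \<open>For q > 0 algebraic constancy is used only to know that the kernel has constant
  dimension. In other degrees the dimension of the kernel need not fix the linear type. The flow box
  has to do more than carry a coordinate vector to the given field: it must also leave alone every
  other coordinate direction in which the field is constant, since otherwise the kernel directions
  straightened earlier would be lost. This is read off the Picard iterates. The induction for q = 2
  splits off one product of differentials at a time and needs neither a primitive of the form nor an
  isotopy. It does not keep track of independence; it only counts the products. As their number is
  half the rank, the differentials turn out to be independent for dimension reasons.\<close>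

text \<open>
  Closure properties are proved for sequences whose derivatives up to order \<open>k\<close> converge locally
  uniformly. Constant sequences give the same properties of \<^const>\<open>Ck_on\<close>, and Picard iterates are
  seen to have a smooth limit without differentiating a fixed point equation.
\<close>

definition lu_conv :: "(nat \<Rightarrow> 'e::euclidean_space \<Rightarrow> 'f::euclidean_space) \<Rightarrow> 'e set \<Rightarrow> bool"
  where "lu_conv f S \<longleftrightarrow> (\<forall>m. continuous_on S (f m)) \<and>
    (\<forall>K. compact K \<longrightarrow> K \<subseteq> S \<longrightarrow> uniformly_convergent_on K f)"

lemma lu_convI:
  assumes "\<And>m. continuous_on S (f m)"
    and "\<And>K. compact K \<Longrightarrow> K \<subseteq> S \<Longrightarrow> uniformly_convergent_on K f"
  shows "lu_conv f S"
  using assms by (simp add: lu_conv_def)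

lemma lu_convD:
  assumes "lu_conv f S"
  shows "continuous_on S (f m)"
    and "compact K \<Longrightarrow> K \<subseteq> S \<Longrightarrow> uniformly_convergent_on K f"
  using assms by (simp_all add: lu_conv_def)

text \<open>Derivatives are taken in fixed directions, as in \<open>Ck_on\<close>, so that all
  orders are again sequences of maps between the same two spaces, and a constant sequence satisfies
  this exactly when its member satisfies \<open>Ck_on\<close>.\<close>

primrec seqC :: "nat \<Rightarrow> (nat \<Rightarrow> 'e::euclidean_space \<Rightarrow> 'f::euclidean_space) \<Rightarrow> 'e set \<Rightarrow> bool"
  where
  "seqC 0 f S \<longleftrightarrow> lu_conv f S"
| "seqC (Suc k) f S \<longleftrightarrow> lu_conv f S \<and> (\<forall>m. \<forall>x\<in>S. f m differentiable (at x)) \<and>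
     (\<forall>v. seqC k (\<lambda>m x. frechet_derivative (f m) (at x) v) S)"

lemma linear_basis_expansion:
  fixes L :: "'e::euclidean_space \<Rightarrow> 'f::real_vector"
  assumes "linear L"
  shows "L h = (\<Sum>b\<in>Basis. (h \<bullet> b) *\<^sub>R L b)"
proof -
  have "L h = L (\<Sum>b\<in>Basis. (h \<bullet> b) *\<^sub>R b)" by (simp add: euclidean_representation)
  then show ?thesis using assms by (simp add: linear_sum linear_cmul)
qed

lemma lu_conv_limit:
  assumes "lu_conv f S" "compact K" "K \<subseteq> S"
  obtains F where "uniform_limit K f F sequentially" "continuous_on K F" "bounded (F ` K)"
proof -
  obtain F where F: "uniform_limit K f F sequentially"
    using assms unfolding lu_conv_def uniformly_convergent_on_def by blast
  have "\<And>m. continuous_on K (f m)"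
    using assms unfolding lu_conv_def by (blast intro: continuous_on_subset)
  then have "continuous_on K F"
    by (intro uniform_limit_theorem[OF _ F]) auto
  moreover have "bounded (F ` K)"
    using compact_continuous_image[OF \<open>continuous_on K F\<close> \<open>compact K\<close>] compact_imp_bounded by blast
  ultimately show ?thesis using F that by blast
qed

lemma lu_conv_cong:
  assumes "\<And>m x. x \<in> S \<Longrightarrow> f m x = g m x"
  shows "lu_conv f S \<longleftrightarrow> lu_conv g S"
proof -
  have "continuous_on S (f m) \<longleftrightarrow> continuous_on S (g m)" for m
    using assms by (intro continuous_on_cong) auto
  moreover have "uniformly_convergent_on K f \<longleftrightarrow> uniformly_convergent_on K g" if "K \<subseteq> S" for K
    using assms that by (intro uniformly_convergent_cong) (auto intro!: always_eventually)
  ultimately show ?thesis unfolding lu_conv_def by blast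
qed

lemma lu_conv_const: "continuous_on S g \<Longrightarrow> lu_conv (\<lambda>m. g) S"
  by (simp add: lu_conv_def uniformly_convergent_on_const)

lemma lu_conv_shift:
  assumes "lu_conv (\<lambda>m. f (Suc m)) S" "continuous_on S (f 0)"
  shows "lu_conv f S"
proof -
  have "continuous_on S (f m)" for m
    using assms unfolding lu_conv_def by (cases m) auto
  moreover have "uniformly_convergent_on K f" if K: "compact K" "K \<subseteq> S" for K
  proof -
    obtain F where F: "uniform_limit K (\<lambda>m. f (Suc m)) F sequentially"
      using assms K unfolding lu_conv_def uniformly_convergent_on_def by blast
    then have "uniform_limit K f F sequentially"
      unfolding uniform_limit_iff by (subst eventually_sequentially_Suc[symmetric]) blast
    then show ?thesis unfolding uniformly_convergent_on_def by blast
  qed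
  ultimately show ?thesis unfolding lu_conv_def by blast
qed

lemma lu_conv_bounded_linear:
  assumes "bounded_linear L" "lu_conv f S"
  shows "lu_conv (\<lambda>m x. L (f m x)) S"
  by (intro lu_convI bounded_linear.continuous_on[OF assms(1)] bounded_linear.uniformly_convergent_on[OF assms(1)]
      lu_convD[OF assms(2)])

lemma lu_conv_add:
  assumes "lu_conv f S" "lu_conv g S"
  shows "lu_conv (\<lambda>m x. f m x + g m x) S"
proof (rule lu_convI)
  show "continuous_on S (\<lambda>x. f m x + g m x)" for m
    by (intro continuous_on_add lu_convD[OF assms(1)] lu_convD[OF assms(2)])
  fix K assume K: "compact K" "K \<subseteq> S"
  obtain F where F: "uniform_limit K f F sequentially"
    using lu_convD(2)[OF assms(1) K] unfolding uniformly_convergent_on_def by blast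
  obtain G where G: "uniform_limit K g G sequentially"
    using lu_convD(2)[OF assms(2) K] unfolding uniformly_convergent_on_def by blast
  show "uniformly_convergent_on K (\<lambda>m x. f m x + g m x)"
    using uniform_limit_add[OF F G] by (rule uniformly_convergentI)
qed

lemma lu_conv_bilinear:
  assumes "bounded_bilinear pr" "lu_conv f S" "lu_conv g S"
  shows "lu_conv (\<lambda>m x. pr (f m x) (g m x)) S"
proof -
  interpret bounded_bilinear pr by fact
  have "uniformly_convergent_on K (\<lambda>m x. pr (f m x) (g m x))" if K: "compact K" "K \<subseteq> S" for K
  proof -
    obtain F where F: "uniform_limit K f F sequentially" "bounded (F ` K)"
      using lu_conv_limit[OF assms(2) K] by metis
    obtain G where G: "uniform_limit K g G sequentially" "bounded (G ` K)"
      using lu_conv_limit[OF assms(3) K] by metis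
    show ?thesis
      using bounded_uniform_limit[OF F(1) G(1) G(2) F(2)] unfolding uniformly_convergent_on_def by blast
  qed
  then show ?thesis
    by (intro lu_convI continuous_on lu_convD(1)[OF assms(2)] lu_convD(1)[OF assms(3)])
qed

text \<open>The uniformity in \<open>m\<close> is what composition needs: a map continuous on an
  open set is known to be uniformly continuous only on compact subsets, so one compact set has to
  contain the images under all members.\<close>

definition tame_range :: "(nat \<Rightarrow> 'e::euclidean_space \<Rightarrow> 'f::euclidean_space) \<Rightarrow> 'e set \<Rightarrow> 'f set \<Rightarrow> bool"
  where "tame_range f S U \<longleftrightarrow>
    (\<forall>K. compact K \<longrightarrow> K \<subseteq> S \<longrightarrow> (\<exists>K'. compact K' \<and> K' \<subseteq> U \<and> (\<forall>m. f m ` K \<subseteq> K')))"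

lemma tame_range_const:
  assumes "continuous_on S f" "f ` S \<subseteq> U"
  shows "tame_range (\<lambda>m. f) S U"
  unfolding tame_range_def
proof (intro allI impI)
  fix K assume K: "compact K" "K \<subseteq> S"
  have "compact (f ` K)" using K assms(1) continuous_on_subset compact_continuous_image by blast
  then show "\<exists>K'. compact K' \<and> K' \<subseteq> U \<and> (\<forall>m::nat. f ` K \<subseteq> K')" using K assms(2) by blast
qed

lemma tame_range_subset: "tame_range f S U \<Longrightarrow> f m ` S \<subseteq> U"
proof
  fix y assume t: "tame_range f S U" and "y \<in> f m ` S"
  then obtain x where x: "x \<in> S" "y = f m x" by blast
  have "compact {x}" "{x} \<subseteq> S" using x by auto
  then show "y \<in> U" using t x(2) unfolding tame_range_def by blast
qed

lemma lu_conv_compose: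
  assumes "continuous_on U g" "lu_conv f S" "tame_range f S U"
  shows "lu_conv (\<lambda>m x. g (f m x)) S"
proof -
  have "continuous_on S (\<lambda>x. g (f m x))" for m
    using continuous_on_compose2[OF assms(1) lu_convD(1)[OF assms(2)] tame_range_subset[OF assms(3)]] .
  moreover have "uniformly_convergent_on K (\<lambda>m x. g (f m x))" if K: "compact K" "K \<subseteq> S" for K
  proof -
    obtain K' where K': "compact K'" "K' \<subseteq> U" "\<And>m. f m ` K \<subseteq> K'"
      using assms(3) K unfolding tame_range_def by meson
    show ?thesis
    proof (rule uniformly_convergent_on_compose_uniformly_continuous_on[where B = K'])
      show "uniformly_convergent_on K f" using lu_convD(2)[OF assms(2) K] .
      show "uniformly_continuous_on K' g"
        using K' assms(1) compact_uniformly_continuous continuous_on_subset by blast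
      show "\<forall>\<^sub>F m in sequentially. \<forall>y\<in>K. f m y \<in> K'" using K'(3) by (intro always_eventually) blast
      show "closed K'" using K' compact_imp_closed by blast
    qed
  qed
  ultimately show ?thesis unfolding lu_conv_def by blast
qed

lemma lu_conv_subset: "lu_conv f S \<Longrightarrow> T \<subseteq> S \<Longrightarrow> lu_conv f T"
  unfolding lu_conv_def by (meson continuous_on_subset order_trans)

lemma seqC_lu_conv: "seqC k f S \<Longrightarrow> lu_conv f S"
  by (cases k) auto

lemma seqC_SucD: "seqC (Suc k) f S \<Longrightarrow> seqC k f S"
proof (induction k arbitrary: f)
  case 0
  then show ?case by simp
next
  case (Suc k)
  have "lu_conv f S" "\<forall>m. \<forall>x\<in>S. f m differentiable (at x)"
    and v: "\<forall>v. seqC (Suc k) (\<lambda>m x. frechet_derivative (f m) (at x) v) S"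
    using Suc.prems unfolding seqC.simps(2)[of "Suc k"] by auto
  moreover have "\<forall>v. seqC k (\<lambda>m x. frechet_derivative (f m) (at x) v) S"
    using v Suc.IH by blast
  ultimately show ?case unfolding seqC.simps by blast
qed

lemma seqC_cong:
  assumes "open S"
  shows "(\<And>m x. x \<in> S \<Longrightarrow> f m x = g m x) \<Longrightarrow> seqC k f S \<Longrightarrow> seqC k g S"
proof (induction k arbitrary: f g)
  case 0
  then show ?case using lu_conv_cong[of S f g] by simp
next
  case (Suc k)
  have lu: "lu_conv g S" using Suc.prems lu_conv_cong[of S f g] by simp
  have d: "(g m has_derivative frechet_derivative (f m) (at x)) (at x)" if "x \<in> S" for m x
  proof (rule has_derivative_transform_within_open[OF _ assms that])
    show "(f m has_derivative frechet_derivative (f m) (at x)) (at x)"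
      using Suc.prems(2) that by (simp add: frechet_derivative_works)
  qed (use Suc.prems in auto)
  have "seqC k (\<lambda>m x. frechet_derivative (g m) (at x) v) S" for v
  proof (rule Suc.IH)
    show "seqC k (\<lambda>m x. frechet_derivative (f m) (at x) v) S" using Suc.prems(2) by simp
    show "frechet_derivative (f m) (at x) v = frechet_derivative (g m) (at x) v" if "x \<in> S" for m x
      using frechet_derivative_at[OF d[OF that]] by simp
  qed
  then show ?case using lu d by (auto simp: differentiable_def)
qed

lemma seqC_SucI:
  assumes "open S" "lu_conv f S"
    and d: "\<And>m x. x \<in> S \<Longrightarrow> (f m has_derivative f' m x) (at x)"
    and "\<And>v. seqC k (\<lambda>m x. f' m x v) S"
  shows "seqC (Suc k) f S"
proof -
  have "seqC k (\<lambda>m x. frechet_derivative (f m) (at x) v) S" for v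
    by (rule seqC_cong[OF assms(1) _ assms(4)]) (simp add: frechet_derivative_at[OF d, symmetric])
  then show ?thesis using assms(2) d by (auto simp: differentiable_def)
qed

lemma seqC_deriv:
  assumes "seqC (Suc k) f S"
  shows "x \<in> S \<Longrightarrow> (f m has_derivative frechet_derivative (f m) (at x)) (at x)"
    and "seqC k (\<lambda>m x. frechet_derivative (f m) (at x) v) S"
  using assms by (simp_all add: frechet_derivative_works)

lemma seqC_const: "open S \<Longrightarrow> seqC k (\<lambda>m x. c) S"
proof (induction k arbitrary: c)
  case (Suc k)
  then show ?case
    by (intro seqC_SucI[where f' = "\<lambda>m x v. 0"]) (auto intro: lu_conv_const)
qed (auto intro: lu_conv_const)

lemma seqC_bounded_linear:
  assumes L: "bounded_linear L" and "open S"
  shows "seqC k f S \<Longrightarrow> seqC k (\<lambda>m x. L (f m x)) S"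
proof (induction k arbitrary: f)
  case 0
  then show ?case using lu_conv_bounded_linear[OF L] by simp
next
  case (Suc k)
  show ?case
    by (rule seqC_SucI[OF \<open>open S\<close> lu_conv_bounded_linear[OF L seqC_lu_conv[OF Suc.prems]]
          bounded_linear.has_derivative[OF L seqC_deriv(1)[OF Suc.prems]]
          Suc.IH[OF seqC_deriv(2)[OF Suc.prems]]])
qed

lemma seqC_add:
  assumes "open S"
  shows "seqC k f S \<Longrightarrow> seqC k g S \<Longrightarrow> seqC k (\<lambda>m x. f m x + g m x) S"
proof (induction k arbitrary: f g)
  case 0
  then show ?case using lu_conv_add by simp
next
  case (Suc k)
  show ?case
    by (rule seqC_SucI[OF \<open>open S\<close> lu_conv_add[OF seqC_lu_conv[OF Suc.prems(1)] seqC_lu_conv[OF Suc.prems(2)]]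
          has_derivative_add[OF seqC_deriv(1)[OF Suc.prems(1)] seqC_deriv(1)[OF Suc.prems(2)]]
          Suc.IH[OF seqC_deriv(2)[OF Suc.prems(1)] seqC_deriv(2)[OF Suc.prems(2)]]])
qed

lemma seqC_bilinear:
  assumes P: "bounded_bilinear pr" and "open S"
  shows "seqC k f S \<Longrightarrow> seqC k g S \<Longrightarrow> seqC k (\<lambda>m x. pr (f m x) (g m x)) S"
proof (induction k arbitrary: f g)
  case 0
  then show ?case using lu_conv_bilinear[OF P] by simp
next
  case (Suc k)
  have d: "((\<lambda>x. pr (f m x) (g m x)) has_derivative
      (\<lambda>h. pr (f m x) (frechet_derivative (g m) (at x) h) + pr (frechet_derivative (f m) (at x) h) (g m x))) (at x)"
    if "x \<in> S" for m x
    using bounded_bilinear.FDERIV[OF P seqC_deriv(1)[OF Suc.prems(1) that] seqC_deriv(1)[OF Suc.prems(2) that]] .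
  show ?case
  proof (rule seqC_SucI[OF \<open>open S\<close> _ d])
    show "lu_conv (\<lambda>m x. pr (f m x) (g m x)) S"
      using lu_conv_bilinear[OF P seqC_lu_conv[OF Suc.prems(1)] seqC_lu_conv[OF Suc.prems(2)]] .
    show "seqC k (\<lambda>m x. pr (f m x) (frechet_derivative (g m) (at x) v) +
        pr (frechet_derivative (f m) (at x) v) (g m x)) S" for v
      by (intro seqC_add[OF \<open>open S\<close>] Suc.IH seqC_deriv(2)[OF Suc.prems(1)] seqC_deriv(2)[OF Suc.prems(2)]
          seqC_SucD[OF Suc.prems(1)] seqC_SucD[OF Suc.prems(2)])
  qed
qed

lemma seqC_sum:
  assumes "open S" "finite B" "\<And>b. b \<in> B \<Longrightarrow> seqC k (f b) S"
  shows "seqC k (\<lambda>m x. \<Sum>b\<in>B. f b m x) S"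
  using assms(2,3)
proof (induction B)
  case empty
  then show ?case using seqC_const[OF assms(1)] by simp
next
  case (insert b B)
  then show ?case using seqC_add[OF assms(1), of k "f b" "\<lambda>m x. \<Sum>b\<in>B. f b m x"] by simp
qed

lemma Ck_on_deriv:
  assumes "Ck_on (Suc k) f S" "x \<in> S"
  shows "(f has_derivative frechet_derivative f (at x)) (at x)"
  using assms by (simp add: frechet_derivative_works)

lemma Ck_on_continuous: "Ck_on k f S \<Longrightarrow> continuous_on S f"
  by (cases k)
    (auto intro!: continuous_at_imp_continuous_on differentiable_imp_continuous_within)

lemma Ck_on_iff_seqC: "Ck_on k f S \<longleftrightarrow> seqC k (\<lambda>m. f) S"
proof (induction k arbitrary: f)
  case 0
  then show ?case by (auto simp: lu_conv_def uniformly_convergent_on_const)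
next
  case (Suc k)
  have "Ck_on (Suc k) f S \<Longrightarrow> lu_conv (\<lambda>m. f) S"
    using Ck_on_continuous[of "Suc k" f S] lu_conv_const by blast
  then show ?case using Suc.IH by auto
qed

text \<open>In the chain rule the direction in which \<open>g\<close> is differentiated varies with
  \<open>m\<close> and \<open>x\<close>, while \<open>seqC\<close> controls fixed directions only.
  Expanding that direction in the basis leaves products of components of \<open>Df\<close> with
  fixed partial derivatives of \<open>g\<close> along \<open>f\<close>, and the latter are covered
  by the induction hypothesis.\<close>

lemma seqC_compose:
  assumes "open S" "open U"
  shows "Ck_on k g U \<Longrightarrow> seqC k f S \<Longrightarrow> tame_range f S U \<Longrightarrow> seqC k (\<lambda>m x. g (f m x)) S"
proof (induction k arbitrary: g)
  case 0
  then show ?case using lu_conv_compose by simp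
next
  case (Suc k)
  let ?df = "\<lambda>m x. frechet_derivative (f m) (at x)"
  have fU: "f m x \<in> U" if "x \<in> S" for m x
    using tame_range_subset[OF Suc.prems(3)] that by blast
  have d: "((\<lambda>x. g (f m x)) has_derivative
      (\<lambda>v. \<Sum>b\<in>Basis. (?df m x v \<bullet> b) *\<^sub>R frechet_derivative g (at (f m x)) b)) (at x)" if "x \<in> S" for m x
  proof -
    note dg = Ck_on_deriv[OF Suc.prems(1) fU[OF that]]
    have "(g \<circ> f m has_derivative frechet_derivative g (at (f m x)) \<circ> ?df m x) (at x)"
      by (rule diff_chain_at[OF seqC_deriv(1)[OF Suc.prems(2) that] dg])
    moreover have "frechet_derivative g (at (f m x)) \<circ> ?df m x =
        (\<lambda>v. \<Sum>b\<in>Basis. (?df m x v \<bullet> b) *\<^sub>R frechet_derivative g (at (f m x)) b)"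
      unfolding comp_def by (intro ext linear_basis_expansion has_derivative_linear[OF dg])
    ultimately show ?thesis by (simp add: comp_def)
  qed
  show ?case
  proof (rule seqC_SucI[OF \<open>open S\<close> _ d])
    show "lu_conv (\<lambda>m x. g (f m x)) S"
      by (rule lu_conv_compose[OF Ck_on_continuous[OF Suc.prems(1)] seqC_lu_conv[OF Suc.prems(2)] Suc.prems(3)])
    have "seqC k (\<lambda>m x. ?df m x v \<bullet> b) S" for v b
      using seqC_bounded_linear[OF bounded_linear_inner_left \<open>open S\<close> seqC_deriv(2)[OF Suc.prems(2)]] .
    moreover have "seqC k (\<lambda>m x. frechet_derivative g (at (f m x)) b) S" for b
      using Suc.IH[of "\<lambda>z. frechet_derivative g (at z) b"] Suc.prems seqC_SucD[OF Suc.prems(2)] by simp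
    ultimately show "seqC k (\<lambda>m x. \<Sum>b\<in>Basis. (?df m x v \<bullet> b) *\<^sub>R frechet_derivative g (at (f m x)) b) S" for v
      by (intro seqC_sum[OF \<open>open S\<close>] seqC_bilinear[OF bounded_bilinear_scaleR \<open>open S\<close>]) auto
  qed
qed

text \<open>Recurrences describe the members from index 1 on; the initial member contributes only
  its own regularity.\<close>

lemma seqC_shift:
  assumes "open S"
  shows "seqC k (\<lambda>m. f (Suc m)) S \<Longrightarrow> Ck_on k (f 0) S \<Longrightarrow> seqC k f S"
proof (induction k arbitrary: f)
  case 0
  then show ?case using lu_conv_shift by auto
next
  case (Suc k)
  have "lu_conv f S"
    using lu_conv_shift[OF seqC_lu_conv[OF Suc.prems(1)] Ck_on_continuous[OF Suc.prems(2)]] .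
  moreover have "f m differentiable (at x)" if "x \<in> S" for m x
    using Suc.prems that by (cases m) auto
  moreover have "seqC k (\<lambda>m x. frechet_derivative (f m) (at x) v) S" for v
    using Suc.IH[of "\<lambda>m x. frechet_derivative (f m) (at x) v"] Suc.prems by simp
  ultimately show ?case by simp
qed

section \<open>Limits of sequences converging with their derivatives\<close>

lemma seqC_limit_deriv:
  fixes f :: "nat \<Rightarrow> 'e::euclidean_space \<Rightarrow> 'f::euclidean_space"
  assumes "open S" "seqC (Suc 0) f S" "\<And>x. x \<in> S \<Longrightarrow> (\<lambda>m. f m x) \<longlonglongrightarrow> F x" "x \<in> S"
  obtains F' where "(F has_derivative F') (at x)"
    "\<And>v. (\<lambda>m. frechet_derivative (f m) (at x) v) \<longlonglongrightarrow> F' v"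
proof -
  obtain r where r: "r > 0" "cball x r \<subseteq> S" using assms(1,4) unfolding open_contains_cball by auto
  let ?K = "cball x r" and ?df = "\<lambda>m x. frechet_derivative (f m) (at x)"
  have df: "(f m has_derivative ?df m y) (at y)" if "y \<in> S" for m y
    using seqC_deriv(1)[OF assms(2) that] .
  have "\<exists>G. uniform_limit ?K (\<lambda>m y. ?df m y b) G sequentially" for b
    using lu_convD(2)[OF seqC_lu_conv[OF seqC_deriv(2)[OF assms(2), of b]] compact_cball r(2)]
    unfolding uniformly_convergent_on_def .
  then have "\<forall>b. \<exists>G. uniform_limit ?K (\<lambda>m y. ?df m y b) G sequentially" by (rule allI)
  from choice[OF this] obtain G
    where G: "\<And>b. uniform_limit ?K (\<lambda>m y. ?df m y b) (G b) sequentially" by (elim exE) (rule that, erule spec)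
  define g' where "g' y h = (\<Sum>b\<in>Basis. (h \<bullet> b) *\<^sub>R G b y)" for y h
  have "\<exists>g. \<forall>y\<in>?K. (\<lambda>n. f n y) \<longlonglongrightarrow> g y \<and> (g has_derivative g' y) (at y within ?K)"
  proof (rule has_derivative_sequence)
    show "x \<in> ?K" using r by simp
    show "(\<lambda>n. f n x) \<longlonglongrightarrow> F x" using assms by blast
    show "(f n has_derivative ?df n y) (at y within ?K)" if "y \<in> ?K" for n y
      using df that r has_derivative_at_withinI by blast
    fix e :: real assume e: "e > 0"
    \<comment> \<open>An error \<open>?e\<close> in each basis direction adds up to an operator norm
      error \<open>e\<close>, the uniformity that \<open>has_derivative_sequence\<close> asks
      for.\<close>
    let ?e = "e / real (DIM('e))"
    have "\<forall>\<^sub>F m in sequentially. \<forall>b\<in>Basis. \<forall>y\<in>?K. dist (?df m y b) (G b y) < ?e"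
      using G e unfolding uniform_limit_iff
      by (intro eventually_ball_finite) (auto simp: divide_pos_pos)
    then show "\<forall>\<^sub>F m in sequentially. \<forall>y\<in>?K. \<forall>h. norm (?df m y h - g' y h) \<le> e * norm h"
    proof eventually_elim
      case (elim m)
      show ?case
      proof (intro ballI allI)
        fix y h assume y: "y \<in> ?K"
        have "?df m y h - g' y h = (\<Sum>b\<in>Basis. (h \<bullet> b) *\<^sub>R (?df m y b - G b y))"
          using linear_basis_expansion[OF has_derivative_linear[OF df], of y m h] y r
          by (auto simp: g'_def scaleR_diff_right sum_subtractf)
        also have "norm \<dots> \<le> (\<Sum>b\<in>(Basis::'e set). norm h * ?e)"
        proof (rule sum_norm_le)
          fix b :: 'e assume b: "b \<in> Basis"
          have "norm ((h \<bullet> b) *\<^sub>R (?df m y b - G b y)) = \<bar>h \<bullet> b\<bar> * dist (?df m y b) (G b y)"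
            by (simp add: dist_norm)
          also have "\<dots> \<le> norm h * ?e"
            using elim b y Basis_le_norm[OF b, of h] by (intro mult_mono) (auto intro: less_imp_le)
          finally show "norm ((h \<bullet> b) *\<^sub>R (?df m y b - G b y)) \<le> norm h * ?e" .
        qed
        also have "\<dots> = e * norm h" by simp
        finally show "norm (?df m y h - g' y h) \<le> e * norm h" .
      qed
    qed
  qed simp
  then obtain g where g: "\<And>y. y \<in> ?K \<Longrightarrow> (\<lambda>n. f n y) \<longlonglongrightarrow> g y"
    "\<And>y. y \<in> ?K \<Longrightarrow> (g has_derivative g' y) (at y within ?K)" by blast
  have gF: "g y = F y" if "y \<in> ?K" for y
    using g(1)[OF that] assms(3) r that LIMSEQ_unique by blast
  have xi: "x \<in> interior ?K" using r by simp
  have "(g has_derivative g' x) (at x)"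
    using g(2)[of x] r at_within_interior[OF xi] by simp
  then have "(F has_derivative g' x) (at x)"
    by (rule has_derivative_transform_within_open[of _ _ _ _ "ball x r"]) (use r gF in auto)
  moreover have "(\<lambda>m. ?df m x v) \<longlonglongrightarrow> g' x v" for v
  proof -
    have "(\<lambda>m. ?df m x b) \<longlonglongrightarrow> G b x" for b
      using tendsto_uniform_limitI[OF G] r by simp
    then have "(\<lambda>m. \<Sum>b\<in>Basis. (v \<bullet> b) *\<^sub>R ?df m x b) \<longlonglongrightarrow> g' x v"
      unfolding g'_def by (intro tendsto_intros)
    then show ?thesis using linear_basis_expansion[OF has_derivative_linear[OF df[OF assms(4)]], of _ v] by simp
  qed
  ultimately show ?thesis using that by blast
qed

lemma seqC_limit:
  fixes f :: "nat \<Rightarrow> 'e::euclidean_space \<Rightarrow> 'f::euclidean_space"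
  assumes "open S"
  shows "seqC k f S \<Longrightarrow> (\<And>x. x \<in> S \<Longrightarrow> (\<lambda>m. f m x) \<longlonglongrightarrow> F x) \<Longrightarrow> Ck_on k F S"
proof (induction k arbitrary: f F)
  case 0
  have "isCont F x" if x: "x \<in> S" for x
  proof -
    obtain r where r: "r > 0" "cball x r \<subseteq> S" using assms x unfolding open_contains_cball by auto
    obtain G where G: "uniform_limit (cball x r) f G sequentially" "continuous_on (cball x r) G"
      by (rule lu_conv_limit[OF _ compact_cball r(2)]) (use 0(1) in simp)
    have GF: "G y = F y" if y: "y \<in> ball x r" for y
    proof -
      have "y \<in> cball x r" using y by simp
      moreover from this have "(\<lambda>m. f m y) \<longlonglongrightarrow> F y" using 0(2) r(2) by blast
      ultimately show ?thesis using tendsto_uniform_limitI[OF G(1)] LIMSEQ_unique by blast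
    qed
    have "continuous_on (ball x r) G"
      by (rule continuous_on_subset[OF G(2) ball_subset_cball])
    then have "continuous_on (ball x r) F"
      by (rule continuous_on_eq) (rule GF)
    then show ?thesis using r(1) by (simp add: continuous_on_eq_continuous_at)
  qed
  then show ?case by (simp add: continuous_at_imp_continuous_on)
next
  case (Suc k)
  have 1: "seqC (Suc 0) f S" using Suc.prems(1) seqC_lu_conv[OF seqC_deriv(2)[OF Suc.prems(1)]] by simp
  have ex: "F differentiable (at x) \<and> (\<forall>v. (\<lambda>m. frechet_derivative (f m) (at x) v) \<longlonglongrightarrow> frechet_derivative F (at x) v)"
    if x: "x \<in> S" for x
  proof -
    obtain F' where F': "(F has_derivative F') (at x)"
      "\<And>v. (\<lambda>m. frechet_derivative (f m) (at x) v) \<longlonglongrightarrow> F' v"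
      using seqC_limit_deriv[OF assms 1 _ x] Suc.prems(2) by blast
    then show ?thesis using frechet_derivative_at[OF F'(1)] by (auto simp: differentiable_def)
  qed
  have "Ck_on k (\<lambda>x. frechet_derivative F (at x) v) S" for v
    by (rule Suc.IH[OF seqC_deriv(2)[OF Suc.prems(1), of v]]) (use ex in blast)
  then show ?case using ex by simp
qed

section \<open>Smooth maps\<close>

lemma seqC_imp_Ck_on: "seqC k f S \<Longrightarrow> Ck_on k (f m) S"
proof (induction k arbitrary: f)
  case 0
  then show ?case by (simp add: lu_conv_def)
next
  case (Suc k)
  have "Ck_on k (\<lambda>x. frechet_derivative (f m) (at x) v) S" for v
    by (rule Suc.IH[OF seqC_deriv(2)[OF Suc.prems]])
  then show ?case using Suc.prems by simp
qed

lemma Ck_on_cong: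
  fixes f :: "'e::euclidean_space \<Rightarrow> 'f::euclidean_space"
  assumes "open S" "\<And>x. x \<in> S \<Longrightarrow> f x = g x" "Ck_on k f S"
  shows "Ck_on k g S"
  using seqC_cong[OF assms(1), of "\<lambda>m. f" "\<lambda>m. g" k] assms(2,3) by (simp add: Ck_on_iff_seqC)

lemma Ck_on_SucI:
  fixes f :: "'e::euclidean_space \<Rightarrow> 'f::euclidean_space"
  assumes "open S" and d: "\<And>x. x \<in> S \<Longrightarrow> (f has_derivative f' x) (at x)"
    and "\<And>v. Ck_on k (\<lambda>x. f' x v) S"
  shows "Ck_on (Suc k) f S"
proof -
  have "Ck_on k (\<lambda>x. frechet_derivative f (at x) v) S" for v
    by (rule Ck_on_cong[OF assms(1) _ assms(3)]) (simp add: frechet_derivative_at[OF d, symmetric])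
  then show ?thesis using d by (auto simp: differentiable_def)
qed

lemma Ck_on_SucD:
  fixes f :: "'e::euclidean_space \<Rightarrow> 'f::euclidean_space"
  shows "Ck_on (Suc k) f S \<Longrightarrow> Ck_on k f S"
  unfolding Ck_on_iff_seqC by (rule seqC_SucD)

lemma Ck_on_compose:
  fixes f :: "'e::euclidean_space \<Rightarrow> 'f::euclidean_space" and g :: "'f \<Rightarrow> 'g::euclidean_space"
  assumes "open S" "open U" "Ck_on k g U" "Ck_on k f S" "f ` S \<subseteq> U"
  shows "Ck_on k (\<lambda>x. g (f x)) S"
  using seqC_compose[OF assms(1-3), of "\<lambda>m. f"] assms(4,5)
    tame_range_const[OF Ck_on_continuous[OF assms(4)] assms(5)] by (simp add: Ck_on_iff_seqC)

lemma Ck_on_bilinear: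
  fixes f :: "'e::euclidean_space \<Rightarrow> 'f::euclidean_space" and g :: "'e \<Rightarrow> 'g::euclidean_space"
    and pr :: "'f \<Rightarrow> 'g \<Rightarrow> 'h::euclidean_space"
  shows "bounded_bilinear pr \<Longrightarrow> open S \<Longrightarrow> Ck_on k f S \<Longrightarrow> Ck_on k g S
    \<Longrightarrow> Ck_on k (\<lambda>x. pr (f x) (g x)) S"
  unfolding Ck_on_iff_seqC by (rule seqC_bilinear)

lemma Ck_on_sum:
  fixes f :: "'i \<Rightarrow> 'e::euclidean_space \<Rightarrow> 'f::euclidean_space"
  shows "open S \<Longrightarrow> finite B \<Longrightarrow> (\<And>b. b \<in> B \<Longrightarrow> Ck_on k (f b) S) \<Longrightarrow> Ck_on k (\<lambda>x. \<Sum>b\<in>B. f b x) S"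
  unfolding Ck_on_iff_seqC by (rule seqC_sum)

lemma smooth_on_deriv:
  assumes "smooth_on f S"
  shows "x \<in> S \<Longrightarrow> (f has_derivative frechet_derivative f (at x)) (at x)"
    and "smooth_on (\<lambda>x. frechet_derivative f (at x) v) S"
proof -
  have *: "Ck_on (Suc k) f S" for k using assms unfolding smooth_on_def by blast
  show "x \<in> S \<Longrightarrow> (f has_derivative frechet_derivative f (at x)) (at x)"
    by (rule Ck_on_deriv[OF *])
  show "smooth_on (\<lambda>x. frechet_derivative f (at x) v) S"
    using * unfolding smooth_on_def by simp
qed

lemma smooth_on_continuous: "smooth_on f S \<Longrightarrow> continuous_on S f"
  unfolding smooth_on_def by (metis Ck_on.simps(1))

lemma smooth_onI_deriv:
  fixes f :: "'e::euclidean_space \<Rightarrow> 'f::euclidean_space"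
  assumes "open S" "\<And>x. x \<in> S \<Longrightarrow> (f has_derivative f' x) (at x)"
    and "\<And>v. smooth_on (\<lambda>x. f' x v) S"
  shows "smooth_on f S"
proof -
  have "Ck_on (Suc k) f S" for k
    by (rule Ck_on_SucI[OF assms(1,2)]) (use assms(3) in \<open>simp_all add: smooth_on_def\<close>)
  then have "Ck_on k f S" for k by (rule Ck_on_SucD)
  then show ?thesis by (simp add: smooth_on_def)
qed

lemma smooth_on_cong:
  fixes f :: "'e::euclidean_space \<Rightarrow> 'f::euclidean_space"
  assumes "open S" "\<And>x. x \<in> S \<Longrightarrow> f x = g x" "smooth_on f S"
  shows "smooth_on g S"
  using assms(3) Ck_on_cong[of S f g] assms(1,2) unfolding smooth_on_def by blast

lemma smooth_on_compose:
  fixes f :: "'e::euclidean_space \<Rightarrow> 'f::euclidean_space" and g :: "'f \<Rightarrow> 'g::euclidean_space"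
  assumes "open S" "open U" "smooth_on g U" "smooth_on f S" "f ` S \<subseteq> U"
  shows "smooth_on (\<lambda>x. g (f x)) S"
  using Ck_on_compose[OF assms(1,2)] assms(3-5) unfolding smooth_on_def by blast

lemma smooth_on_bilinear:
  fixes f :: "'e::euclidean_space \<Rightarrow> 'f::euclidean_space" and g :: "'e \<Rightarrow> 'g::euclidean_space"
    and pr :: "'f \<Rightarrow> 'g \<Rightarrow> 'h::euclidean_space"
  assumes "bounded_bilinear pr" "open S" "smooth_on f S" "smooth_on g S"
  shows "smooth_on (\<lambda>x. pr (f x) (g x)) S"
  using Ck_on_bilinear[OF assms(1,2)] assms(3,4) unfolding smooth_on_def by blast

lemmas smooth_on_scaleR = smooth_on_bilinear[OF bounded_bilinear_scaleR]
lemmas smooth_on_mult = smooth_on_bilinear[OF bounded_bilinear_mult[where 'a = real]]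

lemma smooth_on_sum:
  fixes f :: "'i \<Rightarrow> 'e::euclidean_space \<Rightarrow> 'f::euclidean_space"
  assumes "open S" "finite B" "\<And>b. b \<in> B \<Longrightarrow> smooth_on (f b) S"
  shows "smooth_on (\<lambda>x. \<Sum>b\<in>B. f b x) S"
  using Ck_on_sum[OF assms(1,2)] assms(3) unfolding smooth_on_def by blast

lemma smooth_on_const:
  fixes c :: "'f::euclidean_space"
  shows "open (S :: 'e::euclidean_space set) \<Longrightarrow> smooth_on (\<lambda>x. c) S"
  unfolding smooth_on_def Ck_on_iff_seqC by (blast intro: seqC_const)

lemma smooth_on_bounded_linear:
  fixes f :: "'e::euclidean_space \<Rightarrow> 'f::euclidean_space" and L :: "'f \<Rightarrow> 'g::euclidean_space"
  assumes "bounded_linear L" "open S" "smooth_on f S"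
  shows "smooth_on (\<lambda>x. L (f x)) S"
  using seqC_bounded_linear[OF assms(1,2)] assms(3) unfolding smooth_on_def Ck_on_iff_seqC by blast

lemma smooth_on_ident: "open S \<Longrightarrow> smooth_on (\<lambda>x::'e::euclidean_space. x) S"
  by (rule smooth_onI_deriv[where f' = "\<lambda>x v. v"]) (auto intro: smooth_on_const)

lemma smooth_on_add:
  fixes f g :: "'e::euclidean_space \<Rightarrow> 'f::euclidean_space"
  assumes "open S" "smooth_on f S" "smooth_on g S"
  shows "smooth_on (\<lambda>x. f x + g x) S"
  using seqC_add[OF assms(1)] assms(2,3) unfolding smooth_on_def Ck_on_iff_seqC by blast

lemma smooth_on_uminus:
  fixes f :: "'e::euclidean_space \<Rightarrow> 'f::euclidean_space"
  shows "open S \<Longrightarrow> smooth_on f S \<Longrightarrow> smooth_on (\<lambda>x. - f x) S"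
  using smooth_on_bounded_linear[OF bounded_linear_minus[OF bounded_linear_ident]] .

lemma smooth_on_diff:
  fixes f g :: "'e::euclidean_space \<Rightarrow> 'f::euclidean_space"
  assumes "open S" "smooth_on f S" "smooth_on g S"
  shows "smooth_on (\<lambda>x. f x - g x) S"
  using smooth_on_add[OF assms(1,2) smooth_on_uminus[OF assms(1,3)]] by simp

lemma smooth_on_prod:
  fixes f :: "'i \<Rightarrow> 'e::euclidean_space \<Rightarrow> real"
  assumes "open S" "finite B" "\<And>b. b \<in> B \<Longrightarrow> smooth_on (f b) S"
  shows "smooth_on (\<lambda>x. \<Prod>b\<in>B. f b x) S"
  using assms(2,3)
proof (induction B)
  case (insert b B)
  then show ?case using smooth_on_mult[OF assms(1), of "f b" "\<lambda>x. \<Prod>b\<in>B. f b x"] by simp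
qed (simp add: smooth_on_const[OF assms(1)])

lemma Ck_on_subset: "Ck_on k f S \<Longrightarrow> T \<subseteq> S \<Longrightarrow> Ck_on k f T"
  by (induction k arbitrary: f) (auto intro: continuous_on_subset)

lemma smooth_on_subset: "smooth_on f S \<Longrightarrow> T \<subseteq> S \<Longrightarrow> smooth_on f T"
  unfolding smooth_on_def by (blast intro: Ck_on_subset)

text \<open>The derivative of \<open>1 / f\<close> contains \<open>1 / f\<close> only
  undifferentiated, so order \<open>k\<close> gives order \<open>k + 1\<close>.\<close>

lemma smooth_on_inverse:
  fixes f :: "'e::euclidean_space \<Rightarrow> real"
  assumes "open S" "smooth_on f S" "\<And>x. x \<in> S \<Longrightarrow> f x \<noteq> 0"
  shows "smooth_on (\<lambda>x. inverse (f x)) S"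
proof -
  have "Ck_on k (\<lambda>x. inverse (f x)) S" for k
  proof (induction k)
    case 0
    then show ?case using smooth_on_continuous[OF assms(2)] assms(3) by (auto intro: continuous_on_inverse)
  next
    case (Suc k)
    show ?case
    proof (rule Ck_on_SucI[OF assms(1)])
      show "((\<lambda>x. inverse (f x)) has_derivative
          (\<lambda>v. (- frechet_derivative f (at x) v) * (inverse (f x) * inverse (f x)))) (at x)" if "x \<in> S" for x
        using Deriv.has_derivative_inverse[OF assms(3)[OF that] smooth_on_deriv(1)[OF assms(2) that]]
        by (simp add: mult_ac)
      show "Ck_on k (\<lambda>x. (- frechet_derivative f (at x) v) * (inverse (f x) * inverse (f x))) S" for v
        using Suc.IH smooth_on_uminus[OF assms(1) smooth_on_deriv(2)[OF assms(2)]]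
        by (intro Ck_on_bilinear[OF bounded_bilinear_mult assms(1)]) (simp_all add: smooth_on_def)
    qed
  qed
  then show ?thesis by (simp add: smooth_on_def)
qed

lemma smooth_on_divide:
  fixes f g :: "'e::euclidean_space \<Rightarrow> real"
  assumes "open S" "smooth_on f S" "smooth_on g S" "\<And>x. x \<in> S \<Longrightarrow> g x \<noteq> 0"
  shows "smooth_on (\<lambda>x. f x / g x) S"
  using smooth_on_mult[OF assms(1,2) smooth_on_inverse[OF assms(1,3,4)]] by (simp add: divide_inverse)

section \<open>Integration along a coordinate line\<close>

text \<open>For a unit vector \<open>e\<close> this runs along the segment from the projection of
  \<open>y\<close> to the hyperplane through \<open>p\<close> orthogonal to \<open>e\<close>, at
  \<open>s = 0\<close>, to \<open>y\<close> itself, at \<open>s = 1\<close>.\<close>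

definition line_pt :: "'e::euclidean_space \<Rightarrow> 'e \<Rightarrow> 'e \<Rightarrow> real \<Rightarrow> 'e"
  where "line_pt p e y s = y - ((1 - s) * ((y - p) \<bullet> e)) *\<^sub>R e"

text \<open>The integral of \<open>u\<close> along \<open>e\<close> from the hyperplane to
  \<open>y\<close>. Rescaling to \<open>{0..1}\<close> makes the domain of integration independent
  of \<open>y\<close> and takes care of the sign on either side of the hyperplane.\<close>

definition line_int :: "'e::euclidean_space \<Rightarrow> 'e \<Rightarrow> ('e \<Rightarrow> 'f::euclidean_space) \<Rightarrow> 'e \<Rightarrow> 'f"
  where "line_int p e u y = integral {0..1} (\<lambda>s. ((y - p) \<bullet> e) *\<^sub>R u (line_pt p e y s))"

lemma line_pt_1 [simp]: "line_pt p e y 1 = y"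
  by (simp add: line_pt_def)

lemma continuous_line_pt: "continuous_on A (\<lambda>(y, s). line_pt p e y s)"
  unfolding line_pt_def case_prod_beta by (intro continuous_intros)

lemma continuous_line_pt1: "continuous_on A (line_pt p e y)"
  unfolding line_pt_def by (intro continuous_intros)

text \<open>The component of \<open>y - p\<close> along \<open>e\<close> is scaled by
  \<open>s\<close> and the orthogonal one is kept, so balls around \<open>p\<close> contain the
  segments of their points.\<close>

lemma line_pt_norm:
  assumes "norm e = 1" "0 \<le> s" "s \<le> 1"
  shows "dist p (line_pt p e y s) \<le> dist p y"
proof -
  let ?z = "y - p" and ?a = "(y - p) \<bullet> e"
  have ee: "e \<bullet> e = 1" using assms by (simp add: norm_eq_1)
  have "(norm (?z - ((1 - s) * ?a) *\<^sub>R e))\<^sup>2 = (norm ?z)\<^sup>2 - (1 - s\<^sup>2) * ?a\<^sup>2"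
    unfolding power2_norm_eq_inner by (simp add: inner_diff ee inner_commute) (simp add: algebra_simps power2_eq_square)
  also have "\<dots> \<le> (norm ?z)\<^sup>2"
    using assms by (simp add: power_le_one)
  finally have "norm (?z - ((1 - s) * ?a) *\<^sub>R e) \<le> norm ?z"
    by (rule power2_le_imp_le) simp
  then show ?thesis by (simp add: line_pt_def dist_norm norm_minus_commute algebra_simps)
qed

locale line_ball =
  fixes p e :: "'e::euclidean_space" and r :: real
  assumes e [simp]: "norm e = 1"
begin

abbreviation I :: "('e \<Rightarrow> 'f::euclidean_space) \<Rightarrow> 'e \<Rightarrow> 'f" where "I \<equiv> line_int p e"

lemma ee [simp]: "e \<bullet> e = 1"
  by (simp add: dot_square_norm)

lemma line_pt_ball: "y \<in> ball p r \<Longrightarrow> s \<in> {0..1} \<Longrightarrow> line_pt p e y s \<in> ball p r"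
  using line_pt_norm[OF e, of s p y] by auto

lemma line_pt_dist: "dist p y < r \<Longrightarrow> 0 \<le> s \<Longrightarrow> s \<le> 1 \<Longrightarrow> dist p (line_pt p e y s) < r"
  using line_pt_norm[OF e, of s p y] by linarith

lemma line_pt_cball: "y \<in> cball p \<rho> \<Longrightarrow> s \<in> {0..1} \<Longrightarrow> line_pt p e y s \<in> cball p \<rho>"
  using line_pt_norm[OF e, of s p y] by auto

lemma continuous_integrand:
  fixes u :: "'e \<Rightarrow> 'f::euclidean_space"
  assumes "continuous_on (cball p \<rho>) u" "y \<in> cball p \<rho>"
  shows "continuous_on {0..1} (\<lambda>s. ((y - p) \<bullet> e) *\<^sub>R u (line_pt p e y s))"
  by (intro continuous_intros continuous_on_compose2[OF assms(1) continuous_line_pt1])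
    (use line_pt_cball[OF assms(2)] in blast)

lemma line_int_dist:
  fixes u :: "'e \<Rightarrow> 'f::euclidean_space"
  assumes "continuous_on (cball p \<rho>) u" "continuous_on (cball p \<rho>) w" "y \<in> cball p \<rho>"
    and d: "\<And>z. z \<in> cball p \<rho> \<Longrightarrow> dist (u z) (w z) \<le> d"
  shows "dist (I u y) (I w y) \<le> \<rho> * d"
proof -
  note c = continuous_integrand[OF assms(1,3)] continuous_integrand[OF assms(2,3)]
  have "\<bar>(y - p) \<bullet> e\<bar> \<le> \<rho>"
    using Cauchy_Schwarz_ineq2[of "y - p" e] assms(3) by (simp add: dist_norm norm_minus_commute)
  moreover from this have "0 \<le> \<rho>" by linarith
  ultimately have "norm (((y - p) \<bullet> e) *\<^sub>R u (line_pt p e y s) - ((y - p) \<bullet> e) *\<^sub>R w (line_pt p e y s)) \<le> \<rho> * d"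
    if "s \<in> {0..1}" for s
    using d[OF line_pt_cball[OF assms(3) that]]
    by (auto simp: scaleR_diff_right[symmetric] dist_norm intro!: mult_mono)
  then have "norm (integral {0..1} (\<lambda>s. ((y - p) \<bullet> e) *\<^sub>R u (line_pt p e y s) - ((y - p) \<bullet> e) *\<^sub>R w (line_pt p e y s)))
      \<le> \<rho> * d * (1 - 0)"
    using c by (intro integral_bound) (auto intro!: continuous_intros)
  then show ?thesis
    using c by (simp add: line_int_def dist_norm integral_diff integrable_continuous_real)
qed

lemma line_int_add:
  fixes u :: "'e \<Rightarrow> 'f::euclidean_space"
  assumes "continuous_on (ball p r) u" "continuous_on (ball p r) w" "y \<in> ball p r"
  shows "I (\<lambda>z. u z + w z) y = I u y + I w y"
proof -
  have sub: "cball p (dist p y) \<subseteq> ball p r" using assms(3) by auto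
  have c: "continuous_on {0..1} (\<lambda>s. ((y - p) \<bullet> e) *\<^sub>R u (line_pt p e y s))"
    "continuous_on {0..1} (\<lambda>s. ((y - p) \<bullet> e) *\<^sub>R w (line_pt p e y s))"
    using continuous_integrand[OF continuous_on_subset[OF assms(1) sub], of y]
      continuous_integrand[OF continuous_on_subset[OF assms(2) sub], of y] by simp_all
  then show ?thesis
    by (simp add: line_int_def scaleR_add_right integral_add integrable_continuous_real)
qed

lemma line_int_cong: "(\<And>z. z \<in> ball p r \<Longrightarrow> u z = w z) \<Longrightarrow> y \<in> ball p r \<Longrightarrow> I u y = I w y"
  unfolding line_int_def by (intro integral_cong) (simp add: line_pt_dist)

lemma line_int_zero [simp]: "I (\<lambda>z. 0) y = 0"
  by (simp add: line_int_def)

text \<open>A direction orthogonal to \<open>e\<close> moves the whole segment, so the derivative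
  passes under the integral; the direction \<open>e\<close> only moves the end point, which gives
  \<open>u y\<close>.\<close>

lemma line_int_deriv:
  fixes u :: "'e \<Rightarrow> 'f::euclidean_space"
  assumes du: "\<And>x. x \<in> ball p r \<Longrightarrow> (u has_derivative du x) (at x)"
    and cont: "\<And>v. continuous_on (ball p r) (\<lambda>x. du x v)"
    and y: "y \<in> ball p r"
  shows "(I u has_derivative (\<lambda>v. I (\<lambda>z. du z (v - (v \<bullet> e) *\<^sub>R e)) y + (v \<bullet> e) *\<^sub>R u y)) (at y)"
proof -
  let ?c = "line_pt p e" and ?B = "ball p r"
  have cu: "continuous_on ?B u"
    using du has_derivative_continuous by (blast intro: continuous_at_imp_continuous_on)
  define fx where "fx x s = (\<lambda>v. (v \<bullet> e) *\<^sub>R u (?c x s) + ((x - p) \<bullet> e) *\<^sub>R du (?c x s) (v - ((1 - s) * (v \<bullet> e)) *\<^sub>R e))"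
    for x s
  have dc: "((\<lambda>x. ?c x s) has_derivative (\<lambda>v. v - ((1 - s) * (v \<bullet> e)) *\<^sub>R e)) (at x)" for x s
    unfolding line_pt_def by (auto intro!: derivative_eq_intros)
  have fx: "((\<lambda>x. ((x - p) \<bullet> e) *\<^sub>R u (?c x s)) has_derivative fx x s) (at x)" if "x \<in> ?B" "s \<in> {0..1}" for x s
  proof -
    have "((\<lambda>x. u (?c x s)) has_derivative (\<lambda>v. du (?c x s) (v - ((1 - s) * (v \<bullet> e)) *\<^sub>R e))) (at x)"
      using diff_chain_at[OF dc du[OF line_pt_ball[OF that]]] by (simp add: comp_def)
    then show ?thesis unfolding fx_def
      by (auto intro!: derivative_eq_intros)
  qed
  have bl: "bounded_linear (fx x s)" if "x \<in> ?B" "s \<in> {0..1}" for x s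
    using fx[OF that] by (rule has_derivative_bounded_linear)
  have cc: "continuous_on (?B \<times> {0..1}) (\<lambda>z. g (?c (fst z) (snd z)))" if "continuous_on ?B g"
    for g :: "'e \<Rightarrow> 'f"
    by (rule continuous_on_compose2[OF that continuous_line_pt[unfolded case_prod_beta]]) (auto simp: line_pt_dist)
  have cfx: "continuous_on (?B \<times> {0..1}) (\<lambda>z. fx (fst z) (snd z) v)" for v
  proof -
    have "continuous_on (?B \<times> {0..1}) (\<lambda>z. (v \<bullet> e) *\<^sub>R u (?c (fst z) (snd z)) +
        ((fst z - p) \<bullet> e) *\<^sub>R (du (?c (fst z) (snd z)) v - ((1 - snd z) * (v \<bullet> e)) *\<^sub>R du (?c (fst z) (snd z)) e))"
      by (intro continuous_intros cc cu cont)
    moreover have "fx x s v = (v \<bullet> e) *\<^sub>R u (?c x s) +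
        ((x - p) \<bullet> e) *\<^sub>R (du (?c x s) v - ((1 - s) * (v \<bullet> e)) *\<^sub>R du (?c x s) e)" if "x \<in> ?B" "s \<in> {0..1}" for x s
      using has_derivative_linear[OF du[OF line_pt_ball[OF that]]]
      by (simp add: fx_def linear_diff linear_cmul)
    ultimately show ?thesis
      by (subst continuous_on_cong[OF refl, where g = "\<lambda>z. (v \<bullet> e) *\<^sub>R u (?c (fst z) (snd z)) +
        ((fst z - p) \<bullet> e) *\<^sub>R (du (?c (fst z) (snd z)) v - ((1 - snd z) * (v \<bullet> e)) *\<^sub>R du (?c (fst z) (snd z)) e)"]) auto
  qed
  \<comment> \<open>The Leibniz rule asks for a continuous family of bounded operators; continuity
    in each basis direction suffices for this.\<close>
  define FX where "FX x s = Blinfun (fx x s)" for x s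
  have FX: "blinfun_apply (FX x s) = fx x s" if "x \<in> ?B" "s \<in> {0..1}" for x s
    unfolding FX_def by (rule bounded_linear_Blinfun_apply[OF bl[OF that]])
  have cFX: "continuous_on (?B \<times> cbox 0 1) (\<lambda>(x, s). FX x s)"
  proof (rule continuous_on_blinfun_componentwise)
    fix i :: 'e
    show "continuous_on (?B \<times> cbox 0 1) (\<lambda>x. blinfun_apply (case x of (x, s) \<Rightarrow> FX x s) i)"
      using cfx[of i] by (subst continuous_on_cong[OF refl, where g = "\<lambda>z. fx (fst z) (snd z) i"]) (auto simp: FX)
  qed
  have "((\<lambda>x. integral (cbox 0 1) (\<lambda>s. ((x - p) \<bullet> e) *\<^sub>R u (?c x s))) has_derivative
      blinfun_apply (integral (cbox 0 1) (FX y))) (at y within ?B)"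
  proof (rule leibniz_rule[OF _ _ cFX y convex_ball])
    show "((\<lambda>x. ((x - p) \<bullet> e) *\<^sub>R u (?c x s)) has_derivative blinfun_apply (FX x s)) (at x within ?B)"
      if "x \<in> ?B" "s \<in> cbox 0 1" for x s
      using fx[of x s] FX[of x s] that has_derivative_at_withinI by auto
    show "(\<lambda>s. ((x - p) \<bullet> e) *\<^sub>R u (?c x s)) integrable_on cbox 0 1" if "x \<in> ?B" for x
    proof -
      have "cball p (dist p x) \<subseteq> ?B" using that by auto
      then have "continuous_on {0..1} (\<lambda>s. ((x - p) \<bullet> e) *\<^sub>R u (?c x s))"
        using continuous_integrand[OF continuous_on_subset[OF cu]] by simp
      then show ?thesis by (simp add: integrable_continuous_real)
    qed
  qed
  then have D: "(I u has_derivative blinfun_apply (integral {0..1} (FX y))) (at y)"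
    using at_within_open[OF y open_ball] by (simp add: line_int_def[abs_def])
  have "blinfun_apply (integral {0..1} (FX y)) v = I (\<lambda>z. du z (v - (v \<bullet> e) *\<^sub>R e)) y + (v \<bullet> e) *\<^sub>R u y" for v
  proof -
    let ?v' = "v - (v \<bullet> e) *\<^sub>R e"
    have ysub: "cball p (dist p y) \<subseteq> ?B" using y by auto
    have cFXy: "continuous_on {0..1} (FX y)"
    proof -
      have "continuous_on {0..1} (\<lambda>s::real. (y, s))" by (intro continuous_intros)
      moreover have "(\<lambda>s. (y, s)) ` {0..1} \<subseteq> ?B \<times> cbox 0 (1::real)" using y by auto
      ultimately have "continuous_on {0..1} (\<lambda>s. case (y, s) of (x, s) \<Rightarrow> FX x s)"
        by (rule continuous_on_compose2[OF cFX])
      then show ?thesis by simp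
    qed
    have "blinfun_apply (integral {0..1} (FX y)) v = integral {0..1} (\<lambda>s. FX y s v)"
      by (rule blinfun_apply_integral) (simp add: cFXy integrable_continuous_real)
    also have "\<dots> = integral {0..1} (\<lambda>s. ((y - p) \<bullet> e) *\<^sub>R du (?c y s) ?v' +
        (v \<bullet> e) *\<^sub>R (u (?c y s) + (s * ((y - p) \<bullet> e)) *\<^sub>R du (?c y s) e))"
    proof (rule integral_cong)
      fix s :: real assume s: "s \<in> {0..1}"
      have "du (?c y s) (v - ((1 - s) * (v \<bullet> e)) *\<^sub>R e) = du (?c y s) ?v' + (s * (v \<bullet> e)) *\<^sub>R du (?c y s) e"
        using has_derivative_linear[OF du[OF line_pt_ball[OF y s]]]
        by (simp add: linear_add linear_diff linear_cmul algebra_simps)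
      then show "FX y s v = ((y - p) \<bullet> e) *\<^sub>R du (?c y s) ?v' +
        (v \<bullet> e) *\<^sub>R (u (?c y s) + (s * ((y - p) \<bullet> e)) *\<^sub>R du (?c y s) e)"
        by (simp add: FX[OF y s] fx_def algebra_simps)
    qed
    also have "\<dots> = I (\<lambda>z. du z ?v') y + (v \<bullet> e) *\<^sub>R u y"
    proof -
      have 1: "((\<lambda>s. ((y - p) \<bullet> e) *\<^sub>R du (?c y s) ?v') has_integral I (\<lambda>z. du z ?v') y) {0..1}"
        unfolding line_int_def
        by (rule integrable_integral)
          (use continuous_integrand[OF continuous_on_subset[OF cont ysub]] in \<open>auto intro: integrable_continuous_real\<close>)
      \<comment> \<open>The contribution of the \<open>e\<close> component of \<open>v\<close> is a
        total derivative, namely that of \<open>s *\<^sub>R u (?c y s)\<close>.\<close>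
      have "((\<lambda>s. u (?c y s) + (s * ((y - p) \<bullet> e)) *\<^sub>R du (?c y s) e) has_integral
          (1 *\<^sub>R u (?c y 1) - 0 *\<^sub>R u (?c y 0))) {0..1}"
      proof (rule fundamental_theorem_of_calculus)
        fix s :: real assume s: "s \<in> {0..1}"
        have "(?c y has_derivative (\<lambda>h. (h * ((y - p) \<bullet> e)) *\<^sub>R e)) (at s)"
          unfolding line_pt_def by (auto intro!: derivative_eq_intros simp: algebra_simps)
        from diff_chain_at[OF this du[OF line_pt_ball[OF y s]]]
        have "((\<lambda>s. u (?c y s)) has_derivative (\<lambda>h. (h * ((y - p) \<bullet> e)) *\<^sub>R du (?c y s) e)) (at s)"
          using has_derivative_linear[OF du[OF line_pt_ball[OF y s]]] by (simp add: comp_def linear_cmul)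
        then have "((\<lambda>s. s *\<^sub>R u (?c y s)) has_derivative
            (\<lambda>h. h *\<^sub>R (u (?c y s) + (s * ((y - p) \<bullet> e)) *\<^sub>R du (?c y s) e))) (at s)"
          by (auto intro!: derivative_eq_intros simp: algebra_simps)
        then show "((\<lambda>s. s *\<^sub>R u (?c y s)) has_vector_derivative
            (u (?c y s) + (s * ((y - p) \<bullet> e)) *\<^sub>R du (?c y s) e)) (at s within {0..1})"
          unfolding has_vector_derivative_def by (rule has_derivative_at_withinI)
      qed simp
      then have 2: "((\<lambda>s. u (?c y s) + (s * ((y - p) \<bullet> e)) *\<^sub>R du (?c y s) e) has_integral u y) {0..1}"
        by simp
      show ?thesis
        by (rule integral_unique) (intro has_integral_add 1 has_integral_cmul 2)
    qed
    finally show ?thesis .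
  qed
  then have "blinfun_apply (integral {0..1} (FX y)) = (\<lambda>v. I (\<lambda>z. du z (v - (v \<bullet> e) *\<^sub>R e)) y + (v \<bullet> e) *\<^sub>R u y)"
    by (rule ext)
  with D show ?thesis by simp
qed

lemma compact_in_ball:
  assumes "compact K" "K \<subseteq> ball p r"
  obtains \<rho> where "\<rho> < r" "K \<subseteq> cball p \<rho>"
proof (cases "K = {}")
  case True
  then show ?thesis using that[of "r - 1"] by simp
next
  case False
  obtain x where x: "x \<in> K" "\<And>y. y \<in> K \<Longrightarrow> dist p y \<le> dist p x"
    using continuous_attains_sup[OF assms(1) False continuous_on_dist[OF continuous_on_const continuous_on_id, of _ p]]
    by auto
  show ?thesis
  proof (rule that)
    show "dist p x < r" using x assms(2) by auto
    show "K \<subseteq> cball p (dist p x)" using x by auto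
  qed
qed

lemma continuous_line_int:
  fixes u :: "'e \<Rightarrow> 'f::euclidean_space"
  assumes "continuous_on (ball p r) u"
  shows "continuous_on (ball p r) (I u)"
proof -
  have "continuous_on (ball p r \<times> cbox 0 1) (\<lambda>z. ((fst z - p) \<bullet> e) *\<^sub>R u (line_pt p e (fst z) (snd z)))"
    by (intro continuous_intros continuous_on_compose2[OF assms continuous_line_pt[unfolded case_prod_beta]])
      (auto simp: line_pt_dist)
  then have "continuous_on (ball p r) (\<lambda>y. integral (cbox 0 1) (\<lambda>s. ((y - p) \<bullet> e) *\<^sub>R u (line_pt p e y s)))"
    by (intro integral_continuous_on_param) (simp add: case_prod_beta)
  then show ?thesis by (simp add: line_int_def[abs_def])
qed

lemma lu_conv_ballI:
  fixes f :: "nat \<Rightarrow> 'e \<Rightarrow> 'f::euclidean_space"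
  assumes "\<And>m. continuous_on (ball p r) (f m)"
    and "\<And>\<rho>. \<rho> < r \<Longrightarrow> uniformly_convergent_on (cball p \<rho>) f"
  shows "lu_conv f (ball p r)"
proof (rule lu_convI)
  fix K assume "compact K" "K \<subseteq> ball p r"
  then obtain \<rho> where "\<rho> < r" "K \<subseteq> cball p \<rho>" by (rule compact_in_ball)
  then show "uniformly_convergent_on K f"
    using assms(2) uniformly_convergent_on_subset by blast
qed (rule assms)

lemma lu_conv_line_int:
  fixes f :: "nat \<Rightarrow> 'e \<Rightarrow> 'f::euclidean_space"
  assumes "lu_conv f (ball p r)"
  shows "lu_conv (\<lambda>m. I (f m)) (ball p r)"
proof (rule lu_conv_ballI)
  show "continuous_on (ball p r) (I (f m))" for m
    using continuous_line_int lu_convD(1)[OF assms] .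
  fix \<rho> assume \<rho>: "\<rho> < r"
  then have sub: "cball p \<rho> \<subseteq> ball p r" by auto
  obtain F where F: "uniform_limit (cball p \<rho>) f F sequentially" "continuous_on (cball p \<rho>) F"
    using lu_conv_limit[OF assms compact_cball sub] .
  have "uniform_limit (cball p \<rho>) (\<lambda>m. I (f m)) (I F) sequentially"
    unfolding uniform_limit_iff
  proof (intro allI impI)
    fix d :: real assume d: "d > 0"
    let ?d = "d / (\<bar>\<rho>\<bar> + 1)"
    have "?d > 0" using d by (simp add: divide_pos_pos)
    then have "\<forall>\<^sub>F m in sequentially. \<forall>x\<in>cball p \<rho>. dist (f m x) (F x) < ?d"
      using F(1) unfolding uniform_limit_iff by blast
    then show "\<forall>\<^sub>F m in sequentially. \<forall>x\<in>cball p \<rho>. dist (I (f m) x) (I F x) < d"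
    proof eventually_elim
      case (elim m)
      show ?case
      proof
        fix x assume x: "x \<in> cball p \<rho>"
        have "dist (I (f m) x) (I F x) \<le> \<rho> * ?d"
          by (rule line_int_dist[OF continuous_on_subset[OF lu_convD(1)[OF assms] sub] F(2) x])
            (use elim in \<open>auto intro: less_imp_le\<close>)
        also have "\<dots> < d"
          using d by (simp add: divide_simps) (auto simp: algebra_simps abs_if intro: add_strict_increasing)
        finally show "dist (I (f m) x) (I F x) < d" .
      qed
    qed
  qed
  then show "uniformly_convergent_on (cball p \<rho>) (\<lambda>m. I (f m))" by (rule uniformly_convergentI)
qed

text \<open>By \<open>line_int_deriv\<close> a derivative of \<open>I u\<close> is made of
  \<open>I\<close> applied to a derivative of \<open>u\<close> and of \<open>u\<close> itself, so
  order \<open>k + 1\<close> reduces to order \<open>k\<close>.\<close>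

lemma seqC_line_int:
  fixes u :: "nat \<Rightarrow> 'e \<Rightarrow> 'f::euclidean_space"
  shows "seqC k u (ball p r) \<Longrightarrow> seqC k (\<lambda>m. I (u m)) (ball p r)"
proof (induction k arbitrary: u)
  case 0
  then show ?case by (simp add: lu_conv_line_int)
next
  case (Suc k)
  let ?du = "\<lambda>m x. frechet_derivative (u m) (at x)"
  show ?case
  proof (rule seqC_SucI[OF open_ball lu_conv_line_int[OF seqC_lu_conv[OF Suc.prems]]])
    show "(I (u m) has_derivative (\<lambda>v. I (\<lambda>z. ?du m z (v - (v \<bullet> e) *\<^sub>R e)) y + (v \<bullet> e) *\<^sub>R u m y)) (at y)"
      if "y \<in> ball p r" for m y
      by (rule line_int_deriv[OF seqC_deriv(1)[OF Suc.prems] lu_convD(1)[OF seqC_lu_conv[OF seqC_deriv(2)[OF Suc.prems]]] that])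
    show "seqC k (\<lambda>m y. I (\<lambda>z. ?du m z (v - (v \<bullet> e) *\<^sub>R e)) y + (v \<bullet> e) *\<^sub>R u m y) (ball p r)" for v
      by (intro seqC_add Suc.IH seqC_deriv(2)[OF Suc.prems] open_ball
          seqC_bounded_linear[OF bounded_linear_scaleR_right] seqC_SucD[OF Suc.prems])
  qed
qed

lemma smooth_on_line_int:
  fixes u :: "'e \<Rightarrow> 'f::euclidean_space"
  shows "smooth_on u (ball p r) \<Longrightarrow> smooth_on (I u) (ball p r)"
  unfolding smooth_on_def Ck_on_iff_seqC using seqC_line_int[of _ "\<lambda>m. u"] by simp

end

section \<open>Flow boxes\<close>

lemma lu_conv_bounded:
  assumes "lu_conv f S" "compact K" "K \<subseteq> S"
  obtains B where "0 \<le> B" "\<And>m y. y \<in> K \<Longrightarrow> norm (f m y) \<le> B"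
proof -
  obtain F where F: "uniform_limit K f F sequentially" "bounded (F ` K)"
    using lu_conv_limit[OF assms] by metis
  obtain C where C: "\<And>y. y \<in> K \<Longrightarrow> norm (F y) \<le> C"
    using F(2) unfolding bounded_iff by auto
  have "\<forall>\<^sub>F m in sequentially. \<forall>y\<in>K. dist (f m y) (F y) < 1"
    using F(1) unfolding uniform_limit_iff by simp
  then obtain N where N: "\<And>m y. m \<ge> N \<Longrightarrow> y \<in> K \<Longrightarrow> dist (f m y) (F y) < 1"
    unfolding eventually_sequentially by blast
  have "bounded (f m ` K)" for m
    using compact_continuous_image[OF continuous_on_subset[OF lu_convD(1)[OF assms(1)] assms(3)] assms(2)]
    by (rule compact_imp_bounded)
  then have "bounded (\<Union>m\<in>{..<N}. f m ` K)" by (intro bounded_UN) auto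
  then obtain D where D: "\<And>m y. m < N \<Longrightarrow> y \<in> K \<Longrightarrow> norm (f m y) \<le> D"
    unfolding bounded_iff by auto
  show ?thesis
  proof (rule that[of "\<bar>C\<bar> + 1 + \<bar>D\<bar>"])
    fix m y assume y: "y \<in> K"
    show "norm (f m y) \<le> \<bar>C\<bar> + 1 + \<bar>D\<bar>"
    proof (cases "m < N")
      case True
      then show ?thesis using D[OF True y] by linarith
    next
      case False
      then have "dist (f m y) (F y) < 1" using N y by simp
      moreover have "norm (f m y) \<le> norm (F y) + dist (f m y) (F y)"
        by (metis dist_norm norm_triangle_sub)
      ultimately show ?thesis using C[OF y] by linarith
    qed
  qed simp
qed

text \<open>Beyond a suitable index, one step halves the distance of two members up to a small
  error. Iterating from the crude bound \<open>2 * B\<close> leaves a geometric remainder and the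
  sum of the errors. The error term allows for maps that change from step to step.\<close>

lemma contraction_uniformly_convergent:
  fixes w :: "nat \<Rightarrow> 'e \<Rightarrow> 'f::euclidean_space"
  assumes B: "\<And>m y. y \<in> K \<Longrightarrow> norm (w m y) \<le> B"
    and step: "\<And>\<epsilon>. \<epsilon> > 0 \<Longrightarrow> \<exists>M. \<forall>m\<ge>M. \<forall>n\<ge>M. \<forall>d. (\<forall>y\<in>K. dist (w m y) (w n y) \<le> d) \<longrightarrow>
      (\<forall>y\<in>K. dist (w (Suc m) y) (w (Suc n) y) \<le> \<epsilon> + d / 2)"
  shows "uniformly_convergent_on K w"
proof (rule Cauchy_uniformly_convergent, rule uniformly_Cauchy_onI)
  fix \<delta> :: real assume \<delta>: "\<delta> > 0"
  have "\<exists>M. \<forall>m\<ge>M. \<forall>n\<ge>M. \<forall>d. (\<forall>y\<in>K. dist (w m y) (w n y) \<le> d) \<longrightarrow>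
      (\<forall>y\<in>K. dist (w (Suc m) y) (w (Suc n) y) \<le> \<delta> / 4 + d / 2)"
    by (rule step) (use \<delta> in simp)
  then obtain M where M0: "\<forall>m\<ge>M. \<forall>n\<ge>M. \<forall>d. (\<forall>y\<in>K. dist (w m y) (w n y) \<le> d) \<longrightarrow>
      (\<forall>y\<in>K. dist (w (Suc m) y) (w (Suc n) y) \<le> \<delta> / 4 + d / 2)" ..
  have M: "\<forall>y\<in>K. dist (w (Suc m) y) (w (Suc n) y) \<le> \<delta> / 4 + d / 2"
    if "m \<ge> M" "n \<ge> M" "\<forall>y\<in>K. dist (w m y) (w n y) \<le> d" for m n d
    using M0 that by simp
  \<comment> \<open>The value \<open>\<delta> / 2\<close> is the fixed point of
    \<open>d \<mapsto> \<delta> / 4 + d / 2\<close>, so the accumulated errors never exceed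
    it.\<close>
  have it: "\<forall>y\<in>K. dist (w (m + j) y) (w (n + j) y) \<le> \<delta> / 2 + 2 * B / 2 ^ j" if "m \<ge> M" "n \<ge> M" for m n j
  proof (induction j)
    case 0
    have "dist (w m y) (w n y) \<le> 2 * B" if "y \<in> K" for y
      using B[OF that, of m] B[OF that, of n] norm_triangle_ineq4[of "w m y" "w n y"] by (simp add: dist_norm)
    then show ?case using \<delta> by (auto intro!: add_increasing)
  next
    case (Suc j)
    have "m + j \<ge> M" "n + j \<ge> M" using that by simp_all
    moreover have "\<delta> / 4 + (\<delta> / 2 + 2 * B / 2 ^ j) / 2 = \<delta> / 2 + 2 * B / 2 ^ Suc j"
      by (simp add: field_simps)
    ultimately show ?case using M[OF _ _ Suc.IH] by simp
  qed
  have "(\<lambda>j. 2 * B / 2 ^ j) \<longlonglongrightarrow> 0"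
    using tendsto_mult[OF tendsto_const LIMSEQ_inverse_realpow_zero[of 2], of "2 * B"]
    by (simp add: divide_inverse)
  then have "\<forall>\<^sub>F j in sequentially. 2 * B / 2 ^ j < \<delta> / 2"
    using \<delta> by (intro order_tendstoD) auto
  then obtain j where j: "2 * B / 2 ^ j < \<delta> / 2"
    unfolding eventually_sequentially by blast
  show "\<exists>M. \<forall>x\<in>K. \<forall>m\<ge>M. \<forall>n\<ge>M. dist (w m x) (w n x) < \<delta>"
  proof (intro exI ballI allI impI)
    fix x m n assume x: "x \<in> K" and mn: "m \<ge> M + j" "n \<ge> M + j"
    have "dist (w (m - j + j) x) (w (n - j + j) x) \<le> \<delta> / 2 + 2 * B / 2 ^ j"
      using it[of "m - j" "n - j" j] x mn by auto
    then show "dist (w m x) (w n x) < \<delta>" using j mn by simp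
  qed
qed

context line_ball
begin

lemma line_int_norm:
  fixes u :: "'e \<Rightarrow> 'f::euclidean_space"
  assumes "continuous_on (cball p \<rho>) u" "y \<in> cball p \<rho>"
    and "\<And>z. z \<in> cball p \<rho> \<Longrightarrow> norm (u z) \<le> d"
  shows "norm (I u y) \<le> \<rho> * d"
  using line_int_dist[OF assms(1) continuous_on_const assms(2), of 0 d] assms(3)
  by simp

text \<open>Integration over a segment gains at most the radius as a factor, so
  \<open>r * L \<le> 1 / 2\<close> makes each step a contraction by one half. The coefficients vary
  with \<open>m\<close>, but they converge, and their differences go into the error allowed by
  \<open>contraction_uniformly_convergent\<close>.\<close>

lemma linear_recurrence_lu_conv:
  fixes w \<beta> :: "nat \<Rightarrow> 'e \<Rightarrow> 'f::euclidean_space" and a :: "'f \<Rightarrow> nat \<Rightarrow> 'e \<Rightarrow> 'f"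
  assumes rL: "0 < r" "r * L \<le> 1 / 2"
    and bound: "\<And>m z h. z \<in> ball p r \<Longrightarrow> norm (\<Sum>b\<in>Basis. (h \<bullet> b) *\<^sub>R a b m z) \<le> L * norm h"
    and \<beta>: "lu_conv \<beta> (ball p r)" and w0: "continuous_on (ball p r) (w 0)"
    and a: "\<And>b. b \<in> Basis \<Longrightarrow> lu_conv (a b) (ball p r)"
    and rec: "\<And>m y. y \<in> ball p r \<Longrightarrow> w (Suc m) y = \<beta> m y + I (\<lambda>z. \<Sum>b\<in>Basis. (w m z \<bullet> b) *\<^sub>R a b m z) y"
  shows "lu_conv w (ball p r)"
proof (rule lu_conv_ballI)
  define A where "A m z h = (\<Sum>b\<in>Basis. (h \<bullet> b) *\<^sub>R a b m z)" for m z h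
  have cA: "continuous_on (ball p r) (\<lambda>z. A m z (u z))" if "continuous_on (ball p r) u" for m u
    unfolding A_def by (intro continuous_intros that lu_convD(1)[OF a])
  show cw: "continuous_on (ball p r) (w m)" for m
  proof (induction m)
    case (Suc m)
    have "continuous_on (ball p r) (\<lambda>y. \<beta> m y + I (\<lambda>z. A m z (w m z)) y)"
      by (intro continuous_on_add lu_convD(1)[OF \<beta>] continuous_line_int cA Suc)
    then show ?case by (rule continuous_on_eq) (simp add: rec A_def)
  qed (rule w0)
  fix \<rho> assume \<rho>: "\<rho> < r"
  let ?K = "cball p \<rho>"
  have sub: "?K \<subseteq> ball p r" using \<rho> by auto
  have L0: "0 \<le> L"
  proof -
    have p_in: "p \<in> ball p r" using rL(1) by simp
    obtain h :: 'f where "h \<in> Basis" using nonempty_Basis by blast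
    moreover have "0 \<le> L * norm h"
      by (rule order_trans[OF norm_ge_zero bound[OF p_in]])
    ultimately show ?thesis by simp
  qed
  show "uniformly_convergent_on ?K w"
  proof (cases "\<rho> < 0")
    case True
    then show ?thesis by simp
  next
    case False
    then have \<rho>L: "0 \<le> \<rho>" "\<rho> * L \<le> 1 / 2"
      using rL \<rho> L0 mult_right_mono[of \<rho> r L] by auto
    have cAK: "continuous_on ?K (\<lambda>z. A m z (w m z))" for m
      using continuous_on_subset[OF cA[OF cw] sub] .
    have A_lin: "A m z h - A m z h' = A m z (h - h')" for m z h h'
      unfolding A_def by (simp add: inner_diff_left scaleR_diff_left sum_subtractf)
    obtain B\<beta> where B\<beta>: "0 \<le> B\<beta>" "\<And>m y. y \<in> ?K \<Longrightarrow> norm (\<beta> m y) \<le> B\<beta>"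
      using lu_conv_bounded[OF \<beta> compact_cball sub] by metis
    obtain B0 where B0: "\<And>y. y \<in> ?K \<Longrightarrow> norm (w 0 y) \<le> B0"
      using lu_conv_bounded[OF lu_conv_const[OF w0] compact_cball sub] by metis
    \<comment> \<open>Chosen so that the bound reproduces itself:
      \<open>B\<beta> + B / 2 \<le> B\<close>.\<close>
    define B where "B = max B0 (2 * B\<beta>)"
    have B: "\<forall>y\<in>?K. norm (w m y) \<le> B" for m
    proof (induction m)
      case 0
      then show ?case using B0 by (fastforce simp: B_def)
    next
      case (Suc m)
      show ?case
      proof
        fix y assume y: "y \<in> ?K"
        have "norm (I (\<lambda>z. A m z (w m z)) y) \<le> \<rho> * (L * B)"
        proof (rule line_int_norm[OF cAK y])
          fix z assume z: "z \<in> ?K"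
          have "norm (A m z (w m z)) \<le> L * norm (w m z)" using bound sub z unfolding A_def by blast
          also have "\<dots> \<le> L * B" using Suc z L0 by (intro mult_left_mono) auto
          finally show "norm (A m z (w m z)) \<le> L * B" .
        qed
        also have "\<dots> \<le> B / 2"
          using mult_right_mono[OF \<rho>L(2), of B] B\<beta>(1) by (simp add: B_def mult.assoc)
        finally have "norm (w (Suc m) y) \<le> B\<beta> + B / 2"
          using norm_triangle_ineq[of "\<beta> m y" "I (\<lambda>z. A m z (w m z)) y"] B\<beta>(2)[OF y, of m] rec[of y m] sub y
          by (auto simp: A_def)
        also have "\<dots> \<le> B" by (simp add: B_def)
        finally show "norm (w (Suc m) y) \<le> B" .
      qed
    qed
    have B0': "0 \<le> B" using B\<beta>(1) by (simp add: B_def)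
    show ?thesis
    proof (rule contraction_uniformly_convergent)
      show "norm (w m y) \<le> B" if "y \<in> ?K" for m y using B that by blast
      fix \<epsilon> :: real assume \<epsilon>: "\<epsilon> > 0"
      \<comment> \<open>With this tolerance the change of the coefficients contributes at most
        \<open>\<epsilon> / 2\<close>; the summand 1 only keeps the denominator positive.\<close>
      define \<eta> where "\<eta> = \<epsilon> / (2 * (\<rho> * B * real DIM('f) + 1))"
      have pos: "\<rho> * B * real DIM('f) + 1 > 0" using \<rho>L B0' by (simp add: add_nonneg_pos)
      then have \<eta>: "\<eta> > 0" using \<epsilon> by (simp add: \<eta>_def)
      have "\<rho> * B * real DIM('f) * \<eta> \<le> \<epsilon> / 2"
        using pos \<epsilon> \<rho>L B0' by (simp add: \<eta>_def field_simps)
      have ev: "\<forall>\<^sub>F M in sequentially. \<forall>m\<ge>M. \<forall>n\<ge>M. \<forall>z\<in>?K. dist (g m z) (g n z) < \<delta>"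
        if g: "lu_conv g (ball p r)" and \<delta>: "\<delta> > 0" for g :: "nat \<Rightarrow> 'e \<Rightarrow> 'f" and \<delta>
      proof -
        obtain M where "\<forall>x\<in>?K. \<forall>m\<ge>M. \<forall>n\<ge>M. dist (g m x) (g n x) < \<delta>"
          using uniformly_convergent_Cauchy[OF lu_convD(2)[OF g compact_cball sub]] \<delta>
          unfolding uniformly_Cauchy_on_def by blast
        then show ?thesis by (intro eventually_sequentiallyI[of M]) (meson order_trans)
      qed
      have "\<forall>\<^sub>F M in sequentially. \<forall>b\<in>Basis. \<forall>m\<ge>M. \<forall>n\<ge>M. \<forall>z\<in>?K. dist (a b m z) (a b n z) < \<eta>"
        by (intro eventually_ball_finite ballI ev a \<eta>) auto
      moreover have "\<forall>\<^sub>F M in sequentially. \<forall>m\<ge>M. \<forall>n\<ge>M. \<forall>z\<in>?K. dist (\<beta> m z) (\<beta> n z) < \<epsilon> / 2"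
        by (rule ev[OF \<beta> half_gt_zero[OF \<epsilon>]])
      ultimately have "\<forall>\<^sub>F M in sequentially. (\<forall>b\<in>Basis. \<forall>m\<ge>M. \<forall>n\<ge>M. \<forall>z\<in>?K. dist (a b m z) (a b n z) < \<eta>) \<and>
          (\<forall>m\<ge>M. \<forall>n\<ge>M. \<forall>z\<in>?K. dist (\<beta> m z) (\<beta> n z) < \<epsilon> / 2)"
        by (rule eventually_conj)
      from eventually_happens'[OF sequentially_bot this] obtain M
        where M0: "(\<forall>b\<in>Basis. \<forall>m\<ge>M. \<forall>n\<ge>M. \<forall>z\<in>?K. dist (a b m z) (a b n z) < \<eta>) \<and>
          (\<forall>m\<ge>M. \<forall>n\<ge>M. \<forall>z\<in>?K. dist (\<beta> m z) (\<beta> n z) < \<epsilon> / 2)" ..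
      have M: "\<And>b m n z. b \<in> Basis \<Longrightarrow> m \<ge> M \<Longrightarrow> n \<ge> M \<Longrightarrow> z \<in> ?K \<Longrightarrow> dist (a b m z) (a b n z) < \<eta>"
          "\<And>m n z. m \<ge> M \<Longrightarrow> n \<ge> M \<Longrightarrow> z \<in> ?K \<Longrightarrow> dist (\<beta> m z) (\<beta> n z) < \<epsilon> / 2"
        using M0 by simp_all
      show "\<exists>M. \<forall>m\<ge>M. \<forall>n\<ge>M. \<forall>d. (\<forall>y\<in>?K. dist (w m y) (w n y) \<le> d) \<longrightarrow>
          (\<forall>y\<in>?K. dist (w (Suc m) y) (w (Suc n) y) \<le> \<epsilon> + d / 2)"
      proof (intro exI allI impI ballI)
        fix m n d y assume mn: "m \<ge> M" "n \<ge> M" and d: "\<forall>y\<in>?K. dist (w m y) (w n y) \<le> d" and y: "y \<in> ?K"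
        have d0: "0 \<le> d" using d y zero_le_dist order_trans by blast
        have "dist (I (\<lambda>z. A m z (w m z)) y) (I (\<lambda>z. A n z (w n z)) y) \<le> \<rho> * (L * d + B * (real DIM('f) * \<eta>))"
        proof (rule line_int_dist[OF cAK cAK y])
          fix z assume z: "z \<in> ?K"
          have "dist (A m z (w m z)) (A n z (w n z)) \<le>
              norm (A m z (w m z - w n z)) + norm (A m z (w n z) - A n z (w n z))"
            unfolding A_lin[symmetric] dist_norm by (rule order_trans[OF _ norm_triangle_ineq]) simp
          also have "norm (A m z (w m z - w n z)) \<le> L * d"
          proof -
            have "norm (A m z (w m z - w n z)) \<le> L * norm (w m z - w n z)" using bound sub z unfolding A_def by blast
            also have "\<dots> \<le> L * d" using d z L0 by (intro mult_left_mono) (auto simp: dist_norm)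
            finally show ?thesis .
          qed
          also have "norm (A m z (w n z) - A n z (w n z)) \<le> B * (real DIM('f) * \<eta>)"
          proof -
            have "A m z (w n z) - A n z (w n z) = (\<Sum>b\<in>Basis. (w n z \<bullet> b) *\<^sub>R (a b m z - a b n z))"
              by (simp add: A_def scaleR_diff_right sum_subtractf)
            also have "norm \<dots> \<le> (\<Sum>b\<in>(Basis::'f set). B * \<eta>)"
            proof (rule sum_norm_le)
              fix b :: 'f assume b: "b \<in> Basis"
              have "\<bar>w n z \<bullet> b\<bar> \<le> B" using Basis_le_norm[OF b, of "w n z"] B z order_trans by blast
              moreover have "norm (a b m z - a b n z) \<le> \<eta>" using M(1)[OF b mn z] by (simp add: dist_norm)
              ultimately show "norm ((w n z \<bullet> b) *\<^sub>R (a b m z - a b n z)) \<le> B * \<eta>"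
                using B0' by (simp add: mult_mono)
            qed
            finally show ?thesis by (simp add: mult_ac)
          qed
          finally show "dist (A m z (w m z)) (A n z (w n z)) \<le> L * d + B * (real DIM('f) * \<eta>)" by simp
        qed
        also have "\<dots> \<le> d / 2 + \<epsilon> / 2"
          using mult_right_mono[OF \<rho>L(2) d0] \<open>\<rho> * B * real DIM('f) * \<eta> \<le> \<epsilon> / 2\<close>
          by (simp add: distrib_left mult.assoc)
        finally show "dist (w (Suc m) y) (w (Suc n) y) \<le> \<epsilon> + d / 2"
          using dist_triangle_add[of "\<beta> m y" "I (\<lambda>z. A m z (w m z)) y" "\<beta> n y" "I (\<lambda>z. A n z (w n z)) y"]
            M(2)[OF mn y] rec[of y m] rec[of y n] sub y by (auto simp: A_def)
      qed
    qed
  qed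
qed

text \<open>Differentiation in a direction orthogonal to \<open>e\<close> gives a recurrence for the
  derivative with the same coefficients, hence the same \<open>L\<close>, and a new inhomogeneous
  part that involves \<open>w\<close> only undifferentiated. The induction hypothesis applies to it.
  Along \<open>e\<close> the integral disappears and the derivative is given explicitly.\<close>

lemma linear_recurrence_seqC:
  fixes w \<beta> :: "nat \<Rightarrow> 'e \<Rightarrow> 'f::euclidean_space" and a :: "'f \<Rightarrow> nat \<Rightarrow> 'e \<Rightarrow> 'f"
  assumes rL: "0 < r" "r * L \<le> 1 / 2"
    and bound: "\<And>m z h. z \<in> ball p r \<Longrightarrow> norm (\<Sum>b\<in>Basis. (h \<bullet> b) *\<^sub>R a b m z) \<le> L * norm h"
  shows "seqC k \<beta> (ball p r) \<Longrightarrow> Ck_on k (w 0) (ball p r) \<Longrightarrow> (\<And>b. b \<in> Basis \<Longrightarrow> seqC k (a b) (ball p r)) \<Longrightarrow>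
    (\<And>m y. y \<in> ball p r \<Longrightarrow> w (Suc m) y = \<beta> m y + I (\<lambda>z. \<Sum>b\<in>Basis. (w m z \<bullet> b) *\<^sub>R a b m z) y) \<Longrightarrow>
    seqC k w (ball p r)"
proof (induction k arbitrary: w \<beta>)
  case 0
  have "lu_conv w (ball p r)"
    by (rule linear_recurrence_lu_conv[OF rL bound 0(1)[unfolded seqC.simps(1)] 0(2)[unfolded Ck_on.simps(1)]
          0(3)[unfolded seqC.simps(1)] 0(4)])
  then show ?case by simp
next
  case (Suc k)
  let ?B = "ball p r"
  let ?D = "\<lambda>g m x. frechet_derivative (g m) (at x)"
  have w: "seqC k w ?B"
    by (rule Suc.IH[OF seqC_SucD[OF Suc.prems(1)] Ck_on_SucD[OF Suc.prems(2)] seqC_SucD[OF Suc.prems(3)] Suc.prems(4)])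
  define u where "u m z = (\<Sum>b\<in>Basis. (w m z \<bullet> b) *\<^sub>R a b m z)" for m z
  have rec: "w (Suc m) y = \<beta> m y + I (u m) y" if "y \<in> ?B" for m y
    using Suc.prems(4)[OF that] by (simp add: u_def[abs_def])
  have ai: "seqC j (\<lambda>m z. w m z \<bullet> b) ?B" if "seqC j w ?B" for j b
    using seqC_bounded_linear[OF bounded_linear_inner_left open_ball that] .
  have u: "seqC k u ?B" unfolding u_def[abs_def]
    by (intro seqC_sum seqC_bilinear[OF bounded_bilinear_scaleR] ai w seqC_SucD[OF Suc.prems(3)]) auto
  note prems = Suc.prems
  \<comment> \<open>The induction hypothesis yields convergence only to order \<open>k\<close>; that
    each single member is one order smoother has to be known before it can be
    differentiated.\<close>
  have Cw: "Ck_on (Suc k) (w m) ?B" for m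
  proof (induction m)
    case (Suc m)
    have "Ck_on (Suc k) (\<lambda>z. \<Sum>b\<in>Basis. (w m z \<bullet> b) *\<^sub>R a b m z) ?B"
      by (intro Ck_on_sum Ck_on_bilinear[OF bounded_bilinear_scaleR] Ck_on_bilinear[OF bounded_bilinear_inner]
          Suc.IH seqC_imp_Ck_on[OF prems(3)])
        (auto simp: Ck_on_iff_seqC intro: seqC_const simp del: seqC.simps Ck_on.simps)
    then have "seqC (Suc k) (\<lambda>i y. \<beta> m y + I (u m) y) ?B"
      unfolding u_def[abs_def] Ck_on_iff_seqC
      by (intro seqC_add open_ball seqC_line_int seqC_imp_Ck_on[OF prems(1), unfolded Ck_on_iff_seqC])
    then have "Ck_on (Suc k) (\<lambda>y. \<beta> m y + I (u m) y) ?B" unfolding Ck_on_iff_seqC .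
    then show ?case by (rule Ck_on_cong[OF open_ball, rotated]) (simp add: rec)
  qed (rule prems(2))
  have dw: "(w m has_derivative ?D w m x) (at x)" if "x \<in> ?B" for m x
    by (rule Ck_on_deriv[OF Cw that])
  note da = seqC_deriv(1)[OF Suc.prems(3)]
  note d\<beta> = seqC_deriv(1)[OF Suc.prems(1)]
  define du where "du m z v = (\<Sum>b\<in>Basis. (w m z \<bullet> b) *\<^sub>R ?D (a b) m z v) +
      (\<Sum>b\<in>Basis. (?D w m z v \<bullet> b) *\<^sub>R a b m z)" for m z v
  have du: "(u m has_derivative du m z) (at z)" if z: "z \<in> ?B" for m z
  proof -
    have "((\<lambda>z. \<Sum>b\<in>Basis. (w m z \<bullet> b) *\<^sub>R a b m z) has_derivative
        (\<lambda>v. \<Sum>b\<in>Basis. (w m z \<bullet> b) *\<^sub>R ?D (a b) m z v + (?D w m z v \<bullet> b) *\<^sub>R a b m z)) (at z)"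
    proof (rule has_derivative_sum)
      fix b :: 'f assume b: "b \<in> Basis"
      show "((\<lambda>z. (w m z \<bullet> b) *\<^sub>R a b m z) has_derivative
        (\<lambda>v. (w m z \<bullet> b) *\<^sub>R ?D (a b) m z v + (?D w m z v \<bullet> b) *\<^sub>R a b m z)) (at z)"
        using bounded_bilinear.FDERIV[OF bounded_bilinear_scaleR
            bounded_linear.has_derivative[OF bounded_linear_inner_left dw[OF z]] da[OF b z]] .
    qed
    then show ?thesis by (simp add: u_def[abs_def] du_def[abs_def] sum.distrib)
  qed
  have cDw: "continuous_on ?B (\<lambda>x. ?D w m x v)" for m v
    by (rule Ck_on_continuous[of k]) (use Cw[of m] in simp)
  have cdu1: "seqC k (\<lambda>m z. \<Sum>b\<in>Basis. (w m z \<bullet> b) *\<^sub>R ?D (a b) m z v) ?B" for v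
    by (intro seqC_sum seqC_bilinear[OF bounded_bilinear_scaleR] ai w seqC_deriv(2)[OF Suc.prems(3)]) auto
  have cdu2: "continuous_on ?B (\<lambda>z. \<Sum>b\<in>Basis. (?D w m z v \<bullet> b) *\<^sub>R a b m z)" for m v
    by (intro continuous_intros cDw lu_convD(1)[OF seqC_lu_conv[OF Suc.prems(3)]])
  have cdu: "continuous_on ?B (\<lambda>x. du m x v)" for m v
    unfolding du_def by (intro continuous_on_add cdu2 lu_convD(1)[OF seqC_lu_conv[OF cdu1]])
  have Dw: "?D w (Suc m) y v = ?D \<beta> m y v + (I (\<lambda>z. du m z (v - (v \<bullet> e) *\<^sub>R e)) y + (v \<bullet> e) *\<^sub>R u m y)"
    if y: "y \<in> ?B" for m y v
  proof -
    have "((\<lambda>y. \<beta> m y + I (u m) y) has_derivative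
        (\<lambda>v. ?D \<beta> m y v + (I (\<lambda>z. du m z (v - (v \<bullet> e) *\<^sub>R e)) y + (v \<bullet> e) *\<^sub>R u m y))) (at y)"
      by (intro has_derivative_add d\<beta>[OF y] line_int_deriv[OF du cdu y])
    then have "(w (Suc m) has_derivative
        (\<lambda>v. ?D \<beta> m y v + (I (\<lambda>z. du m z (v - (v \<bullet> e) *\<^sub>R e)) y + (v \<bullet> e) *\<^sub>R u m y))) (at y)"
      by (rule has_derivative_transform_within_open[OF _ open_ball y]) (rule rec[symmetric])
    from fun_cong[OF frechet_derivative_at[OF this], of v] show ?thesis by (rule sym)
  qed
  \<comment> \<open>For \<open>v\<close> orthogonal to \<open>e\<close> the derivative of the
    integral splits into a part with \<open>D a\<close>, which joins the inhomogeneous term, and a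
    part linear in \<open>D w\<close>.\<close>
  have transversal: "seqC k (\<lambda>m x. ?D w m x v) ?B" if v: "v \<bullet> e = 0" for v
  proof (rule Suc.IH)
    show "seqC k (\<lambda>m y. ?D \<beta> m y v + I (\<lambda>z. \<Sum>b\<in>Basis. (w m z \<bullet> b) *\<^sub>R ?D (a b) m z v) y) ?B"
      by (intro seqC_add open_ball seqC_deriv(2)[OF Suc.prems(1)] seqC_line_int cdu1)
    show "Ck_on k (\<lambda>x. ?D w 0 x v) ?B" using Suc.prems(2) by simp
    show "seqC k (a b) ?B" if "b \<in> Basis" for b using seqC_SucD[OF Suc.prems(3)[OF that]] .
    show "?D w (Suc m) y v = (?D \<beta> m y v + I (\<lambda>z. \<Sum>b\<in>Basis. (w m z \<bullet> b) *\<^sub>R ?D (a b) m z v) y) +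
        I (\<lambda>z. \<Sum>b\<in>Basis. (?D w m z v \<bullet> b) *\<^sub>R a b m z) y" if "y \<in> ?B" for m y
      using Dw[OF that, of m v] line_int_add[OF lu_convD(1)[OF seqC_lu_conv[OF cdu1]] cdu2 that, of m v m v] v
      by (simp add: du_def)
  qed
  have along: "seqC k (\<lambda>m x. ?D w m x e) ?B"
  proof (rule seqC_shift[OF open_ball])
    have "seqC k (\<lambda>m y. ?D \<beta> m y e + u m y) ?B"
      by (intro seqC_add open_ball seqC_deriv(2)[OF Suc.prems(1)] u)
    moreover have "?D \<beta> m y e + u m y = ?D w (Suc m) y e" if "y \<in> ?B" for m y
    proof -
      have "I (\<lambda>z. du m z 0) y = I (\<lambda>z. 0) y"
        by (rule line_int_cong[OF _ that]) (rule linear_0[OF has_derivative_linear[OF du]])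
      then show ?thesis using Dw[OF that, of m e] by simp
    qed
    ultimately show "seqC k (\<lambda>m y. ?D w (Suc m) y e) ?B"
      by (rule seqC_cong[OF open_ball, rotated])
    show "Ck_on k (\<lambda>x. ?D w 0 x e) ?B" using Suc.prems(2) by simp
  qed
  have "seqC k (\<lambda>m x. ?D w m x v) ?B" for v
  proof -
    let ?v' = "v - (v \<bullet> e) *\<^sub>R e"
    have "?v' \<bullet> e = 0" by (simp add: inner_diff_left)
    then have "seqC k (\<lambda>m x. ?D w m x ?v' + (v \<bullet> e) *\<^sub>R ?D w m x e) ?B"
      by (intro seqC_add open_ball transversal seqC_bounded_linear[OF bounded_linear_scaleR_right] along)
    moreover have "?D w m x ?v' + (v \<bullet> e) *\<^sub>R ?D w m x e = ?D w m x v" if "x \<in> ?B" for m x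
      using has_derivative_linear[OF dw[OF that]] by (simp add: linear_diff linear_cmul)
    ultimately show ?thesis
      by (rule seqC_cong[OF open_ball, rotated])
  qed
  moreover have "w m differentiable (at x)" if "x \<in> ?B" for m x
    using dw[OF that] by (rule differentiableI)
  ultimately show ?case
    using seqC_lu_conv[OF w] by simp
qed

lemma line_int_at_center [simp]: "I u p = 0"
  by (simp add: line_int_def)

end

text \<open>
  The flow box of \<open>X\<close> transversal to the hyperplane \<open>(y - p) \<bullet> e = 0\<close> is the fixed point of
  \<open>\<Phi> = \<xi> + I (X \<circ> \<Phi>)\<close>, where \<open>\<xi>\<close> projects along \<open>e\<close> to the hyperplane. The Picard iterates
  converge together with all their derivatives.
\<close>

lemma flow_map:
  fixes X :: "'e::euclidean_space \<Rightarrow> 'e"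
  assumes U: "open U" "p \<in> U" and X: "smooth_on X U" and e: "norm e = 1"
  obtains r \<Phi> where "r > 0" "smooth_on \<Phi> (ball p r)" "\<Phi> ` ball p r \<subseteq> U" "\<Phi> p = p"
    "\<And>x. x \<in> ball p r \<Longrightarrow> frechet_derivative \<Phi> (at x) e = X (\<Phi> x)"
    "\<And>v. v \<bullet> e = 0 \<Longrightarrow> frechet_derivative \<Phi> (at p) v = v"
    "\<And>v x. v \<bullet> e = 0 \<Longrightarrow> \<forall>z\<in>U. frechet_derivative X (at z) v = 0 \<Longrightarrow> x \<in> ball p r \<Longrightarrow>
      frechet_derivative \<Phi> (at x) v = v"
proof -
  let ?D = "\<lambda>f x. frechet_derivative f (at x)"
  obtain R where R: "R > 0" "cball p R \<subseteq> U" using U unfolding open_contains_cball by auto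
  note dX = smooth_on_deriv(1)[OF X]
  have bounded_on: "\<exists>C. \<forall>z\<in>cball p R. norm (g z) \<le> C" if g: "smooth_on g U" for g :: "'e \<Rightarrow> 'e"
  proof -
    have "bounded (g ` cball p R)"
      using compact_continuous_image[OF continuous_on_subset[OF smooth_on_continuous[OF g] R(2)] compact_cball]
      by (rule compact_imp_bounded)
    then show ?thesis unfolding bounded_iff by blast
  qed
  have "\<forall>b. \<exists>C. \<forall>z\<in>cball p R. norm (?D X z b) \<le> C"
    using bounded_on[OF smooth_on_deriv(2)[OF X]] by blast
  from choice[OF this] obtain Cb where Cb: "\<And>b z. z \<in> cball p R \<Longrightarrow> norm (?D X z b) \<le> Cb b" by blast
  obtain C where C: "\<And>z. z \<in> cball p R \<Longrightarrow> norm (X z) \<le> C"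
    using bounded_on[OF X] by blast
  have pR: "p \<in> cball p R" using R by simp
  have C0: "0 \<le> C" using order_trans[OF norm_ge_zero C[OF pR]] .
  define L where "L = (\<Sum>b\<in>Basis. Cb b)"
  have L0: "0 \<le> L" unfolding L_def using order_trans[OF norm_ge_zero Cb[OF pR]] by (intro sum_nonneg) blast
  have DX: "?D X z h = (\<Sum>b\<in>Basis. (h \<bullet> b) *\<^sub>R ?D X z b)" if "z \<in> cball p R" for z h
    using that R by (intro linear_basis_expansion has_derivative_linear[OF dX]) blast
  have DXL: "norm (?D X z h) \<le> L * norm h" if z: "z \<in> cball p R" for z h
  proof -
    have "norm (\<Sum>b\<in>Basis. (h \<bullet> b) *\<^sub>R ?D X z b) \<le> (\<Sum>b\<in>Basis. norm h * Cb b)"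
    proof (rule sum_norm_le)
      fix b :: 'e assume b: "b \<in> Basis"
      show "norm ((h \<bullet> b) *\<^sub>R ?D X z b) \<le> norm h * Cb b"
        unfolding norm_scaleR by (rule mult_mono[OF Basis_le_norm[OF b] Cb[OF z]]) simp_all
    qed
    then have "norm (?D X z h) \<le> (\<Sum>b\<in>Basis. norm h * Cb b)" by (subst DX[OF z])
    then show ?thesis unfolding L_def sum_distrib_right by (simp only: mult.commute)
  qed
  have lip: "dist (X x) (X y) \<le> L * dist x y" if "x \<in> cball p R" "y \<in> cball p R" for x y
    unfolding dist_norm
  proof (rule differentiable_bound[OF convex_cball _ _ that(1) that(2)])
    show "(X has_derivative ?D X x) (at x within cball p R)" if "x \<in> cball p R" for x
      using dX R that has_derivative_at_withinI by blast
    show "onorm (?D X x) \<le> L" if "x \<in> cball p R" for x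
      using DXL[OF that] by (intro onorm_le)
  qed
  \<comment> \<open>The three bounds give \<open>r + r * C \<le> R\<close>, so that no iterate
    leaves the ball of radius \<open>R\<close>, and \<open>r * L \<le> 1 / 2\<close>, so that the
    iteration contracts. Adding 1 avoids division by zero.\<close>
  define r where "r = min (R / 2) (min (R / (2 * (C + 1))) (1 / (2 * (L + 1))))"
  have r0: "0 < r" using R C0 L0 by (simp add: r_def)
  have "r \<le> R / 2" unfolding r_def by (rule min.cobounded1)
  moreover have "r * C \<le> R / 2"
  proof -
    have "r * C \<le> R / (2 * (C + 1)) * C" using C0 by (intro mult_right_mono) (simp_all add: r_def)
    also have "\<dots> \<le> R / 2" using C0 R by (simp add: field_simps)
    finally show ?thesis .
  qed
  ultimately have rC: "r + r * C \<le> R" by linarith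
  have rL: "r * L \<le> 1 / 2"
  proof -
    have "r * L \<le> 1 / (2 * (L + 1)) * L" using L0 by (intro mult_right_mono) (simp_all add: r_def)
    also have "\<dots> \<le> 1 / 2" using L0 by (simp add: field_simps)
    finally show ?thesis .
  qed
  interpret line_ball p e r by unfold_locales (rule e)
  let ?B = "ball p r"
  define \<xi> where "\<xi> y = y - ((y - p) \<bullet> e) *\<^sub>R e" for y
  define w where "w = rec_nat \<xi> (\<lambda>m f y. \<xi> y + I (\<lambda>z. X (f z)) y)"
  have w0: "w 0 = \<xi>" and wS: "\<And>m. w (Suc m) = (\<lambda>y. \<xi> y + I (\<lambda>z. X (w m z)) y)"
    by (simp_all add: w_def)
  have d\<xi>: "(\<xi> has_derivative (\<lambda>v. v - (v \<bullet> e) *\<^sub>R e)) (at y)" for y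
    unfolding \<xi>_def by (auto intro!: derivative_eq_intros)
  have s\<xi>: "smooth_on \<xi> ?B"
    by (rule smooth_onI_deriv[OF open_ball d\<xi>]) (rule smooth_on_const[OF open_ball])
  have \<xi>_dist: "dist p (\<xi> y) \<le> dist p y" for y
    using line_pt_norm[OF e, of 0 p y] by (simp add: \<xi>_def line_pt_def)
  have inv: "smooth_on (w m) ?B \<and> w m ` ?B \<subseteq> cball p R" for m
  proof (induction m)
    case 0
    have "dist p (\<xi> y) \<le> R" if "y \<in> ?B" for y
      using \<xi>_dist[of y] that \<open>r \<le> R / 2\<close> R(1) by simp
    then show ?case by (auto simp: w0 s\<xi>)
  next
    case (Suc m)
    have sX: "smooth_on (\<lambda>z. X (w m z)) ?B"
      by (rule smooth_on_compose[OF open_ball U(1) X]) (use Suc R in auto)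
    have "dist p (w (Suc m) y) \<le> R" if y: "y \<in> ?B" for y
    proof -
      have sub: "cball p (dist p y) \<subseteq> ?B" using y by auto
      have "norm (I (\<lambda>z. X (w m z)) y) \<le> dist p y * C"
      proof (rule line_int_norm[OF continuous_on_subset[OF smooth_on_continuous[OF sX] sub]])
        fix z assume "z \<in> cball p (dist p y)"
        then have "w m z \<in> cball p R" using Suc sub by blast
        then show "norm (X (w m z)) \<le> C" by (rule C)
      qed simp
      also have "\<dots> \<le> r * C" using y C0 by (intro mult_right_mono) auto
      finally have "norm (I (\<lambda>z. X (w m z)) y) \<le> r * C" .
      moreover have "dist p (\<xi> y) \<le> r" using \<xi>_dist[of y] y by simp
      moreover have "dist p (w (Suc m) y) \<le> dist p (\<xi> y) + norm (I (\<lambda>z. X (w m z)) y)"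
        unfolding wS dist_norm using norm_triangle_ineq4[of "p - \<xi> y" "I (\<lambda>z. X (w m z)) y"]
        by (simp add: algebra_simps)
      ultimately show ?thesis using rC by linarith
    qed
    moreover have "smooth_on (w (Suc m)) ?B"
      unfolding wS by (intro smooth_on_add open_ball s\<xi> smooth_on_line_int sX)
    ultimately show ?case by auto
  qed
  have sw: "smooth_on (w m) ?B" and wR: "\<And>y. y \<in> ?B \<Longrightarrow> w m y \<in> cball p R" for m
    using inv[of m] by blast+
  have sX: "smooth_on (\<lambda>z. X (w m z)) ?B" for m
    by (rule smooth_on_compose[OF open_ball U(1) X sw]) (use wR R in blast)
  have tame: "tame_range w ?B U"
    unfolding tame_range_def
  proof (intro allI impI exI conjI)
    show "compact (cball p R)" "cball p R \<subseteq> U" using R by auto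
    show "w m ` K \<subseteq> cball p R" if "K \<subseteq> ?B" for K m using wR that by blast
  qed
  have Dw: "?D (w (Suc m)) y v = (v - (v \<bullet> e) *\<^sub>R e) + (I (\<lambda>z. ?D X (w m z) (?D (w m) z (v - (v \<bullet> e) *\<^sub>R e))) y + (v \<bullet> e) *\<^sub>R X (w m y))"
    if y: "y \<in> ?B" for m y v
  proof -
    have d: "((\<lambda>z. X (w m z)) has_derivative (\<lambda>v. ?D X (w m z) (?D (w m) z v))) (at z)" if "z \<in> ?B" for z
    proof -
      have "w m z \<in> U" using wR[OF that] R by blast
      from diff_chain_at[OF smooth_on_deriv(1)[OF sw that] dX[OF this]] show ?thesis by (simp add: comp_def)
    qed
    have "continuous_on ?B (\<lambda>z. ?D X (w m z) (?D (w m) z v))" for v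
      using smooth_on_continuous[OF smooth_on_deriv(2)[OF sX[of m], of v]]
      by (rule continuous_on_eq) (simp add: frechet_derivative_at[OF d, symmetric])
    then have "(w (Suc m) has_derivative (\<lambda>v. (v - (v \<bullet> e) *\<^sub>R e) +
        (I (\<lambda>z. ?D X (w m z) (?D (w m) z (v - (v \<bullet> e) *\<^sub>R e))) y + (v \<bullet> e) *\<^sub>R X (w m y)))) (at y)"
      unfolding wS by (intro has_derivative_add d\<xi> line_int_deriv d y)
    from fun_cong[OF frechet_derivative_at[OF this], of v] show ?thesis by (rule sym)
  qed
  have Dw_e: "?D (w (Suc m)) y e = X (w m y)" if y: "y \<in> ?B" for m y
  proof -
    have "I (\<lambda>z. ?D X (w m z) (?D (w m) z 0)) y = I (\<lambda>z. 0) y"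
    proof (rule line_int_cong[OF _ y])
      fix z assume z: "z \<in> ?B"
      have "w m z \<in> U" using wR[OF z] R by blast
      then show "?D X (w m z) (?D (w m) z 0) = 0"
        using linear_0[OF has_derivative_linear[OF smooth_on_deriv(1)[OF sw z]]]
          linear_0[OF has_derivative_linear[OF dX]] by simp
    qed
    then show ?thesis using Dw[OF y, of m e] by simp
  qed
  have lu: "lu_conv w ?B"
  proof (rule lu_conv_ballI)
    show "continuous_on ?B (w m)" for m by (rule smooth_on_continuous[OF sw])
    fix \<rho> assume \<rho>: "\<rho> < r"
    then have sub: "cball p \<rho> \<subseteq> ?B" by auto
    show "uniformly_convergent_on (cball p \<rho>) w"
    proof (rule contraction_uniformly_convergent)
      show "norm (w m y) \<le> norm p + R" if "y \<in> cball p \<rho>" for m y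
      proof -
        have "dist p (w m y) \<le> R" using wR[of y m] that sub by auto
        then show ?thesis using norm_triangle_sub[of "w m y" p] by (simp add: dist_norm norm_minus_commute)
      qed
      show "\<exists>M. \<forall>m\<ge>M. \<forall>n\<ge>M. \<forall>d. (\<forall>y\<in>cball p \<rho>. dist (w m y) (w n y) \<le> d) \<longrightarrow>
          (\<forall>y\<in>cball p \<rho>. dist (w (Suc m) y) (w (Suc n) y) \<le> \<epsilon> + d / 2)" if "\<epsilon> > 0" for \<epsilon>
      proof (intro exI[of _ 0] allI impI ballI)
        fix m n d y assume d: "\<forall>y\<in>cball p \<rho>. dist (w m y) (w n y) \<le> d" and y: "y \<in> cball p \<rho>"
        have d0: "0 \<le> d" using order_trans[OF zero_le_dist bspec[OF d y]] .
        have "dist (I (\<lambda>z. X (w m z)) y) (I (\<lambda>z. X (w n z)) y) \<le> \<rho> * (L * d)"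
        proof (rule line_int_dist[OF _ _ y])
          show "continuous_on (cball p \<rho>) (\<lambda>z. X (w m z))" "continuous_on (cball p \<rho>) (\<lambda>z. X (w n z))"
            using continuous_on_subset[OF smooth_on_continuous[OF sX] sub] by blast+
          fix z assume z: "z \<in> cball p \<rho>"
          then have "z \<in> ?B" using sub by blast
          then have "dist (X (w m z)) (X (w n z)) \<le> L * dist (w m z) (w n z)"
            by (intro lip wR)
          also have "\<dots> \<le> L * d" using L0 d z by (intro mult_left_mono) auto
          finally show "dist (X (w m z)) (X (w n z)) \<le> L * d" .
        qed
        also have "\<dots> \<le> r * L * d"
          using \<rho> L0 d0 by (simp add: mult.assoc mult_right_mono)
        also have "\<dots> \<le> d / 2" using mult_right_mono[OF rL d0] by simp
        finally show "dist (w (Suc m) y) (w (Suc n) y) \<le> \<epsilon> + d / 2"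
          using that by (simp add: wS)
      qed
    qed
  qed
  have sC: "seqC k w ?B" for k
  proof (induction k)
    case 0
    then show ?case using lu by simp
  next
    case (Suc k)
    \<comment> \<open>Transversal derivatives of the iterates obey a linear recurrence whose
      coefficients are partial derivatives of \<open>X\<close> at \<open>w m z\<close>. These
      contain \<open>w\<close> only undifferentiated, so order \<open>k\<close> for \<open>w\<close>
      gives order \<open>k\<close> for its first derivatives.\<close>
    have transversal: "seqC k (\<lambda>m x. ?D (w m) x v) ?B" if v: "v \<bullet> e = 0" for v
    proof (rule linear_recurrence_seqC[OF r0 rL])
      show "norm (\<Sum>b\<in>Basis. (h \<bullet> b) *\<^sub>R ?D X (w m z) b) \<le> L * norm h" if "z \<in> ?B" for m z h
        using DXL[OF wR[OF that], of m h] by (subst (asm) DX[OF wR[OF that]])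
      show "seqC k (\<lambda>m x. v) ?B" by (rule seqC_const[OF open_ball])
      show "Ck_on k (\<lambda>x. ?D (w 0) x v) ?B"
        using smooth_on_deriv(2)[OF sw] unfolding smooth_on_def by blast
      show "seqC k (\<lambda>m z. ?D X (w m z) b) ?B" for b
        using smooth_on_deriv(2)[OF X]
        by (intro seqC_compose[OF open_ball U(1) _ Suc tame]) (simp add: smooth_on_def)
      show "?D (w (Suc m)) y v = v + I (\<lambda>z. \<Sum>b\<in>Basis. (?D (w m) z v \<bullet> b) *\<^sub>R ?D X (w m z) b) y" if y: "y \<in> ?B" for m y
      proof -
        have "I (\<lambda>z. \<Sum>b\<in>Basis. (?D (w m) z v \<bullet> b) *\<^sub>R ?D X (w m z) b) y = I (\<lambda>z. ?D X (w m z) (?D (w m) z v)) y"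
          by (rule line_int_cong[OF _ y]) (rule DX[OF wR, symmetric])
        then show ?thesis using Dw[OF y, of m v] v by simp
      qed
    qed
    have along: "seqC k (\<lambda>m x. ?D (w m) x e) ?B"
    proof (rule seqC_shift[OF open_ball])
      have "seqC k (\<lambda>m y. X (w m y)) ?B"
        using X by (intro seqC_compose[OF open_ball U(1) _ Suc tame]) (simp add: smooth_on_def)
      then show "seqC k (\<lambda>m y. ?D (w (Suc m)) y e) ?B"
        by (rule seqC_cong[OF open_ball, rotated]) (rule Dw_e[symmetric])
      show "Ck_on k (\<lambda>x. ?D (w 0) x e) ?B"
        using smooth_on_deriv(2)[OF sw] unfolding smooth_on_def by blast
    qed
    have "seqC k (\<lambda>m x. ?D (w m) x v) ?B" for v
    proof -
      let ?v' = "v - (v \<bullet> e) *\<^sub>R e"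
      have "?v' \<bullet> e = 0" by (simp add: inner_diff_left)
      then have "seqC k (\<lambda>m x. ?D (w m) x ?v' + (v \<bullet> e) *\<^sub>R ?D (w m) x e) ?B"
        by (intro seqC_add open_ball transversal seqC_bounded_linear[OF bounded_linear_scaleR_right] along)
      moreover have "?D (w m) x ?v' + (v \<bullet> e) *\<^sub>R ?D (w m) x e = ?D (w m) x v" if "x \<in> ?B" for m x
        using has_derivative_linear[OF smooth_on_deriv(1)[OF sw that]] by (simp add: linear_diff linear_cmul)
      ultimately show ?thesis by (rule seqC_cong[OF open_ball, rotated])
    qed
    moreover have "w m differentiable (at x)" if "x \<in> ?B" for m x
      using smooth_on_deriv(1)[OF sw that] by (rule differentiableI)
    ultimately show ?case using lu by simp
  qed
  define \<Phi> where "\<Phi> y = lim (\<lambda>m. w m y)" for y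
  have lim: "(\<lambda>m. w m y) \<longlonglongrightarrow> \<Phi> y" if "y \<in> ?B" for y
  proof -
    have "uniformly_convergent_on {y} w" using lu_convD(2)[OF lu, of "{y}"] that by simp
    then have "convergent (\<lambda>m. w m y)" by (rule uniformly_convergent_imp_convergent) simp
    then show ?thesis unfolding \<Phi>_def by (rule convergent_LIMSEQ_iff[THEN iffD1])
  qed
  have s\<Phi>: "smooth_on \<Phi> ?B"
    unfolding smooth_on_def using seqC_limit[OF open_ball sC lim] by blast
  have \<Phi>R: "\<Phi> y \<in> cball p R" if "y \<in> ?B" for y
    by (rule closed_sequentially[OF closed_cball _ lim[OF that]]) (rule wR[OF that])
  have lim_deriv: "(\<lambda>m. ?D (w (Suc m)) y v) \<longlonglongrightarrow> ?D \<Phi> y v" if y: "y \<in> ?B" for y v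
  proof -
    obtain F' where F': "(\<Phi> has_derivative F') (at y)" "\<And>v. (\<lambda>m. ?D (w m) y v) \<longlonglongrightarrow> F' v"
      using seqC_limit_deriv[OF open_ball sC lim y] by blast
    then show ?thesis using frechet_derivative_at[OF F'(1)] LIMSEQ_Suc[OF F'(2)] by simp
  qed
  have wp: "w m p = p" for m by (cases m) (simp_all add: w0 wS \<xi>_def)
  show ?thesis
  proof (rule that[OF r0 s\<Phi>])
    show "\<Phi> ` ?B \<subseteq> U" using \<Phi>R R by blast
    show "\<Phi> p = p" using lim[of p] wp r0 LIMSEQ_unique[OF _ tendsto_const] by auto
    show "?D \<Phi> x e = X (\<Phi> x)" if x: "x \<in> ?B" for x
    proof -
      have "isCont X (\<Phi> x)" using dX[THEN has_derivative_continuous] \<Phi>R[OF x] R by blast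
      then have "(\<lambda>m. X (w m x)) \<longlonglongrightarrow> X (\<Phi> x)" using lim[OF x] by (rule isCont_tendsto_compose)
      then show ?thesis using lim_deriv[OF x, of e] LIMSEQ_unique by (simp add: Dw_e[OF x])
    qed
    show "?D \<Phi> p v = v" if v: "v \<bullet> e = 0" for v
    proof -
      have pB: "p \<in> ?B" using r0 by simp
      have "?D (w (Suc m)) p v = v" for m using Dw[OF pB, of m v] v by simp
      then show ?thesis using lim_deriv[OF pB, of v] LIMSEQ_unique[OF _ tendsto_const] by simp
    qed
    show "?D \<Phi> x v = v" if v: "v \<bullet> e = 0" "\<forall>z\<in>U. ?D X z v = 0" and x: "x \<in> ?B" for v x
    proof -
      \<comment> \<open>If \<open>D (w m)\<close> fixes \<open>v\<close>, then the integrand of the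
        next derivative is \<open>D X\<close> in direction \<open>v\<close>, which is zero; so every
        iterate, and hence the limit, fixes \<open>v\<close>.\<close>
      have "\<forall>x\<in>?B. ?D (w m) x v = v" for m
      proof (induction m)
        case 0
        show ?case using fun_cong[OF frechet_derivative_at[OF d\<xi>], of v] v(1) by (simp add: w0)
      next
        case (Suc m)
        show ?case
        proof
          fix y assume y: "y \<in> ?B"
          have "I (\<lambda>z. ?D X (w m z) (?D (w m) z v)) y = I (\<lambda>z. 0) y"
          proof (rule line_int_cong[OF _ y])
            fix z assume z: "z \<in> ?B"
            have "w m z \<in> U" using wR[OF z] R by blast
            then show "?D X (w m z) (?D (w m) z v) = 0" using Suc z v(2) by simp
          qed
          then show "?D (w (Suc m)) y v = v" using Dw[OF y, of m v] v(1) by simp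
        qed
      qed
      then have "?D (w (Suc m)) x v = v" for m using x by blast
      then show ?thesis using lim_deriv[OF x, of v] LIMSEQ_unique[OF _ tendsto_const] by simp
    qed
  qed
qed

section \<open>Symmetry of second derivatives\<close>

lemma (in line_ball) line_int_deriv_along:
  fixes u :: "'e \<Rightarrow> 'f::euclidean_space"
  assumes u: "smooth_on u (ball p r)" and y: "y \<in> ball p r"
  shows "I (\<lambda>z. frechet_derivative u (at z) e) y = u y - u (y - ((y - p) \<bullet> e) *\<^sub>R e)"
proof -
  let ?c = "line_pt p e y"
  have "((\<lambda>s. ((y - p) \<bullet> e) *\<^sub>R frechet_derivative u (at (?c s)) e) has_integral (u (?c 1) - u (?c 0))) {0..1}"
  proof (rule fundamental_theorem_of_calculus)
    fix s :: real assume s: "s \<in> {0..1}"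
    note du = smooth_on_deriv(1)[OF u line_pt_ball[OF y s]]
    have "(?c has_derivative (\<lambda>h. (h * ((y - p) \<bullet> e)) *\<^sub>R e)) (at s)"
      unfolding line_pt_def by (auto intro!: derivative_eq_intros simp: algebra_simps)
    from diff_chain_at[OF this du]
    have "((\<lambda>s. u (?c s)) has_derivative (\<lambda>h. h *\<^sub>R (((y - p) \<bullet> e) *\<^sub>R frechet_derivative u (at (?c s)) e))) (at s)"
      using has_derivative_linear[OF du] by (simp add: comp_def linear_cmul)
    then show "((\<lambda>s. u (?c s)) has_vector_derivative ((y - p) \<bullet> e) *\<^sub>R frechet_derivative u (at (?c s)) e) (at s within {0..1})"
      unfolding has_vector_derivative_def by (rule has_derivative_at_withinI)
  qed simp
  from integral_unique[OF this] show ?thesis unfolding line_int_def by (simp add: line_pt_def)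
qed

text \<open>Integrating \<open>D\<^sub>e u\<close> along \<open>e\<close> recovers \<open>u\<close> up to \<open>u \<circ> \<xi>\<close>, and \<open>D\<^sub>v\<close> commutes with this integration.\<close>

lemma symmetric_second_derivative:
  fixes u :: "'e::euclidean_space \<Rightarrow> 'f::euclidean_space"
  assumes "open U" "smooth_on u U" "p \<in> U"
  shows "frechet_derivative (\<lambda>x. frechet_derivative u (at x) v) (at p) w =
    frechet_derivative (\<lambda>x. frechet_derivative u (at x) w) (at p) v"
proof -
  let ?D = "\<lambda>f x. frechet_derivative f (at x)"
  let ?H = "\<lambda>a. ?D (\<lambda>x. ?D u x a) p"
  note du = smooth_on_deriv(1)[OF assms(2)]
  have H: "((\<lambda>x. ?D u x a) has_derivative ?H a) (at p)" for a
    by (rule smooth_on_deriv(1)[OF smooth_on_deriv(2)[OF assms(2)] assms(3)])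
  have H_add: "?H (a + c *\<^sub>R b) h = ?H a h + c *\<^sub>R ?H b h" for a b c h
  proof -
    have "((\<lambda>x. ?D u x a + c *\<^sub>R ?D u x b) has_derivative (\<lambda>h. ?H a h + c *\<^sub>R ?H b h)) (at p)"
      by (intro has_derivative_add has_derivative_scaleR_right H)
    then have "((\<lambda>x. ?D u x (a + c *\<^sub>R b)) has_derivative (\<lambda>h. ?H a h + c *\<^sub>R ?H b h)) (at p)"
      by (rule has_derivative_transform_within_open[OF _ assms(1,3)])
        (simp add: linear_add[OF has_derivative_linear[OF du]] linear_cmul[OF has_derivative_linear[OF du]])
    from fun_cong[OF frechet_derivative_at[OF this], of h] show ?thesis by (rule sym)
  qed
  note linH = has_derivative_linear[OF H]
  \<comment> \<open>Both sides are bilinear in \<open>v\<close> and \<open>w\<close>. Writing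
    \<open>w\<close> as a multiple of a unit vector \<open>e\<close> and splitting \<open>v\<close>
    along \<open>e\<close> leaves only this case with any content.\<close>
  have commute: "?H v e = ?H e v" if e: "norm e = 1" and v: "v \<bullet> e = 0" for e v
  proof -
    obtain r where r: "r > 0" "ball p r \<subseteq> U" using assms(1,3) open_contains_ball by blast
    interpret line_ball p e r by unfold_locales (rule e)
    let ?B = "ball p r"
    have u: "smooth_on u ?B" by (rule smooth_on_subset[OF assms(2) r(2)])
    have p: "p \<in> ?B" using r by simp
    define \<xi> where "\<xi> y = y - ((y - p) \<bullet> e) *\<^sub>R e" for y
    have d\<xi>: "(\<xi> has_derivative (\<lambda>v. v - (v \<bullet> e) *\<^sub>R e)) (at y)" for y
      unfolding \<xi>_def by (auto intro!: derivative_eq_intros)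
    have \<xi>B: "\<xi> y \<in> ?B" if "y \<in> ?B" for y
      using line_pt_ball[OF that, of 0] by (simp add: line_pt_def \<xi>_def)
    have \<xi>p: "\<xi> p = p" by (simp add: \<xi>_def)
    define g where "g z = ?D u z e" for z
    have Ig: "I g y = u y - u (\<xi> y)" if "y \<in> ?B" for y
      using line_int_deriv_along[OF u that] by (simp add: g_def[abs_def] \<xi>_def)
    have g: "smooth_on g ?B" unfolding g_def by (rule smooth_on_deriv(2)[OF u])
    have Duv: "?D u y v = ?D u (\<xi> y) v + I (\<lambda>z. ?D g z v) y" if y: "y \<in> ?B" for y
    proof -
      have "((\<lambda>y. u (\<xi> y) + I g y) has_derivative (\<lambda>h. ?D u (\<xi> y) (h - (h \<bullet> e) *\<^sub>R e) +
          (I (\<lambda>z. ?D g z (h - (h \<bullet> e) *\<^sub>R e)) y + (h \<bullet> e) *\<^sub>R g y))) (at y)"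
        using diff_chain_at[OF d\<xi> smooth_on_deriv(1)[OF u \<xi>B[OF y]]]
        by (intro has_derivative_add line_int_deriv smooth_on_deriv(1)[OF g] y
            smooth_on_continuous[OF smooth_on_deriv(2)[OF g]]) (simp_all add: comp_def)
      then have "(u has_derivative (\<lambda>h. ?D u (\<xi> y) (h - (h \<bullet> e) *\<^sub>R e) +
          (I (\<lambda>z. ?D g z (h - (h \<bullet> e) *\<^sub>R e)) y + (h \<bullet> e) *\<^sub>R g y))) (at y)"
        by (rule has_derivative_transform_within_open[OF _ open_ball y]) (simp add: Ig)
      from fun_cong[OF frechet_derivative_at[OF this], of v] v show ?thesis by simp
    qed
    have g2: "smooth_on (\<lambda>z. ?D g z v) ?B" by (rule smooth_on_deriv(2)[OF g])
    have "((\<lambda>x. ?D u x v) has_derivative ?H v) (at (\<xi> p))" unfolding \<xi>p by (rule H)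
    from diff_chain_at[OF d\<xi> this]
    have "((\<lambda>y. ?D u (\<xi> y) v) has_derivative (\<lambda>h. ?H v (h - (h \<bullet> e) *\<^sub>R e))) (at p)"
      by (simp add: comp_def)
    then have "((\<lambda>y. ?D u (\<xi> y) v + I (\<lambda>z. ?D g z v) y) has_derivative
        (\<lambda>h. ?H v (h - (h \<bullet> e) *\<^sub>R e) +
          (I (\<lambda>z. ?D (\<lambda>z. ?D g z v) z (h - (h \<bullet> e) *\<^sub>R e)) p + (h \<bullet> e) *\<^sub>R ?D g p v))) (at p)"
      by (intro has_derivative_add line_int_deriv smooth_on_deriv(1)[OF g2] p
            smooth_on_continuous[OF smooth_on_deriv(2)[OF g2]])
    then have "((\<lambda>y. ?D u y v) has_derivative
        (\<lambda>h. ?H v (h - (h \<bullet> e) *\<^sub>R e) +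
          (I (\<lambda>z. ?D (\<lambda>z. ?D g z v) z (h - (h \<bullet> e) *\<^sub>R e)) p + (h \<bullet> e) *\<^sub>R ?D g p v))) (at p)"
      by (rule has_derivative_transform_within_open[OF _ open_ball p]) (simp add: Duv)
    \<comment> \<open>In direction \<open>e\<close> at \<open>p\<close> the first term vanishes
      because \<open>e\<close> projects to 0, and the integral because its segment has length 0.
      Only \<open>D g\<close> in direction \<open>v\<close> survives.\<close>
    from fun_cong[OF frechet_derivative_at[OF this], of e]
    show ?thesis using linear_0[OF linH] by (simp add: g_def[abs_def])
  qed
  show ?thesis
  proof (cases "w = 0")
    case True
    have "?H 0 v = 0" using H_add[of 0 "-1" 0 v] by simp
    then show ?thesis using linear_0[OF linH] True by simp
  next
    case False
    define e where "e = w /\<^sub>R norm w"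
    define v' where "v' = v - (v \<bullet> e) *\<^sub>R e"
    have e: "norm e = 1" and w: "w = 0 + norm w *\<^sub>R e" using False by (simp_all add: e_def)
    have v': "v' \<bullet> e = 0" using e by (simp add: v'_def inner_diff_left dot_square_norm)
    have v: "v = v' + (v \<bullet> e) *\<^sub>R e" by (simp add: v'_def)
    have H0: "?H 0 h = 0" for h using H_add[of 0 "-1" 0 h] by simp
    have "?H v w = norm w *\<^sub>R ?H v e" by (subst w) (simp add: linear_cmul[OF linH])
    also have "?H v e = ?H v' e + (v \<bullet> e) *\<^sub>R ?H e e" by (subst v) (rule H_add)
    also have "?H v' e = ?H e v'" by (rule commute[OF e v'])
    also have "?H e v' + (v \<bullet> e) *\<^sub>R ?H e e = ?H e (v' + (v \<bullet> e) *\<^sub>R e)"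
      by (simp only: linear_add[OF linH] linear_cmul[OF linH])
    also have "v' + (v \<bullet> e) *\<^sub>R e = v" by (rule v[symmetric])
    also have "norm w *\<^sub>R ?H e v = ?H (0 + norm w *\<^sub>R e) v" by (simp only: H_add H0) simp
    also have "0 + norm w *\<^sub>R e = w" by (rule w[symmetric])
    finally show ?thesis .
  qed
qed

section \<open>Local parametrizations\<close>

lemma linear_frechet: "smooth_on f S \<Longrightarrow> x \<in> S \<Longrightarrow> linear (frechet_derivative f (at x))"
  using has_derivative_linear[OF smooth_on_deriv(1)] .

lemma smooth_on_vec_nth:
  fixes f :: "'e::euclidean_space \<Rightarrow> real ^ 'n"
  shows "open S \<Longrightarrow> smooth_on f S \<Longrightarrow> smooth_on (\<lambda>x. f x $ i) S"
  by (rule smooth_on_bounded_linear[OF bounded_linear_vec_nth])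

lemma smooth_on_vecI:
  fixes f :: "'e::euclidean_space \<Rightarrow> real ^ 'n"
  assumes "open S" "\<And>i. smooth_on (\<lambda>x. f x $ i) S"
  shows "smooth_on f S"
proof -
  have "smooth_on (\<lambda>x. \<Sum>i\<in>UNIV. (f x $ i) *\<^sub>R (axis i 1 :: real ^ 'n)) S"
    by (intro smooth_on_sum smooth_on_scaleR smooth_on_const assms) auto
  then show ?thesis
    using basis_expansion[of "f _"] by (simp add: scalar_mult_eq_scaleR)
qed

lemma smooth_on_det:
  fixes M :: "'e::euclidean_space \<Rightarrow> real ^ 'n ^ 'n"
  assumes "open S" "\<And>i j. smooth_on (\<lambda>x. M x $ i $ j) S"
  shows "smooth_on (\<lambda>x. det (M x)) S"
  unfolding det_def
  by (intro smooth_on_sum smooth_on_mult smooth_on_const smooth_on_prod assms) auto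

text \<open>By Cramer's rule the solution is a quotient of determinants, so even a solution picked
  pointwise by choice is smooth.\<close>

lemma smooth_on_solve:
  fixes M :: "'e::euclidean_space \<Rightarrow> real ^ 'n ^ 'n"
  assumes S: "open S" and M: "\<And>i j. smooth_on (\<lambda>x. M x $ i $ j) S" and b: "smooth_on b S"
    and det: "\<And>x. x \<in> S \<Longrightarrow> det (M x) \<noteq> 0" and X: "\<And>x. x \<in> S \<Longrightarrow> M x *v X x = b x"
  shows "smooth_on X S"
proof (rule smooth_on_vecI[OF S])
  fix k
  have "smooth_on (\<lambda>x. det (\<chi> i j. if j = k then b x $ i else M x $ i $ j) / det (M x)) S"
  proof (intro smooth_on_divide smooth_on_det S M det)
    show "smooth_on (\<lambda>x. (\<chi> i j. if j = k then b x $ i else M x $ i $ j) $ i $ j) S" for i j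
      using M[of i j] smooth_on_vec_nth[OF S b, of i] by (cases "j = k") auto
  qed
  moreover have "det (\<chi> i j. if j = k then b x $ i else M x $ i $ j) / det (M x) = X x $ k" if "x \<in> S" for x
    by (subst iffD1[OF cramer[OF det[OF that]] X[OF that]]) simp
  ultimately show "smooth_on (\<lambda>x. X x $ k) S"
    by (rule smooth_on_cong[OF S, rotated])
qed

lemma matrix_apply: "linear f \<Longrightarrow> matrix f *v x = f (x :: real ^ 'n)"
  using matrix_works[of f x] by (simp add: linear_matrix_vector_mul_eq)

lemma smooth_on_matrix_deriv:
  fixes f :: "real ^ 'n \<Rightarrow> real ^ 'n"
  assumes "open S" "smooth_on f S"
  shows "smooth_on (\<lambda>x. matrix (frechet_derivative f (at x)) $ i $ j) S"
  unfolding matrix_def using smooth_on_vec_nth[OF assms(1) smooth_on_deriv(2)[OF assms(2)]] by simp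

text \<open>A parametrization runs from new coordinates to old ones, the direction in which forms
  are pulled back. Equal dimensions and the injective derivative make it a diffeomorphism onto an
  open image, see \<open>param_inverse\<close>.\<close>

definition param :: "(real ^ 'n) set \<Rightarrow> (real ^ 'n \<Rightarrow> real ^ 'n) \<Rightarrow> bool"
  where "param V \<Phi> \<longleftrightarrow> open V \<and> smooth_on \<Phi> V \<and> inj_on \<Phi> V \<and>
    (\<forall>x\<in>V. inj (frechet_derivative \<Phi> (at x)))"

lemma paramD:
  assumes "param V \<Phi>"
  shows "open V" "smooth_on \<Phi> V" "inj_on \<Phi> V" "x \<in> V \<Longrightarrow> inj (frechet_derivative \<Phi> (at x))"
    "x \<in> V \<Longrightarrow> linear (frechet_derivative \<Phi> (at x))"
    "x \<in> V \<Longrightarrow> (\<Phi> has_derivative frechet_derivative \<Phi> (at x)) (at x)"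
  using assms linear_frechet smooth_on_deriv(1) unfolding param_def by blast+

lemma param_open_image:
  assumes "param V \<Phi>" "open W" "W \<subseteq> V"
  shows "open (\<Phi> ` W)"
proof (rule invariance_of_domain[OF _ assms(2)])
  show "continuous_on W \<Phi>"
    using smooth_on_continuous[OF paramD(2)[OF assms(1)]] assms(3) by (rule continuous_on_subset)
  show "inj_on \<Phi> W" using paramD(3)[OF assms(1)] assms(3) by (rule inj_on_subset)
qed

lemma param_id: "open U \<Longrightarrow> param U (\<lambda>x. x)"
  unfolding param_def by (auto simp: smooth_on_ident)

lemma param_compose_deriv:
  assumes "param V \<Phi>" "param W \<Psi>" "\<Psi> ` W \<subseteq> V" "x \<in> W"
  shows "frechet_derivative (\<Phi> \<circ> \<Psi>) (at x) = frechet_derivative \<Phi> (at (\<Psi> x)) \<circ> frechet_derivative \<Psi> (at x)"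
proof -
  have "\<Psi> x \<in> V" using assms by blast
  from diff_chain_at[OF paramD(6)[OF assms(2,4)] paramD(6)[OF assms(1) this]]
  show ?thesis by (rule frechet_derivative_at[symmetric])
qed

lemma param_compose:
  assumes "param V \<Phi>" "param W \<Psi>" "\<Psi> ` W \<subseteq> V"
  shows "param W (\<Phi> \<circ> \<Psi>)"
  unfolding param_def
proof (intro conjI ballI)
  show "open W" by (rule paramD(1)[OF assms(2)])
  show "smooth_on (\<Phi> \<circ> \<Psi>) W"
    unfolding comp_def
    by (rule smooth_on_compose[OF paramD(1)[OF assms(2)] paramD(1)[OF assms(1)] paramD(2)[OF assms(1)]
          paramD(2)[OF assms(2)] assms(3)])
  show "inj_on (\<Phi> \<circ> \<Psi>) W"
    by (rule comp_inj_on[OF paramD(3)[OF assms(2)] inj_on_subset[OF paramD(3)[OF assms(1)] assms(3)]])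
  show "inj (frechet_derivative (\<Phi> \<circ> \<Psi>) (at x))" if "x \<in> W" for x
  proof -
    have "\<Psi> x \<in> V" using assms(3) that by blast
    then show ?thesis
      unfolding param_compose_deriv[OF assms that]
      by (intro inj_compose paramD(4)[OF assms(1)] paramD(4)[OF assms(2) that])
  qed
qed

text \<open>The derivative of the inverse at \<open>y\<close> is the inverse matrix taken at
  \<open>\<Psi> y\<close>, smooth in its base point by Cramer's rule. Hence order \<open>k\<close>
  of \<open>\<Psi>\<close> gives order \<open>k\<close> of its derivative, and smoothness follows by
  induction.\<close>

lemma param_inverse:
  fixes \<Phi> :: "real ^ 'n \<Rightarrow> real ^ 'n"
  assumes P: "param V \<Phi>"
  defines "\<Psi> \<equiv> inv_into V \<Phi>"
  shows "param (\<Phi> ` V) \<Psi>"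
    and "x \<in> V \<Longrightarrow> frechet_derivative \<Psi> (at (\<Phi> x)) (frechet_derivative \<Phi> (at x) v) = v"
    and "x \<in> V \<Longrightarrow> frechet_derivative \<Phi> (at x) (frechet_derivative \<Psi> (at (\<Phi> x)) v) = v"
proof -
  let ?D = "\<lambda>f x. frechet_derivative f (at x)"
  have \<Psi>\<Phi>: "\<Psi> (\<Phi> x) = x" if "x \<in> V" for x
    unfolding \<Psi>_def using paramD(3)[OF P] that by simp
  define G where "G x = inv (?D \<Phi> x)" for x
  have surj: "surj (?D \<Phi> x)" if "x \<in> V" for x
    by (rule linear_injective_imp_surjective[OF paramD(5)[OF P that] paramD(4)[OF P that] refl])
  have DG: "?D \<Phi> x (G x v) = v" if "x \<in> V" for x v
    unfolding G_def by (rule surj_f_inv_f[OF surj[OF that]])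
  have GD: "G x (?D \<Phi> x v) = v" if "x \<in> V" for x v
    unfolding G_def by (rule inv_f_f[OF paramD(4)[OF P that]])
  have d: "(\<Psi> has_derivative G x) (at (\<Phi> x))" if "x \<in> V" for x
    by (rule has_derivative_inverse_strong[OF paramD(1)[OF P] that smooth_on_continuous[OF paramD(2)[OF P]] \<Psi>\<Phi> paramD(6)[OF P that]])
      (auto simp: fun_eq_iff DG[OF that])
  have D\<Psi>: "?D \<Psi> (\<Phi> x) = G x" if "x \<in> V" for x
    using frechet_derivative_at[OF d[OF that]] by (rule sym)
  show "x \<in> V \<Longrightarrow> ?D \<Psi> (\<Phi> x) (?D \<Phi> x v) = v" "x \<in> V \<Longrightarrow> ?D \<Phi> x (?D \<Psi> (\<Phi> x) v) = v"
    by (simp_all add: D\<Psi> DG GD)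
  have op: "open (\<Phi> ` V)" by (rule param_open_image[OF P paramD(1)[OF P] subset_refl])
  have sG: "smooth_on (\<lambda>x. G x v) V" for v
  proof (rule smooth_on_solve[OF paramD(1)[OF P] smooth_on_matrix_deriv[OF paramD(1,2)[OF P]] smooth_on_const[OF paramD(1)[OF P]]])
    show "det (matrix (?D \<Phi> x)) \<noteq> 0" if "x \<in> V" for x
      using det_nz_iff_inj[OF paramD(5)[OF P that]] paramD(4)[OF P that] by blast
    show "matrix (?D \<Phi> x) *v G x v = v" if "x \<in> V" for x
      using matrix_apply[OF paramD(5)[OF P that]] DG[OF that] by simp
  qed
  have \<Psi>V: "\<Psi> ` \<Phi> ` V \<subseteq> V" using \<Psi>\<Phi> by auto
  have dy: "(\<Psi> has_derivative G (\<Psi> y)) (at y)" if "y \<in> \<Phi> ` V" for y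
    using d that \<Psi>\<Phi> by auto
  have "Ck_on k \<Psi> (\<Phi> ` V)" for k
  proof (induction k)
    case 0
    have "continuous_on (\<Phi> ` V) \<Psi>"
      by (rule continuous_at_imp_continuous_on) (blast intro: has_derivative_continuous[OF dy])
    then show ?case by simp
  next
    case (Suc k)
    show ?case
    proof (rule Ck_on_SucI[OF op dy])
      show "Ck_on k (\<lambda>y. G (\<Psi> y) v) (\<Phi> ` V)" for v
        using sG by (intro Ck_on_compose[OF op paramD(1)[OF P] _ Suc \<Psi>V]) (simp add: smooth_on_def)
    qed
  qed
  then have "smooth_on \<Psi> (\<Phi> ` V)" by (simp add: smooth_on_def)
  moreover have "inj_on \<Psi> (\<Phi> ` V)" unfolding \<Psi>_def by (rule inj_on_inv_into) simp
  moreover have "inj (?D \<Psi> y)" if "y \<in> \<Phi> ` V" for y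
  proof -
    from that obtain x where x: "x \<in> V" "y = \<Phi> x" by blast
    have "inj (G x)" by (rule inj_on_inverseI[of _ "?D \<Phi> x"]) (simp add: DG[OF x(1)])
    then show ?thesis by (simp add: x(2) D\<Psi>[OF x(1)])
  qed
  ultimately show "param (\<Phi> ` V) \<Psi>" using op by (simp add: param_def)
qed

text \<open>The inverse function theorem: local injectivity follows from continuity of the
  derivative, and nonvanishing of the determinant keeps the derivative injective nearby.\<close>

lemma param_local:
  fixes \<Phi> :: "real ^ 'n \<Rightarrow> real ^ 'n"
  assumes U: "open U" "p \<in> U" and s: "smooth_on \<Phi> U" and inj: "inj (frechet_derivative \<Phi> (at p))"
  obtains V where "p \<in> V" "V \<subseteq> U" "param V \<Phi>"
proof -
  let ?D = "\<lambda>x. frechet_derivative \<Phi> (at x)"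
  have lin: "linear (?D x)" if "x \<in> U" for x using linear_frechet[OF s that] .
  note d = smooth_on_deriv(1)[OF s]
  let ?det = "\<lambda>x. det (matrix (?D x))"
  have "open {x \<in> U. ?det x \<in> - {0}}"
    using smooth_on_continuous[OF smooth_on_det[OF U(1) smooth_on_matrix_deriv[OF U(1) s]]] U(1)
    by (intro continuous_open_preimage[unfolded vimage_def Int_def, simplified]) auto
  moreover have "?det p \<noteq> 0" using det_nz_iff_inj[OF lin[OF U(2)]] inj by blast
  moreover define W where "W = {x \<in> U. ?det x \<in> - {0}}"
  ultimately have W: "open W" "p \<in> W" "W \<subseteq> U" using U(2) by auto
  have injW: "inj (?D x)" if "x \<in> W" for x
    using that det_nz_iff_inj[OF lin] by (auto simp: W_def)
  obtain g where g: "linear g" "g \<circ> ?D p = id"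
    using linear_injective_left_inverse[OF lin[OF U(2)] inj] by blast
  \<comment> \<open>Local injectivity needs continuity in operator norm, while smoothness gives it
    for fixed vectors; the finitely many basis vectors mediate between the two.\<close>
  have cont: "\<exists>d>0. \<forall>x. dist p x < d \<longrightarrow> onorm (\<lambda>v. ?D x v - ?D p v) < \<epsilon>" if \<epsilon>: "\<epsilon> > 0" for \<epsilon>
  proof -
    let ?e = "\<epsilon> / (2 * real DIM(real ^ 'n))"
    have e0: "?e > 0" using \<epsilon> by simp
    have "\<forall>\<^sub>F x in nhds p. dist (?D x b) (?D p b) < ?e" for b
    proof -
      have "isCont (\<lambda>x. ?D x b) p"
        using smooth_on_continuous[OF smooth_on_deriv(2)[OF s]] U continuous_on_eq_continuous_at by blast
      then have "((\<lambda>x. ?D x b) \<longlongrightarrow> ?D p b) (nhds p)"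
        unfolding isCont_def by (rule tendsto_at_iff_tendsto_nhds[THEN iffD1])
      then show ?thesis using e0 by (rule tendstoD)
    qed
    then have "\<forall>\<^sub>F x in nhds p. \<forall>b\<in>Basis. dist (?D x b) (?D p b) < ?e"
      by (intro eventually_ball_finite) auto
    moreover have "\<forall>\<^sub>F x in nhds p. x \<in> U" using U by (rule eventually_nhds_in_open)
    ultimately have "\<forall>\<^sub>F x in nhds p. (\<forall>b\<in>Basis. dist (?D x b) (?D p b) < ?e) \<and> x \<in> U"
      by (rule eventually_conj)
    then obtain d where d: "d > 0" "\<And>x. dist x p < d \<Longrightarrow> (\<forall>b\<in>Basis. dist (?D x b) (?D p b) < ?e) \<and> x \<in> U"
      unfolding eventually_nhds_metric by blast
    have "onorm (\<lambda>v. ?D x v - ?D p v) < \<epsilon>" if x: "dist p x < d" for x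
    proof -
      have *: "\<forall>b\<in>Basis. dist (?D x b) (?D p b) < ?e" "x \<in> U" using d(2)[of x] x by (simp_all add: dist_commute)
      have "onorm (\<lambda>v. ?D x v - ?D p v) \<le> \<epsilon> / 2"
      proof (rule onorm_le)
        fix v
        have "linear (\<lambda>v. ?D x v - ?D p v)"
          using lin[OF *(2)] lin[OF U(2)] by (rule linear_compose_sub)
        then have "?D x v - ?D p v = (\<Sum>b\<in>Basis. (v \<bullet> b) *\<^sub>R (?D x b - ?D p b))"
          by (rule linear_basis_expansion)
        also have "norm \<dots> \<le> (\<Sum>b\<in>(Basis :: (real ^ 'n) set). norm v * ?e)"
        proof (rule sum_norm_le)
          fix b :: "real ^ 'n" assume b: "b \<in> Basis"
          show "norm ((v \<bullet> b) *\<^sub>R (?D x b - ?D p b)) \<le> norm v * ?e"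
            unfolding norm_scaleR using Basis_le_norm[OF b, of v] *(1) b
            by (intro mult_mono) (auto simp: dist_norm intro: less_imp_le)
        qed
        also have "\<dots> = \<epsilon> / 2 * norm v" by (simp add: field_simps)
        finally show "norm (?D x v - ?D p v) \<le> \<epsilon> / 2 * norm v" .
      qed
      then show ?thesis using \<epsilon> by linarith
    qed
    then show ?thesis using d(1) by blast
  qed
  obtain r where r: "r > 0" "ball p r \<subseteq> W" "inj_on \<Phi> (ball p r)"
  proof (rule has_derivative_locally_injective[OF W(2,1) linear_conv_bounded_linear[THEN iffD1, OF g(1)] g(2) _ cont])
    show "(\<Phi> has_derivative ?D x) (at x)" if "x \<in> W" for x using d that W(3) by blast
  qed blast+
  show ?thesis
  proof (rule that[of "ball p r"])
    show "p \<in> ball p r" using r by simp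
    show "ball p r \<subseteq> U" using r W by blast
    then have "smooth_on \<Phi> (ball p r)" using smooth_on_subset[OF s] by blast
    then show "param (ball p r) \<Phi>" using r(2,3) injW unfolding param_def by auto
  qed
qed

text \<open>Normal forms produce the new coordinates as functions \<open>\<Psi>\<close> of the old
  ones; the parametrization is the local inverse.\<close>

lemma param_of_coordinates:
  fixes \<Psi> :: "real ^ 'n \<Rightarrow> real ^ 'n"
  assumes "open U" "p \<in> U" "smooth_on \<Psi> U" "inj (frechet_derivative \<Psi> (at p))"
  obtains V \<Phi> where "param V \<Phi>" "p \<in> \<Phi> ` V" "\<Phi> ` V \<subseteq> U"
    "\<forall>y\<in>V. inj (frechet_derivative \<Psi> (at (\<Phi> y))) \<and>
      (\<forall>v. frechet_derivative \<Psi> (at (\<Phi> y)) (frechet_derivative \<Phi> (at y) v) = v)"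
proof -
  obtain W where W: "p \<in> W" "W \<subseteq> U" "param W \<Psi>" by (rule param_local[OF assms])
  let ?\<Phi> = "inv_into W \<Psi>"
  have inv: "?\<Phi> (\<Psi> x) = x" if "x \<in> W" for x using paramD(3)[OF W(3)] that by simp
  show ?thesis
  proof (rule that[of "\<Psi> ` W" ?\<Phi>])
    show "param (\<Psi> ` W) ?\<Phi>" by (rule param_inverse(1)[OF W(3)])
    show "p \<in> ?\<Phi> ` \<Psi> ` W" using W(1) inv by (metis imageI)
    show "?\<Phi> ` \<Psi> ` W \<subseteq> U" using inv W(2) by auto
    show "\<forall>y\<in>\<Psi> ` W. inj (frechet_derivative \<Psi> (at (?\<Phi> y))) \<and>
      (\<forall>v. frechet_derivative \<Psi> (at (?\<Phi> y)) (frechet_derivative ?\<Phi> (at y) v) = v)"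
    proof (intro ballI conjI allI)
      fix y assume "y \<in> \<Psi> ` W"
      then obtain x where x: "x \<in> W" "y = \<Psi> x" by blast
      show "frechet_derivative \<Psi> (at (?\<Phi> y)) (frechet_derivative ?\<Phi> (at y) v) = v" for v
        using param_inverse(3)[OF W(3) x(1)] x inv by simp
      show "inj (frechet_derivative \<Psi> (at (?\<Phi> y)))"
        using paramD(4)[OF W(3) x(1)] x inv by simp
    qed
  qed
qed

abbreviation ax :: "'n::finite \<Rightarrow> real ^ 'n" where "ax i \<equiv> axis i 1"

text \<open>At \<open>p\<close> the derivative of the flow map fixes the vectors without
  \<open>i\<close>-th component and sends \<open>ax i\<close> to \<open>X p\<close>, so
  \<open>X p $ i \<noteq> 0\<close> makes it invertible. The last clause keeps coordinate directions
  in which \<open>X\<close> is constant, so that straightening can be repeated.\<close>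

lemma straighten:
  fixes X :: "real ^ 'n \<Rightarrow> real ^ 'n"
  assumes W: "open W" "p \<in> W" and X: "smooth_on X W" and i: "X p $ i \<noteq> 0"
  obtains V \<Psi> where "param V \<Psi>" "p \<in> V" "\<Psi> ` V \<subseteq> W" "\<Psi> p = p"
    "\<And>x. x \<in> V \<Longrightarrow> frechet_derivative \<Psi> (at x) (ax i) = X (\<Psi> x)"
    "\<And>j x. j \<noteq> i \<Longrightarrow> \<forall>z\<in>W. frechet_derivative X (at z) (ax j) = 0 \<Longrightarrow> x \<in> V \<Longrightarrow>
      frechet_derivative \<Psi> (at x) (ax j) = ax j"
proof -
  let ?e = "ax i"
  have e: "norm ?e = 1" by simp
  show ?thesis
  proof (rule flow_map[OF W X e])
    fix r \<Psi>
    assume r: "r > 0" and s: "smooth_on \<Psi> (ball p r)" and im: "\<Psi> ` ball p r \<subseteq> W" and pp: "\<Psi> p = p"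
      and along: "\<And>x. x \<in> ball p r \<Longrightarrow> frechet_derivative \<Psi> (at x) ?e = X (\<Psi> x)"
      and centre: "\<And>v. v \<bullet> ?e = 0 \<Longrightarrow> frechet_derivative \<Psi> (at p) v = v"
      and transversal: "\<And>v x. v \<bullet> ?e = 0 \<Longrightarrow> \<forall>z\<in>W. frechet_derivative X (at z) v = 0 \<Longrightarrow> x \<in> ball p r \<Longrightarrow>
        frechet_derivative \<Psi> (at x) v = v"
    have p: "p \<in> ball p r" using r by simp
    have lin: "linear (frechet_derivative \<Psi> (at p))" by (rule linear_frechet[OF s p])
    have "inj (frechet_derivative \<Psi> (at p))"
    proof (rule linear_injective_0[OF lin, THEN iffD2], intro allI impI)
      fix v assume v: "frechet_derivative \<Psi> (at p) v = 0"
      let ?v' = "v - (v $ i) *\<^sub>R ?e"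
      have "?v' \<bullet> ?e = 0" by (simp add: inner_axis)
      then have "frechet_derivative \<Psi> (at p) ?v' = ?v'" by (rule centre)
      moreover have "frechet_derivative \<Psi> (at p) ?v' = - ((v $ i) *\<^sub>R X p)"
        using v along[OF p] pp by (simp add: linear_diff[OF lin] linear_cmul[OF lin])
      ultimately have *: "?v' + (v $ i) *\<^sub>R X p = 0" by (metis add.left_inverse add.commute)
      then have "(?v' + (v $ i) *\<^sub>R X p) $ i = 0" by simp
      then have "v $ i = 0" using i by simp
      then show "v = 0" using * by simp
    qed
    then obtain V where V: "p \<in> V" "V \<subseteq> ball p r" "param V \<Psi>"
      by (rule param_local[OF open_ball p s])
    show ?thesis
    proof (rule that[OF V(3,1) _ pp])
      show "\<Psi> ` V \<subseteq> W" using V im by blast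
      show "frechet_derivative \<Psi> (at x) ?e = X (\<Psi> x)" if "x \<in> V" for x using along V that by blast
      show "frechet_derivative \<Psi> (at x) (ax j) = ax j"
        if "j \<noteq> i" "\<forall>z\<in>W. frechet_derivative X (at z) (ax j) = 0" "x \<in> V" for j x
      proof (rule transversal[OF _ that(2)])
        show "ax j \<bullet> ax i = 0" using that(1) by (simp add: inner_axis_axis)
      qed (use that V in blast)
    qed
  qed
qed

section \<open>Alternating forms on lists of vectors\<close>

text \<open>The position of an argument is given by splitting the list, which suits induction;
  nothing is asked of lists of another length.\<close>

definition altf :: "nat \<Rightarrow> ('v::real_vector list \<Rightarrow> real) \<Rightarrow> bool"
  where "altf q w \<longleftrightarrow>
    (\<forall>xs ys v v' s t. Suc (length xs + length ys) = q \<longrightarrow>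
      w (xs @ (s *\<^sub>R v + t *\<^sub>R v') # ys) = s * w (xs @ v # ys) + t * w (xs @ v' # ys)) \<and>
    (\<forall>vs. length vs = q \<longrightarrow> \<not> distinct vs \<longrightarrow> w vs = 0)"

lemma altfD:
  assumes "altf q w"
  shows "Suc (length xs + length ys) = q \<Longrightarrow>
      w (xs @ (s *\<^sub>R v + t *\<^sub>R v') # ys) = s * w (xs @ v # ys) + t * w (xs @ v' # ys)"
    and "length vs = q \<Longrightarrow> \<not> distinct vs \<Longrightarrow> w vs = 0"
  using assms unfolding altf_def by blast+

lemma altf_add:
  "altf q w \<Longrightarrow> Suc (length xs + length ys) = q \<Longrightarrow>
    w (xs @ (v + v') # ys) = w (xs @ v # ys) + w (xs @ v' # ys)"
  using altfD(1)[of q w xs ys 1 v 1 v'] by simp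

lemma altf_scale:
  "altf q w \<Longrightarrow> Suc (length xs + length ys) = q \<Longrightarrow> w (xs @ (s *\<^sub>R v) # ys) = s * w (xs @ v # ys)"
  using altfD(1)[of q w xs ys s v 0 v] by simp

lemma altf_zero:
  "altf q w \<Longrightarrow> Suc (length xs + length ys) = q \<Longrightarrow> w (xs @ 0 # ys) = 0"
  using altf_scale[of q w xs ys 0 0] by simp

lemma altf_sum:
  assumes "altf q w" "Suc (length xs + length ys) = q" "finite B"
  shows "w (xs @ (\<Sum>b\<in>B. c b *\<^sub>R f b) # ys) = (\<Sum>b\<in>B. c b * w (xs @ f b # ys))"
  using assms(3)
  by (induction B) (simp_all add: altf_zero[OF assms(1,2)] altf_add[OF assms(1,2)] altf_scale[OF assms(1,2)])

lemma altf_Cons: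
  fixes w :: "'a::real_vector list \<Rightarrow> real"
  assumes w: "altf (Suc q) w"
  shows "altf q (\<lambda>l. w (x # l))"
  unfolding altf_def
proof (intro conjI allI impI)
    fix xs ys :: "'a list" and v v' :: 'a and s t assume "Suc (length xs + length ys) = q"
    then show "w (x # xs @ (s *\<^sub>R v + t *\<^sub>R v') # ys) = s * w (x # xs @ v # ys) + t * w (x # xs @ v' # ys)"
    using altfD(1)[OF w, of "x # xs" ys s v t v'] by simp
next
    fix vs :: "'a list" assume "length vs = q" "\<not> distinct vs"
    then show "w (x # vs) = 0" using altfD(2)[OF w, of "x # vs"] by simp
qed

lemma altf_swap:
  assumes w: "altf q w" and len: "length xs + length ys + 2 = q"
  shows "w (xs @ a # b # ys) = - w (xs @ b # a # ys)"
proof -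
  have l: "Suc (length xs + length (c # ys)) = q" "Suc (length (xs @ [c]) + length ys) = q" for c
    using len by simp_all
  have "0 = w (xs @ (a + b) # (a + b) # ys)" using altfD(2)[OF w] len by simp
  also have "\<dots> = w (xs @ a # (a + b) # ys) + w (xs @ b # (a + b) # ys)"
    by (rule altf_add[OF w l(1)])
  also have "w (xs @ a # (a + b) # ys) = w (xs @ a # a # ys) + w (xs @ a # b # ys)"
    using altf_add[OF w l(2), of a a b] by simp
  also have "w (xs @ b # (a + b) # ys) = w (xs @ b # a # ys) + w (xs @ b # b # ys)"
    using altf_add[OF w l(2), of b a b] by simp
  also have "w (xs @ a # a # ys) = 0" using altfD(2)[OF w] len by simp
  also have "w (xs @ b # b # ys) = 0" using altfD(2)[OF w] len by simp
  finally show ?thesis by simp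
qed

lemma altf_move:
  assumes w: "altf q w"
  shows "length zs + Suc (length xs + length ys) = q \<Longrightarrow>
    w (zs @ xs @ x # ys) = (-1) ^ length xs * w (zs @ x # xs @ ys)"
proof (induction xs arbitrary: zs)
  case (Cons a xs)
  have "w ((zs @ [a]) @ xs @ x # ys) = (-1) ^ length xs * w ((zs @ [a]) @ x # xs @ ys)"
    using Cons.prems by (intro Cons.IH) simp
  also have "w ((zs @ [a]) @ x # xs @ ys) = - w (zs @ x # a # xs @ ys)"
    using altf_swap[OF w, of zs "xs @ ys" a x] Cons.prems by simp
  finally show ?case by simp
qed simp

text \<open>The sign of the permutation stays anonymous. What matters is that one
  \<open>\<epsilon>\<close> serves all forms, so that components at different points are compared
  with the same factor.\<close>

lemma altf_mset:
  "mset xs = mset ys \<Longrightarrow> \<exists>\<epsilon>. \<forall>w. altf (length ys) w \<longrightarrow> w xs = \<epsilon> * w ys"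
proof (induction xs arbitrary: ys)
  case Nil
  then show ?case by (auto intro: exI[of _ 1])
next
  case (Cons x xs)
  have "x \<in> set ys" using Cons.prems by (metis list.set_intros(1) set_mset_mset)
  then obtain ys1 ys2 where ys: "ys = ys1 @ x # ys2" by (auto dest: split_list)
  then have "mset xs = mset (ys1 @ ys2)" using Cons.prems by simp
  from Cons.IH[OF this] obtain \<epsilon> where
    \<epsilon>: "\<And>w. altf (length (ys1 @ ys2)) w \<Longrightarrow> w xs = \<epsilon> * w (ys1 @ ys2)" by blast
  have "w (x # xs) = (\<epsilon> * (-1) ^ length ys1) * w ys" if w: "altf (length ys) w" for w
  proof -
    have "w (x # xs) = \<epsilon> * w (x # ys1 @ ys2)"
      by (rule \<epsilon>[of "\<lambda>l. w (x # l)"]) (use altf_Cons[of _ w x] w ys in simp)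
    moreover have "w ys = (-1) ^ length ys1 * w (x # ys1 @ ys2)"
      using altf_move[OF w, of "[]" ys1 ys2 x] ys by simp
    ultimately show ?thesis by (simp add: power_mult_distrib[symmetric])
  qed
  then show ?case by blast
qed

lemma vec_expansion: "(\<Sum>i\<in>UNIV. (v $ i) *\<^sub>R ax i) = v"
  using basis_expansion[of v] by (simp add: scalar_mult_eq_scaleR)

lemma altf_expand:
  assumes "altf q w" "Suc (length xs + length ys) = q"
  shows "w (xs @ v # ys) = (\<Sum>i\<in>UNIV. v $ i * w (xs @ ax i # ys))"
  using altf_sum[OF assms, of UNIV "\<lambda>i. v $ i" ax] by (simp add: vec_expansion)

lemma altf_eq_0I:
  "altf q w \<Longrightarrow> (\<And>is. length is = q \<Longrightarrow> w (map ax is) = 0) \<Longrightarrow> length vs = q \<Longrightarrow> w vs = 0"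
proof (induction q arbitrary: w vs)
  case 0
  then show ?case by simp
next
  case (Suc q)
  obtain v vs' where vs: "vs = v # vs'" "length vs' = q" using Suc.prems(3) by (cases vs) auto
  have "w (ax i # vs') = 0" for i
    by (rule Suc.IH[OF altf_Cons[OF Suc.prems(1)] _ vs(2)]) (use Suc.prems(2)[of "i # _"] in simp)
  then show ?case using altf_expand[OF Suc.prems(1), of "[]" vs' v] vs by simp
qed

section \<open>The kernel of an alternating form\<close>

definition kern :: "nat \<Rightarrow> ('v::real_vector list \<Rightarrow> real) \<Rightarrow> 'v set"
  where "kern q w = {v. \<forall>vs. Suc (length vs) = q \<longrightarrow> w (v # vs) = 0}"

lemma kernI: "(\<And>vs. Suc (length vs) = q \<Longrightarrow> w (v # vs) = 0) \<Longrightarrow> v \<in> kern q w"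
  by (simp add: kern_def)

lemma kernD: "v \<in> kern q w \<Longrightarrow> Suc (length vs) = q \<Longrightarrow> w (v # vs) = 0"
  by (simp add: kern_def)

lemma kern_basisI:
  assumes "altf q w" "\<And>is. Suc (length is) = q \<Longrightarrow> w (v # map ax is) = 0"
  shows "v \<in> kern q w"
proof (rule kernI)
  fix vs :: "(real ^ 'a) list" assume vs: "Suc (length vs) = q"
  have "altf (length vs) (\<lambda>l. w (v # l))" using assms(1) vs by (auto intro: altf_Cons)
  then show "w (v # vs) = 0" by (rule altf_eq_0I) (use assms(2) vs in auto)
qed

lemma subspace_kern:
  assumes "altf q w"
  shows "subspace (kern q w)"
proof (rule subspaceI)
  show "0 \<in> kern q w" using altf_zero[OF assms, of "[]"] by (intro kernI) simp
  show "x + y \<in> kern q w" if "x \<in> kern q w" "y \<in> kern q w" for x y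
    using altf_add[OF assms, of "[]"] kernD[OF that(1)] kernD[OF that(2)] by (intro kernI) simp
  show "c *\<^sub>R x \<in> kern q w" if "x \<in> kern q w" for c x
    using altf_scale[OF assms, of "[]"] kernD[OF that] by (intro kernI) simp
qed

lemma kern_in_set:
  assumes "altf q w" "v \<in> kern q w" "v \<in> set vs" "length vs = q"
  shows "w vs = 0"
proof -
  obtain xs ys where vs: "vs = xs @ v # ys" using assms(3) by (auto dest: split_list)
  then show ?thesis using altf_move[OF assms(1), of "[]" xs ys v] kernD[OF assms(2), of "xs @ ys"] assms(4) by simp
qed

lemma altf_map:
  fixes L :: "'b::real_vector \<Rightarrow> 'a::real_vector"
  assumes "altf q w" "linear L"
  shows "altf q (\<lambda>vs. w (map L vs))"
  unfolding altf_def
proof (intro conjI allI impI)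
  fix xs ys :: "'b list" and v v' :: 'b and s t assume "Suc (length xs + length ys) = q"
  then show "w (map L (xs @ (s *\<^sub>R v + t *\<^sub>R v') # ys)) =
      s * w (map L (xs @ v # ys)) + t * w (map L (xs @ v' # ys))"
    using altfD(1)[OF assms(1), of "map L xs" "map L ys" s "L v" t "L v'"] assms(2)
    by (simp add: linear_add linear_cmul)
next
  fix vs :: "'b list" assume vs: "length vs = q" "\<not> distinct vs"
  then have "\<not> distinct (map L vs)" by (auto simp: distinct_map)
  then show "w (map L vs) = 0" using altfD(2)[OF assms(1)] vs by simp
qed

lemma dim_kern_map:
  fixes L :: "'a::euclidean_space \<Rightarrow> 'a"
  assumes "linear L" "inj L"
  shows "v \<in> kern q (\<lambda>vs. w (map L vs)) \<longleftrightarrow> L v \<in> kern q w"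
    and "dim (kern q (\<lambda>vs. w (map L vs))) = dim (kern q w)"
proof -
  obtain g where g: "linear g" "\<And>x. g (L x) = x" "\<And>x. L (g x) = x"
    using linear_injective_isomorphism[OF assms] by blast
  have *: "v \<in> kern q (\<lambda>vs. w (map L vs)) \<longleftrightarrow> L v \<in> kern q w" for v
  proof
    assume v: "v \<in> kern q (\<lambda>vs. w (map L vs))"
    show "L v \<in> kern q w"
    proof (rule kernI)
      fix vs :: "'a list" assume "Suc (length vs) = q"
      then have "w (map L (v # map g vs)) = 0" by (intro kernD[OF v]) simp
      then show "w (L v # vs) = 0" by (simp add: comp_def g)
    qed
  qed (auto simp: kern_def)
  then show "v \<in> kern q (\<lambda>vs. w (map L vs)) \<longleftrightarrow> L v \<in> kern q w" .
  have "L ` kern q (\<lambda>vs. w (map L vs)) = kern q w"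
  proof (intro set_eqI iffI)
    fix y assume "y \<in> kern q w"
    then have "g y \<in> kern q (\<lambda>vs. w (map L vs))" using * g(3) by simp
    then show "y \<in> L ` kern q (\<lambda>vs. w (map L vs))" using g(3)[of y] by (metis imageI)
  qed (use * in auto)
  then show "dim (kern q (\<lambda>vs. w (map L vs))) = dim (kern q w)"
    using dim_image_eq[OF assms(1), of "kern q (\<lambda>vs. w (map L vs))"] assms(2) inj_on_subset by (metis subset_UNIV)
qed

section \<open>Closed forms on open sets of Euclidean space\<close>

definition pb :: "(real ^ 'n \<Rightarrow> real ^ 'n) \<Rightarrow> (real ^ 'n \<Rightarrow> (real ^ 'n) list \<Rightarrow> real)
    \<Rightarrow> real ^ 'n \<Rightarrow> (real ^ 'n) list \<Rightarrow> real"
  where "pb \<Phi> \<omega> x vs = \<omega> (\<Phi> x) (map (frechet_derivative \<Phi> (at x)) vs)"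

text \<open>
  Smoothness and closedness are required in all coordinate systems, so that no compatibility of
  the exterior derivative with pullbacks has to be proved: on a manifold they hold in all charts.
\<close>

definition closed_lform :: "nat \<Rightarrow> (real ^ 'n) set \<Rightarrow> (real ^ 'n \<Rightarrow> (real ^ 'n) list \<Rightarrow> real) \<Rightarrow> bool"
  where "closed_lform q U \<omega> \<longleftrightarrow> open U \<and> (\<forall>x\<in>U. altf q (\<omega> x)) \<and>
    (\<forall>V \<Phi>. param V \<Phi> \<and> \<Phi> ` V \<subseteq> U \<longrightarrow>
      (\<forall>is. length is = q \<longrightarrow> smooth_on (\<lambda>x. pb \<Phi> \<omega> x (map ax is)) V) \<and>
      (\<forall>x\<in>V. \<forall>is. length is = Suc q \<longrightarrow> euclidean_d (pb \<Phi> \<omega>) x (map ax is) = 0))"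

lemma pb_id [simp]: "pb (\<lambda>x. x) \<omega> = \<omega>"
  by (simp add: fun_eq_iff pb_def)

lemma pb_compose:
  assumes "param V \<Phi>" "param W \<Psi>" "\<Psi> ` W \<subseteq> V" "x \<in> W"
  shows "pb \<Psi> (pb \<Phi> \<omega>) x = pb (\<Phi> \<circ> \<Psi>) \<omega> x"
  unfolding pb_def param_compose_deriv[OF assms] by (simp add: fun_eq_iff)

lemma pb_restrict: "pb \<Phi> \<omega> x = (\<lambda>vs. \<omega> (\<Phi> x) (map (frechet_derivative \<Phi> (at x)) vs))"
  by (simp add: fun_eq_iff pb_def)

lemma frechet_derivative_cong:
  assumes "open S" "x \<in> S" "\<And>y. y \<in> S \<Longrightarrow> f y = g y"
  shows "frechet_derivative f (at x) = frechet_derivative g (at x)"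
proof -
  have "(f has_derivative f') (at x) \<longleftrightarrow> (g has_derivative f') (at x)" for f'
    using has_derivative_transform_within_open[OF _ assms(1,2)] assms(3) by metis
  then show ?thesis by (simp add: frechet_derivative_def)
qed

lemma euclidean_d_cong:
  assumes "open S" "x \<in> S" "\<And>y. y \<in> S \<Longrightarrow> \<omega> y = \<omega>' y"
  shows "euclidean_d \<omega> x ws = euclidean_d \<omega>' x ws"
  unfolding euclidean_d_def
  by (intro sum.cong refl arg_cong2[of _ _ _ _ "(*)"] fun_cong[OF frechet_derivative_cong[OF assms(1,2)]])
    (simp add: assms(3))

lemma closed_lformD:
  assumes "closed_lform q U \<omega>"
  shows "open U" "x \<in> U \<Longrightarrow> altf q (\<omega> x)"
    "length is = q \<Longrightarrow> smooth_on (\<lambda>x. \<omega> x (map ax is)) U"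
    "x \<in> U \<Longrightarrow> length js = Suc q \<Longrightarrow> euclidean_d \<omega> x (map ax js) = 0"
proof -
  show U: "open U" and "x \<in> U \<Longrightarrow> altf q (\<omega> x)" using assms unfolding closed_lform_def by blast+
  have *: "param U (\<lambda>x. x) \<and> (\<lambda>x. x) ` U \<subseteq> U \<longrightarrow>
      (\<forall>is. length is = q \<longrightarrow> smooth_on (\<lambda>x. pb (\<lambda>x. x) \<omega> x (map ax is)) U) \<and>
      (\<forall>x\<in>U. \<forall>is. length is = Suc q \<longrightarrow> euclidean_d (pb (\<lambda>x. x) \<omega>) x (map ax is) = 0)"
    using assms unfolding closed_lform_def by blast
  then show "length is = q \<Longrightarrow> smooth_on (\<lambda>x. \<omega> x (map ax is)) U"
    "x \<in> U \<Longrightarrow> length js = Suc q \<Longrightarrow> euclidean_d \<omega> x (map ax js) = 0"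
    using param_id[OF U] by simp_all
qed

text \<open>Parametrizations into \<open>V\<close> become parametrizations into \<open>U\<close> by
  composition with \<open>\<Phi>\<close>, and \<open>closed_lform\<close> speaks about all of
  these.\<close>

lemma closed_lform_pb:
  assumes "closed_lform q U \<omega>" "param V \<Phi>" "\<Phi> ` V \<subseteq> U"
  shows "closed_lform q V (pb \<Phi> \<omega>)"
  unfolding closed_lform_def
proof (intro conjI ballI allI impI; (elim conjE)?)
  show V: "open V" by (rule paramD(1)[OF assms(2)])
  show "altf q (pb \<Phi> \<omega> x)" if "x \<in> V" for x
    unfolding pb_restrict using assms(3) that
    by (intro altf_map closed_lformD(2)[OF assms(1)] paramD(5)[OF assms(2)]) blast+
  fix W \<Psi> assume W: "param W \<Psi>" "\<Psi> ` W \<subseteq> V"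
  have c: "param W (\<Phi> \<circ> \<Psi>)" "(\<Phi> \<circ> \<Psi>) ` W \<subseteq> U"
    using param_compose[OF assms(2) W] W assms(3) by auto
  note eq = pb_compose[OF assms(2) W, of _ \<omega>]
  note oW = paramD(1)[OF W(1)]
  have *: "(\<forall>is. length is = q \<longrightarrow> smooth_on (\<lambda>x. pb (\<Phi> \<circ> \<Psi>) \<omega> x (map ax is)) W) \<and>
      (\<forall>x\<in>W. \<forall>is. length is = Suc q \<longrightarrow> euclidean_d (pb (\<Phi> \<circ> \<Psi>) \<omega>) x (map ax is) = 0)"
    using assms(1) c unfolding closed_lform_def by blast
  show "smooth_on (\<lambda>x. pb \<Psi> (pb \<Phi> \<omega>) x (map ax is)) W" if "length is = q" for "is"
    by (rule smooth_on_cong[OF oW, of "\<lambda>x. pb (\<Phi> \<circ> \<Psi>) \<omega> x (map ax is)"]) (use * that eq in auto)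
  show "euclidean_d (pb \<Psi> (pb \<Phi> \<omega>)) x (map ax is) = 0" if "x \<in> W" "length is = Suc q" for x "is"
    using euclidean_d_cong[OF oW that(1), of "pb \<Psi> (pb \<Phi> \<omega>)" "pb (\<Phi> \<circ> \<Psi>) \<omega>"] eq * that by simp
qed

lemma kern_pb:
  assumes "param V \<Phi>" "x \<in> V"
  shows "v \<in> kern q (pb \<Phi> \<omega> x) \<longleftrightarrow> frechet_derivative \<Phi> (at x) v \<in> kern q (\<omega> (\<Phi> x))"
    and "dim (kern q (pb \<Phi> \<omega> x)) = dim (kern q (\<omega> (\<Phi> x)))"
  unfolding pb_restrict
  by (rule dim_kern_map[OF paramD(5)[OF assms] paramD(4)[OF assms]])+

text \<open>This is Cartan's formula for the Lie derivative along the coordinate field: in the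
  expansion of \<open>d\<omega>\<close> on \<open>ax j\<close> followed by the other vectors, every
  term but the first still has \<open>ax j\<close> as an argument of \<open>\<omega>\<close> and
  vanishes.\<close>

lemma kern_coordinate_invariant:
  assumes \<omega>: "closed_lform q U \<omega>" and j: "\<And>x. x \<in> U \<Longrightarrow> ax j \<in> kern q (\<omega> x)"
    and x: "x \<in> U" and len: "length is = q"
  shows "frechet_derivative (\<lambda>x. \<omega> x (map ax is)) (at x) (ax j) = 0"
proof -
  let ?ws = "map ax (j # is)"
  let ?t = "\<lambda>i. (-1) ^ i * frechet_derivative (\<lambda>y. \<omega> y (take i ?ws @ drop (Suc i) ?ws)) (at x) (?ws ! i)"
  have "0 = (\<Sum>i<Suc q. ?t i)"
    using closed_lformD(4)[OF \<omega> x, of "j # is"] len by (simp add: euclidean_d_def del: sum.lessThan_Suc)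
  also have "\<dots> = ?t 0 + (\<Sum>i<q. ?t (Suc i))" by (rule sum.lessThan_Suc_shift)
  also have "(\<Sum>i<q. ?t (Suc i)) = 0"
  proof (rule sum.neutral, rule ballI)
    fix i assume i: "i \<in> {..<q}"
    have "\<omega> y (take (Suc i) ?ws @ drop (Suc (Suc i)) ?ws) = 0" if "y \<in> U" for y
      using kernD[OF j[OF that], of "take i (map ax is) @ drop (Suc i) (map ax is)"] i len by simp
    from frechet_derivative_cong[OF closed_lformD(1)[OF \<omega>] x this]
    show "?t (Suc i) = 0" by simp
  qed
  finally show ?thesis by simp
qed

section \<open>Straightening the kernel of a closed form\<close>

lemma finite_index_lists: "finite {is :: 'n::finite list. Suc (length is) = q}"
  by (rule finite_subset[OF _ finite_lists_length_eq[OF finite_class.finite_UNIV, of "q - 1"]]) auto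

lemma det_nonzero_iff: "det A \<noteq> 0 \<longleftrightarrow> (\<forall>v. A *v v = 0 \<longrightarrow> v = 0)" for A :: "real ^ 'n ^ 'n"
  using det_nz_iff_inj[of "(*v) A"] linear_injective_0[of "(*v) A"] by simp

text \<open>Differentiating \<open>M X = k\<close> in a direction in which \<open>M\<close> is
  constant leaves \<open>M\<close> applied to the derivative of \<open>X\<close>, which must be
  0.\<close>

lemma solution_deriv_zero:
  fixes M :: "'e::euclidean_space \<Rightarrow> real ^ 'n ^ 'n"
  assumes W: "open W" and sM: "\<And>a b. smooth_on (\<lambda>x. M x $ a $ b) W" and sX: "smooth_on X W"
    and X: "\<And>x. x \<in> W \<Longrightarrow> M x *v X x = k" and x: "x \<in> W" and det: "det (M x) \<noteq> 0"
    and dM: "\<And>a b. frechet_derivative (\<lambda>x. M x $ a $ b) (at x) e = 0"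
  shows "frechet_derivative X (at x) e = 0"
proof -
  let ?DX = "frechet_derivative X (at x)"
  have "M x *v ?DX e = 0"
  proof (rule vec_eq_iff[THEN iffD2], rule allI)
    fix a
    have "((\<lambda>y. \<Sum>b\<in>UNIV. M y $ a $ b * X y $ b) has_derivative
        (\<lambda>h. \<Sum>b\<in>UNIV. M x $ a $ b * ?DX h $ b + frechet_derivative (\<lambda>x. M x $ a $ b) (at x) h * X x $ b)) (at x)"
      by (intro has_derivative_sum has_derivative_mult smooth_on_deriv(1)[OF sM x]
          bounded_linear.has_derivative[OF bounded_linear_vec_nth smooth_on_deriv(1)[OF sX x]])
    moreover have "(\<Sum>b\<in>UNIV. M y $ a $ b * X y $ b) = k $ a" if "y \<in> W" for y
      using X[OF that] by (auto simp: matrix_vector_mult_def vec_eq_iff)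
    ultimately have "((\<lambda>y. k $ a) has_derivative
        (\<lambda>h. \<Sum>b\<in>UNIV. M x $ a $ b * ?DX h $ b + frechet_derivative (\<lambda>x. M x $ a $ b) (at x) h * X x $ b)) (at x)"
      by (rule has_derivative_transform_within_open[OF _ W x])
    from fun_cong[OF has_derivative_unique[OF this has_derivative_const], of e]
    show "(M x *v ?DX e) $ a = 0 $ a"
      by (simp add: matrix_vector_mult_def dM)
  qed
  then show ?thesis using det unfolding det_nonzero_iff by blast
qed

lemma smooth_solution:
  fixes M :: "'e::euclidean_space \<Rightarrow> real ^ 'n ^ 'n"
  assumes "open S" "\<And>i j. smooth_on (\<lambda>x. M x $ i $ j) S" "smooth_on b S"
    and det: "\<And>x. x \<in> S \<Longrightarrow> det (M x) \<noteq> 0"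
  obtains X where "smooth_on X S" "\<And>x. x \<in> S \<Longrightarrow> M x *v X x = b x"
proof -
  define X where "X x = (\<chi> k. det (\<chi> i j. if j = k then b x $ i else M x $ i $ j) / det (M x))" for x
  have "M x *v X x = b x" if "x \<in> S" for x
    unfolding X_def by (rule cramer[OF det[OF that], THEN iffD2]) (rule refl)
  with smooth_on_solve[OF assms, of X] show ?thesis using that by blast
qed

text \<open>The field is obtained from a linear system whose matrix is built from the components of
  \<open>\<omega>\<close>. These are constant in the kernel coordinates, so the solution is constant
  in them too.\<close>

lemma kernel_field:
  fixes \<omega> :: "real ^ 'n \<Rightarrow> (real ^ 'n) list \<Rightarrow> real"
  assumes \<omega>: "closed_lform q V \<omega>" and p: "p \<in> V"
    and dim: "\<And>x. x \<in> V \<Longrightarrow> dim (kern q (\<omega> x)) = d"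
    and k0: "k0 \<in> kern q (\<omega> p)"
  obtains W X where "open W" "p \<in> W" "W \<subseteq> V" "smooth_on X W" "X p = k0"
    "\<forall>x\<in>W. X x \<in> kern q (\<omega> x)"
    "\<forall>j. (\<forall>x\<in>V. ax j \<in> kern q (\<omega> x)) \<longrightarrow> (\<forall>x\<in>W. frechet_derivative X (at x) (ax j) = 0)"
proof -
  let ?K0 = "kern q (\<omega> p)"
  let ?Ls = "{is :: 'n list. Suc (length is) = q}"
  note alt = closed_lformD(2)[OF \<omega>]
  note V = closed_lformD(1)[OF \<omega>]
  obtain B where B: "B \<subseteq> ?K0" "pairwise orthogonal B" "\<And>x. x \<in> B \<Longrightarrow> norm x = 1"
    "independent B" "span B = ?K0"
    using orthonormal_basis_subspace[OF subspace_kern[OF alt[OF p]]] by metis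
  have finB: "finite B" using B(4) by (rule independent_imp_finite)
  define F where "F is x v = \<omega> x (v # map ax is)" for "is" x v
  have F: "F is x v = (\<Sum>b\<in>UNIV. F is x (ax b) * v $ b)" if "x \<in> V" "is \<in> ?Ls" for "is" x v
    using altf_expand[OF alt[OF that(1)], of "[]" "map ax is" v] that(2) by (simp add: F_def mult.commute)
  have F_kern: "v \<in> kern q (\<omega> x) \<longleftrightarrow> (\<forall>is\<in>?Ls. F is x v = 0)" if "x \<in> V" for x v
    using kern_basisI[OF alt[OF that], of v] by (auto simp: F_def kern_def)
  \<comment> \<open>\<open>M x = F\<^sub>x\<^sup>T F\<^sub>x + \<pi>\<close> with \<open>\<pi>\<close> the orthogonal projection to the kernel \<open>?K0\<close> at \<open>p\<close>. It is invertible near \<open>p\<close>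
    and, the kernels having equal dimension, maps the kernel at \<open>x\<close> onto \<open>?K0\<close>.\<close>
  define M where "M x = (\<chi> a b. (\<Sum>is\<in>?Ls. F is x (ax a) * F is x (ax b)) + (\<Sum>c\<in>B. c $ a * c $ b))" for x
  have Mv: "(M x *v v) $ a = (\<Sum>is\<in>?Ls. F is x (ax a) * F is x v) + (\<Sum>c\<in>B. c $ a * (c \<bullet> v))"
    if x: "x \<in> V" for x v a
  proof -
    have "(M x *v v) $ a = (\<Sum>b\<in>UNIV. \<Sum>is\<in>?Ls. F is x (ax a) * (F is x (ax b) * v $ b)) +
        (\<Sum>b\<in>UNIV. \<Sum>c\<in>B. c $ a * (c $ b * v $ b))"
      by (simp add: M_def matrix_vector_mult_def sum_distrib_right distrib_right sum.distrib mult.assoc)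
    also have "(\<Sum>b\<in>UNIV. \<Sum>is\<in>?Ls. F is x (ax a) * (F is x (ax b) * v $ b)) =
        (\<Sum>is\<in>?Ls. \<Sum>b\<in>UNIV. F is x (ax a) * (F is x (ax b) * v $ b))" by (rule sum.swap)
    also have "\<dots> = (\<Sum>is\<in>?Ls. F is x (ax a) * F is x v)"
      unfolding sum_distrib_left[symmetric] by (intro sum.cong refl) (simp add: F[OF x, symmetric])
    also have "(\<Sum>b\<in>UNIV. \<Sum>c\<in>B. c $ a * (c $ b * v $ b)) = (\<Sum>c\<in>B. \<Sum>b\<in>UNIV. c $ a * (c $ b * v $ b))"
      by (rule sum.swap)
    also have "\<dots> = (\<Sum>c\<in>B. c $ a * (c \<bullet> v))"
      unfolding sum_distrib_left[symmetric] by (simp add: inner_vec_def)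
    finally show ?thesis .
  qed
  have M_kern: "M x *v v = (\<Sum>c\<in>B. (v \<bullet> c) *\<^sub>R c)" if "x \<in> V" "v \<in> kern q (\<omega> x)" for x v
  proof (rule vec_eq_iff[THEN iffD2], rule allI)
    fix a
    have "(\<Sum>is\<in>?Ls. F is x (ax a) * F is x v) = 0"
      using F_kern[OF that(1)] that(2) by (intro sum.neutral) auto
    then show "(M x *v v) $ a = (\<Sum>c\<in>B. (v \<bullet> c) *\<^sub>R c) $ a"
      by (simp add: Mv[OF that(1)] inner_commute mult.commute)
  qed
  have M_K0: "M x *v v \<in> ?K0" if "x \<in> V" "v \<in> kern q (\<omega> x)" for x v
    unfolding M_kern[OF that] B(5)[symmetric] by (intro span_sum span_scale span_base)
  \<comment> \<open>The quadratic form of \<open>M p\<close> is a sum of squares, of which the first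
    group vanishes only on the kernel at \<open>p\<close> and the second only on its orthogonal
    complement.\<close>
  have "det (M p) \<noteq> 0"
    unfolding det_nonzero_iff
  proof (intro allI impI)
    fix v assume v: "M p *v v = 0"
    have "0 = v \<bullet> (M p *v v)" using v by simp
    also have "\<dots> = (\<Sum>a\<in>UNIV. \<Sum>is\<in>?Ls. v $ a * (F is p (ax a) * F is p v)) + (\<Sum>a\<in>UNIV. \<Sum>c\<in>B. v $ a * (c $ a * (c \<bullet> v)))"
      by (simp add: inner_vec_def[of v] Mv[OF p] distrib_left sum.distrib sum_distrib_left)
    also have "(\<Sum>a\<in>UNIV. \<Sum>is\<in>?Ls. v $ a * (F is p (ax a) * F is p v)) =
        (\<Sum>is\<in>?Ls. \<Sum>a\<in>UNIV. (F is p (ax a) * v $ a) * F is p v)"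
      by (subst sum.swap) (simp add: mult_ac)
    also have "\<dots> = (\<Sum>is\<in>?Ls. (F is p v)\<^sup>2)"
      unfolding sum_distrib_right[symmetric]
      by (intro sum.cong refl) (simp add: F[OF p, symmetric] power2_eq_square)
    also have "(\<Sum>a\<in>UNIV. \<Sum>c\<in>B. v $ a * (c $ a * (c \<bullet> v))) = (\<Sum>c\<in>B. \<Sum>a\<in>UNIV. (c $ a * v $ a) * (c \<bullet> v))"
      by (subst sum.swap) (simp add: mult_ac)
    also have "\<dots> = (\<Sum>c\<in>B. (c \<bullet> v)\<^sup>2)"
      unfolding sum_distrib_right[symmetric] by (simp add: inner_vec_def power2_eq_square)
    finally have *: "(\<Sum>is\<in>?Ls. (F is p v)\<^sup>2) + (\<Sum>c\<in>B. (c \<bullet> v)\<^sup>2) = 0" by simp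
    have "(\<Sum>is\<in>?Ls. (F is p v)\<^sup>2) \<ge> 0" "(\<Sum>c\<in>B. (c \<bullet> v)\<^sup>2) \<ge> 0" by (simp_all add: sum_nonneg)
    with * have z: "(\<Sum>is\<in>?Ls. (F is p v)\<^sup>2) = 0" "(\<Sum>c\<in>B. (c \<bullet> v)\<^sup>2) = 0" by linarith+
    from z(1) have "v \<in> ?K0"
      unfolding F_kern[OF p] by (subst (asm) sum_nonneg_eq_0_iff) (simp_all add: finite_index_lists)
    then have "v = (\<Sum>c\<in>B. (v \<bullet> c) *\<^sub>R c)"
      using orthonormal_basis_expand[OF B(2,3) _ finB, of v] B(5) by simp
    also have "\<dots> = 0"
      using z(2) finB by (intro sum.neutral) (simp add: sum_nonneg_eq_0_iff inner_commute)
    finally show "v = 0" .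
  qed
  have sF: "smooth_on (\<lambda>x. F is x (ax a)) V" if "is \<in> ?Ls" for "is" a
    using closed_lformD(3)[OF \<omega>, of "a # is"] that by (simp add: F_def)
  have sM: "smooth_on (\<lambda>x. M x $ a $ b) V" for a b
  proof -
    have "smooth_on (\<lambda>x. (\<Sum>is\<in>?Ls. F is x (ax a) * F is x (ax b)) + (\<Sum>c\<in>B. c $ a * c $ b)) V"
      by (intro smooth_on_add smooth_on_sum smooth_on_mult smooth_on_const sF V finite_index_lists finB)
    then show ?thesis by (simp add: M_def)
  qed
  define W where "W = {x \<in> V. det (M x) \<in> - {0}}"
  have W: "open W" "p \<in> W" "W \<subseteq> V"
    using continuous_open_preimage[OF smooth_on_continuous[OF smooth_on_det[OF V sM]] V, of "- {0}"]
      p \<open>det (M p) \<noteq> 0\<close> by (auto simp: W_def vimage_def Int_def)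
  have detW: "det (M x) \<noteq> 0" if "x \<in> W" for x using that by (simp add: W_def)
  have inj: "v = v'" if "x \<in> W" "M x *v v = M x *v v'" for x v v'
  proof -
    have "M x *v (v - v') = 0" using that(2) by (simp add: matrix_vector_mult_diff_distrib)
    then show ?thesis using detW[OF that(1)] unfolding det_nonzero_iff by auto
  qed
  have ex: "\<exists>v\<in>kern q (\<omega> x). M x *v v = k0" if x: "x \<in> W" for x
  proof -
    let ?im = "(\<lambda>v. M x *v v) ` kern q (\<omega> x)"
    have xV: "x \<in> V" using W(3) x by blast
    have lin: "linear (\<lambda>v. M x *v v)" by simp
    have "inj (\<lambda>v. M x *v v)" using inj[OF x] by (blast intro: injI)
    then have "dim ?im = dim (kern q (\<omega> x))"
      by (intro dim_image_eq[OF lin]) (rule inj_on_subset[OF _ subset_UNIV])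
    then have "dim ?im = dim ?K0" using dim[OF xV] dim[OF p] by simp
    moreover have "subspace ?im" by (rule linear_subspace_image[OF lin subspace_kern[OF alt[OF xV]]])
    moreover have "?im \<subseteq> ?K0" using M_K0[OF xV] by blast
    ultimately have "?im = ?K0"
      using subspace_kern[OF alt[OF p]] by (intro subspace_dim_equal) auto
    then show ?thesis using k0 by (metis imageE)
  qed
  \<comment> \<open>The invertible \<open>M x\<close> leaves only one candidate, so
    \<open>smooth_on_solve\<close> applies in spite of the choice.\<close>
  define X where "X x = (SOME v. v \<in> kern q (\<omega> x) \<and> M x *v v = k0)" for x
  have X: "X x \<in> kern q (\<omega> x) \<and> M x *v X x = k0" if "x \<in> W" for x
    unfolding X_def by (rule someI_ex) (use ex[OF that] in blast)
  have MX: "M x *v X x = k0" if "x \<in> W" for x using X[OF that] by simp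
  have sX: "smooth_on X W"
    by (rule smooth_on_solve[OF W(1) smooth_on_subset[OF sM W(3)] smooth_on_const[OF W(1)] detW MX])
  show ?thesis
  proof (rule that[OF W sX])
    have "M p *v k0 = k0"
      using M_kern[OF p k0] orthonormal_basis_expand[OF B(2,3) _ finB, of k0] B(5) k0 by simp
    then show "X p = k0" using X[OF W(2)] inj[OF W(2)] by metis
    show "\<forall>x\<in>W. X x \<in> kern q (\<omega> x)" using X by blast
    show "\<forall>j. (\<forall>x\<in>V. ax j \<in> kern q (\<omega> x)) \<longrightarrow> (\<forall>x\<in>W. frechet_derivative X (at x) (ax j) = 0)"
    proof (intro allI impI ballI)
      fix j x assume j: "\<forall>x\<in>V. ax j \<in> kern q (\<omega> x)" and x: "x \<in> W"
      have xV: "x \<in> V" using x W(3) by blast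
      let ?DX = "frechet_derivative X (at x)"
      have dF: "((\<lambda>x. F is x (ax a)) has_derivative frechet_derivative (\<lambda>x. F is x (ax a)) (at x)) (at x)"
        "frechet_derivative (\<lambda>x. F is x (ax a)) (at x) (ax j) = 0" if "is \<in> ?Ls" for "is" a
        using smooth_on_deriv(1)[OF sF[OF that] xV]
          kern_coordinate_invariant[OF \<omega> _ xV, of j "a # is"] j that by (simp_all add: F_def)
      have dM: "frechet_derivative (\<lambda>x. M x $ a $ b) (at x) (ax j) = 0" for a b
      proof -
        let ?f = "\<lambda>is a. frechet_derivative (\<lambda>x. F is x (ax a)) (at x)"
        have "((\<lambda>x. (\<Sum>is\<in>?Ls. F is x (ax a) * F is x (ax b)) + (\<Sum>c\<in>B. c $ a * c $ b)) has_derivative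
            (\<lambda>h. (\<Sum>is\<in>?Ls. F is x (ax a) * ?f is b h + ?f is a h * F is x (ax b)) + 0)) (at x)"
          by (intro has_derivative_add has_derivative_sum has_derivative_mult dF(1) has_derivative_const)
        then have "((\<lambda>x. M x $ a $ b) has_derivative
            (\<lambda>h. (\<Sum>is\<in>?Ls. F is x (ax a) * ?f is b h + ?f is a h * F is x (ax b)) + 0)) (at x)"
          by (simp add: M_def)
        from fun_cong[OF frechet_derivative_at[OF this], of "ax j"]
        have "frechet_derivative (\<lambda>x. M x $ a $ b) (at x) (ax j) =
            (\<Sum>is\<in>?Ls. F is x (ax a) * ?f is b (ax j) + ?f is a (ax j) * F is x (ax b)) + 0" by (rule sym)
        also have "\<dots> = 0" by (subst sum.neutral) (auto simp: dF(2))
        finally show ?thesis .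
      qed
      show "?DX (ax j) = 0"
        by (rule solution_deriv_zero[OF W(1) smooth_on_subset[OF sM W(3)] sX MX x detW[OF x] dM])
    qed
  qed
qed

text \<open>A kernel field that is constant in the coordinates \<open>J\<close> is straightened to a
  further coordinate vector \<open>ax i\<close>, and its flow box fixes \<open>ax j\<close> for
  \<open>j\<close> in \<open>J\<close>, so the directions already gained stay in the kernel.\<close>

lemma kernel_straightening_step:
  fixes \<omega> :: "real ^ 'n \<Rightarrow> (real ^ 'n) list \<Rightarrow> real"
  assumes \<omega>: "closed_lform q V \<omega>" and p: "p \<in> V"
    and dim: "\<And>x. x \<in> V \<Longrightarrow> dim (kern q (\<omega> x)) = d"
    and J: "\<forall>x\<in>V. \<forall>j\<in>J. ax j \<in> kern q (\<omega> x)" "card J < d"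
  obtains W \<Psi> i where "param W \<Psi>" "\<Psi> ` W \<subseteq> V" "p \<in> \<Psi> ` W" "i \<notin> J"
    "\<forall>x\<in>W. \<forall>j\<in>insert i J. ax j \<in> kern q (pb \<Psi> \<omega> x)"
proof -
  note alt = closed_lformD(2)[OF \<omega>]
  note sub = subspace_kern[OF alt[OF p]]
  let ?S = "span (ax ` J)"
  have "dim ?S \<le> card J"
    using dim_le_card'[of "ax ` J"] card_image_le[of J ax] by (simp add: dim_span)
  then have "\<not> kern q (\<omega> p) \<subseteq> ?S" using dim_subset[of "kern q (\<omega> p)" ?S] dim[OF p] J(2) by linarith
  then obtain v where v: "v \<in> kern q (\<omega> p)" "v \<notin> ?S" by blast
  \<comment> \<open>Removing the components in \<open>J\<close> stays inside the kernel and forces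
    any nonzero component of the result to have an index outside \<open>J\<close>.\<close>
  define k0 where "k0 = v - (\<Sum>j\<in>J. (v $ j) *\<^sub>R ax j)"
  have s1: "(\<Sum>j\<in>J. (v $ j) *\<^sub>R ax j) \<in> ?S" by (intro span_sum span_scale span_base imageI)
  have "(\<Sum>j\<in>J. (v $ j) *\<^sub>R ax j) \<in> kern q (\<omega> p)"
    using J(1) p by (intro subspace_sum[OF sub] subspace_scale[OF sub]) blast
  then have k0: "k0 \<in> kern q (\<omega> p)" unfolding k0_def by (rule subspace_diff[OF sub v(1)])
  have "k0 \<noteq> 0" using v(2) s1 by (auto simp: k0_def)
  then obtain i where i: "k0 $ i \<noteq> 0" by (auto simp: vec_eq_iff)
  have iJ: "i \<notin> J"
  proof
    assume "i \<in> J"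
    then have "(\<Sum>j\<in>J. v $ j * ax j $ i) = v $ i"
      by (subst sum.remove[of J i]) (auto simp: axis_def intro!: sum.neutral split: if_splits)
    then show False using i by (simp add: k0_def)
  qed
  obtain W X where W: "open W" "p \<in> W" "W \<subseteq> V" and X: "smooth_on X W" "X p = k0"
    and XK: "\<forall>x\<in>W. X x \<in> kern q (\<omega> x)"
    and XJ: "\<forall>j. (\<forall>x\<in>V. ax j \<in> kern q (\<omega> x)) \<longrightarrow> (\<forall>x\<in>W. frechet_derivative X (at x) (ax j) = 0)"
    by (rule kernel_field[OF \<omega> p dim k0])
  have Xi: "X p $ i \<noteq> 0" using X(2) i by simp
  show ?thesis
  proof (rule straighten[OF W(1,2) X(1) Xi])
    fix V' \<Psi>
    assume P: "param V' \<Psi>" "p \<in> V'" "\<Psi> ` V' \<subseteq> W" "\<Psi> p = p"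
      and along: "\<And>x. x \<in> V' \<Longrightarrow> frechet_derivative \<Psi> (at x) (ax i) = X (\<Psi> x)"
      and across: "\<And>j x. j \<noteq> i \<Longrightarrow> \<forall>z\<in>W. frechet_derivative X (at z) (ax j) = 0 \<Longrightarrow> x \<in> V' \<Longrightarrow>
        frechet_derivative \<Psi> (at x) (ax j) = ax j"
    show ?thesis
    proof (rule that[OF P(1) _ _ iJ])
      show "\<Psi> ` V' \<subseteq> V" using P(3) W(3) by blast
      show "p \<in> \<Psi> ` V'" using P(2,4) by (metis imageI)
      show "\<forall>x\<in>V'. \<forall>j\<in>insert i J. ax j \<in> kern q (pb \<Psi> \<omega> x)"
      proof (intro ballI)
        fix x j assume x: "x \<in> V'" and j: "j \<in> insert i J"
        have \<Psi>x: "\<Psi> x \<in> W" using P(3) x by blast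
        show "ax j \<in> kern q (pb \<Psi> \<omega> x)"
          unfolding kern_pb(1)[OF P(1) x]
        proof (cases "j = i")
          case True
          then show "frechet_derivative \<Psi> (at x) (ax j) \<in> kern q (\<omega> (\<Psi> x))"
            using along[OF x] XK \<Psi>x by simp
        next
          case False
          then have jJ: "j \<in> J" using j by blast
          then have "\<forall>z\<in>W. frechet_derivative X (at z) (ax j) = 0" using XJ J(1) by blast
          from across[OF False this x] show "frechet_derivative \<Psi> (at x) (ax j) \<in> kern q (\<omega> (\<Psi> x))"
            using J(1) jJ \<Psi>x W(3) by auto
        qed
      qed
    qed
  qed
qed

lemma kernel_straightening:
  fixes \<omega> :: "real ^ 'n \<Rightarrow> (real ^ 'n) list \<Rightarrow> real"
  assumes \<omega>: "closed_lform q U \<omega>" and p: "p \<in> U"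
    and dim: "\<And>x. x \<in> U \<Longrightarrow> dim (kern q (\<omega> x)) = d"
  obtains V \<Phi> J where "param V \<Phi>" "\<Phi> ` V \<subseteq> U" "p \<in> \<Phi> ` V" "card J = d"
    "\<forall>x\<in>V. \<forall>j\<in>J. ax j \<in> kern q (pb \<Phi> \<omega> x)"
proof -
  have "k \<le> d \<Longrightarrow> \<exists>V \<Phi> J. param V \<Phi> \<and> \<Phi> ` V \<subseteq> U \<and> p \<in> \<Phi> ` V \<and> card J = k \<and>
    (\<forall>x\<in>V. \<forall>j\<in>J. ax j \<in> kern q (pb \<Phi> \<omega> x))" for k
  proof (induction k)
    case 0
    have "param U (\<lambda>x. x) \<and> (\<lambda>x. x) ` U \<subseteq> U \<and> p \<in> (\<lambda>x. x) ` U \<and> card {} = 0 \<and>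
      (\<forall>x\<in>U. \<forall>j\<in>{}. ax j \<in> kern q (pb (\<lambda>x. x) \<omega> x))"
      using param_id[OF closed_lformD(1)[OF \<omega>]] p by simp
    then show ?case by blast
  next
    case (Suc k)
    then obtain V \<Phi> J where P: "param V \<Phi>" "\<Phi> ` V \<subseteq> U" "p \<in> \<Phi> ` V" and J: "card J = k"
      "\<forall>x\<in>V. \<forall>j\<in>J. ax j \<in> kern q (pb \<Phi> \<omega> x)" by auto
    obtain p' where p': "p' \<in> V" "p = \<Phi> p'" using P(3) by blast
    have dim': "dim (kern q (pb \<Phi> \<omega> x)) = d" if "x \<in> V" for x
      using kern_pb(2)[OF P(1) that] dim P(2) that by auto
    have "card J < d" using J(1) Suc.prems by simp
    obtain W \<Psi> i where W: "param W \<Psi>" "\<Psi> ` W \<subseteq> V" "p' \<in> \<Psi> ` W" "i \<notin> J"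
      "\<forall>x\<in>W. \<forall>j\<in>insert i J. ax j \<in> kern q (pb \<Psi> (pb \<Phi> \<omega>) x)"
      by (rule kernel_straightening_step[OF closed_lform_pb[OF \<omega> P(1,2)] p'(1) dim' J(2) \<open>card J < d\<close>])
    have "param W (\<Phi> \<circ> \<Psi>)" by (rule param_compose[OF P(1) W(1,2)])
    moreover have "(\<Phi> \<circ> \<Psi>) ` W \<subseteq> U" using W(2) P(2) by auto
    moreover have "p \<in> (\<Phi> \<circ> \<Psi>) ` W" using W(3) p'(2) by auto
    moreover have "card (insert i J) = Suc k" using W(4) J(1) by simp
    moreover have "\<forall>x\<in>W. \<forall>j\<in>insert i J. ax j \<in> kern q (pb (\<Phi> \<circ> \<Psi>) \<omega> x)"
      using W(5) pb_compose[OF P(1) W(1,2), of _ \<omega>] by auto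
    ultimately show ?case by blast
  qed
  from this[OF order_refl] show ?thesis using that by blast
qed

section \<open>Top-degree forms in the transversal directions\<close>

lemma inj_ax: "inj ax"
  by (auto simp: inj_def axis_eq_axis)

text \<open>Up to sign there is only one list of distinct indices avoiding \<open>J\<close>, and all
  other lists give 0. The factor depends on the list and not on the form.\<close>

lemma top_form_component:
  assumes I: "distinct is0" "set is0 = - J" "length is0 = q" and len: "length is = q"
  shows "\<exists>\<epsilon>. \<forall>w. altf q w \<longrightarrow> (\<forall>j\<in>J. ax j \<in> kern q w) \<longrightarrow> w (map ax is) = \<epsilon> * w (map ax is0)"
proof (cases "distinct is \<and> set is \<subseteq> - J")
  case True
  have "card (set is) = q" "card (- J) = q"
    using True len I distinct_card by metis+
  then have "set is = - J" using True by (intro card_subset_eq) auto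
  then have "mset is = mset is0" using set_eq_iff_mset_eq_distinct[of "is" is0] True I by simp
  then have "mset (map ax is) = mset (map ax is0)" by simp
  from altf_mset[OF this] show ?thesis using I(3) by auto
next
  case False
  have "w (map ax is) = 0" if w: "altf q w" "\<forall>j\<in>J. ax j \<in> kern q w" for w
  proof (cases "distinct is")
    case True
    then obtain j where "j \<in> J" "j \<in> set is" using False by blast
    then show ?thesis using w len by (intro kern_in_set[OF w(1), of "ax j"]) auto
  next
    case False
    then show ?thesis using altfD(2)[OF w(1)] len by (simp add: distinct_map)
  qed
  then show ?thesis by (intro exI[of _ 0]) simp
qed

lemma altf_absorb:
  assumes w: "altf q w"
  shows "Suc (length xs + length as) = q \<Longrightarrow>
    w (e # xs @ map (\<lambda>a. g a + c a *\<^sub>R e) as) = w (e # xs @ map g as)"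
proof (induction as arbitrary: xs)
  case (Cons a as)
  let ?r = "map (\<lambda>a. g a + c a *\<^sub>R e) as"
  have "w ((e # xs) @ (g a + c a *\<^sub>R e) # ?r) = w ((e # xs) @ g a # ?r) + w ((e # xs) @ (c a *\<^sub>R e) # ?r)"
    using Cons.prems by (intro altf_add[OF w]) simp
  also have "w ((e # xs) @ (c a *\<^sub>R e) # ?r) = c a * w ((e # xs) @ e # ?r)"
    using Cons.prems by (intro altf_scale[OF w]) simp
  also have "w ((e # xs) @ e # ?r) = 0"
    using Cons.prems by (intro altfD(2)[OF w]) auto
  finally show ?case using Cons.IH[of "xs @ [g a]"] Cons.prems by simp
qed simp

text \<open>Closedness enters through \<open>kern_coordinate_invariant\<close>: \<open>f\<close>
  does not depend on the coordinates in \<open>J\<close>, hence neither does its primitive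
  \<open>F\<close>, and the kernel vectors \<open>ax j\<close> survive the change of
  coordinates.\<close>

lemma volume_normal_form:
  fixes \<omega> :: "real ^ 'n \<Rightarrow> (real ^ 'n) list \<Rightarrow> real"
  assumes \<omega>: "closed_lform q V \<omega>" and p: "p \<in> V"
    and J: "\<forall>x\<in>V. \<forall>j\<in>J. ax j \<in> kern q (\<omega> x)" "card J + q = CARD('n)" and q: "0 < q"
    and nz: "\<forall>x\<in>V. \<exists>vs. length vs = q \<and> \<omega> x vs \<noteq> 0"
  obtains W \<Phi> where "param W \<Phi>" "\<Phi> ` W \<subseteq> V" "p \<in> \<Phi> ` W"
    "\<forall>x\<in>W. \<forall>y\<in>W. \<forall>is. length is = q \<longrightarrow> pb \<Phi> \<omega> x (map ax is) = pb \<Phi> \<omega> y (map ax is)"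
proof -
  let ?D = "\<lambda>f x. frechet_derivative f (at x)"
  note alt = closed_lformD(2)[OF \<omega>]
  note oV = closed_lformD(1)[OF \<omega>]
  have "card (- J) = q" using J(2) by (simp add: Compl_eq_Diff_UNIV card_Diff_subset)
  obtain is0 where is0: "set is0 = - J" "distinct is0" using finite_distinct_list[of "- J"] by auto
  then have len0: "length is0 = q" using \<open>card (- J) = q\<close> distinct_card by metis
  then obtain i as where is0_eq: "is0 = i # as" using q by (cases is0) auto
  have iJ: "i \<notin> J" using is0 is0_eq by auto
  let ?e = "ax i"
  define f where "f x = \<omega> x (map ax is0)" for x
  have sf: "smooth_on f V" unfolding f_def by (rule closed_lformD(3)[OF \<omega> len0])
  have f0: "f x \<noteq> 0" if x: "x \<in> V" for x
  proof
    assume "f x = 0"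
    have "\<omega> x (map ax is) = 0" if "length is = q" for "is"
      using top_form_component[OF is0(2,1) len0 that] alt[OF x] J(1) x \<open>f x = 0\<close> by (auto simp: f_def)
    then show False using nz x altf_eq_0I[OF alt[OF x]] by blast
  qed
  have fJ: "?D f x (ax j) = 0" if "x \<in> V" "j \<in> J" for x j
    using kern_coordinate_invariant[OF \<omega> _ that(1) len0, of j] J(1) that(2) unfolding f_def by blast
  obtain r where r: "r > 0" "ball p r \<subseteq> V" using oV p open_contains_ball by blast
  let ?B = "ball p r"
  have pB: "p \<in> ?B" using r by simp
  interpret line_ball p ?e r by unfold_locales simp
  have sfB: "smooth_on f ?B" by (rule smooth_on_subset[OF sf r(2)])
  define F where "F = I f"
  have sF: "smooth_on F ?B" unfolding F_def by (rule smooth_on_line_int[OF sfB])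
  have dF: "?D F x v = I (\<lambda>z. ?D f z (v - (v \<bullet> ?e) *\<^sub>R ?e)) x + (v \<bullet> ?e) *\<^sub>R f x" if x: "x \<in> ?B" for x v
  proof -
    have "(F has_derivative (\<lambda>v. I (\<lambda>z. ?D f z (v - (v \<bullet> ?e) *\<^sub>R ?e)) x + (v \<bullet> ?e) *\<^sub>R f x)) (at x)"
      unfolding F_def
      by (rule line_int_deriv[OF smooth_on_deriv(1)[OF sfB] smooth_on_continuous[OF smooth_on_deriv(2)[OF sfB]] x])
    from fun_cong[OF frechet_derivative_at[OF this], of v] show ?thesis by (rule sym)
  qed
  have dFi: "?D F x ?e = f x" if x: "x \<in> ?B" for x
  proof -
    have "I (\<lambda>z. ?D f z 0) x = I (\<lambda>z. 0) x"
      by (rule line_int_cong[OF _ x]) (rule linear_0[OF linear_frechet[OF sfB]])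
    then show ?thesis using dF[OF x, of ?e] by simp
  qed
  have dFj: "?D F x (ax j) = 0" if x: "x \<in> ?B" and j: "j \<in> J" for x j
  proof -
    have ji: "ax j \<bullet> ?e = 0" using j iJ by (auto simp: inner_axis_axis)
    have "I (\<lambda>z. ?D f z (ax j)) x = I (\<lambda>z. 0) x"
      by (rule line_int_cong[OF _ x]) (use fJ j r(2) in blast)
    then show ?thesis using dF[OF x, of "ax j"] ji by simp
  qed
  \<comment> \<open>The \<open>i\<close>-th coordinate is replaced by \<open>F\<close>. Its
    derivative along \<open>ax i\<close> is \<open>f\<close>, which is nonzero, so the derivative of
    \<open>\<Psi>\<close> is invertible.\<close>
  define \<Psi> where "\<Psi> x = x + (F x - x $ i) *\<^sub>R ?e" for x
  have s\<Psi>: "smooth_on \<Psi> ?B"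
    unfolding \<Psi>_def[abs_def]
    by (intro smooth_on_add smooth_on_scaleR smooth_on_diff smooth_on_vec_nth smooth_on_ident smooth_on_const sF open_ball)
  have d\<Psi>: "?D \<Psi> x v = v + (?D F x v - v $ i) *\<^sub>R ?e" if x: "x \<in> ?B" for x v
  proof -
    have "(\<Psi> has_derivative (\<lambda>v. v + (?D F x v - v $ i) *\<^sub>R ?e)) (at x)"
      unfolding \<Psi>_def[abs_def]
      by (intro has_derivative_add has_derivative_ident has_derivative_scaleR_left has_derivative_diff
          smooth_on_deriv(1)[OF sF x] bounded_linear_imp_has_derivative bounded_linear_vec_nth)
    from fun_cong[OF frechet_derivative_at[OF this], of v] show ?thesis by (rule sym)
  qed
  have "inj (?D \<Psi> p)"
  proof (rule linear_injective_0[OF linear_frechet[OF s\<Psi> pB], THEN iffD2], intro allI impI)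
    fix v assume "?D \<Psi> p v = 0"
    then have v0: "v + (?D F p v - v $ i) *\<^sub>R ?e = 0" by (simp add: d\<Psi>[OF pB])
    define c where "c = v $ i - ?D F p v"
    have v: "v = c *\<^sub>R ?e" using v0 by (simp add: c_def algebra_simps add_eq_0_iff)
    have c1: "v $ i = c" by (subst v) simp
    have c2: "?D F p v = c * f p"
      using linear_cmul[OF linear_frechet[OF sF pB], of c ?e] v dFi[OF pB] by simp
    have "c = v $ i - ?D F p v" by (rule c_def)
    also have "\<dots> = c - c * f p" by (rule arg_cong2[of _ _ _ _ "(-)", OF c1 c2])
    finally have "c * f p = 0" by simp
    then have "c = 0" using f0[OF p] by simp
    then show "v = 0" using v by simp
  qed
  then obtain W \<Phi> where W: "param W \<Phi>" "p \<in> \<Phi> ` W" "\<Phi> ` W \<subseteq> ?B"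
    and inv_inj: "\<forall>y\<in>W. inj (?D \<Psi> (\<Phi> y)) \<and> (\<forall>v. ?D \<Psi> (\<Phi> y) (?D \<Phi> y v) = v)"
    by (rule param_of_coordinates[OF open_ball pB s\<Psi>])
  have inv: "?D \<Psi> (\<Phi> y) (?D \<Phi> y v) = v" and inj: "inj (?D \<Psi> (\<Phi> y))" if "y \<in> W" for y v
    using inv_inj that by blast+
  have W_V: "\<Phi> ` W \<subseteq> V" using W(3) r(2) by blast
  have altW: "altf q (pb \<Phi> \<omega> y)" if "y \<in> W" for y
    using closed_lformD(2)[OF closed_lform_pb[OF \<omega> W(1) W_V] that] .
  have kernW: "\<forall>j\<in>J. ax j \<in> kern q (pb \<Phi> \<omega> y)" if y: "y \<in> W" for y
  proof
    fix j assume j: "j \<in> J"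
    have \<Phi>y: "\<Phi> y \<in> ?B" using W(3) y by blast
    have "ax j $ i = (0::real)" using iJ j by (auto simp: axis_def)
    then have "?D \<Psi> (\<Phi> y) (ax j) = ?D \<Psi> (\<Phi> y) (?D \<Phi> y (ax j))"
      using inv[OF y] d\<Psi>[OF \<Phi>y] dFj[OF \<Phi>y j] by simp
    then have "?D \<Phi> y (ax j) = ax j" using inj[OF y] by (simp add: inj_eq)
    then show "ax j \<in> kern q (pb \<Phi> \<omega> y)"
      unfolding kern_pb(1)[OF W(1) y] using J(1) j \<Phi>y r(2) by auto
  qed
  have one: "pb \<Phi> \<omega> y (map ax is0) = 1" if y: "y \<in> W" for y
  proof -
    have \<Phi>y: "\<Phi> y \<in> ?B" "\<Phi> y \<in> V" using W(3) y r(2) by blast+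
    let ?f = "f (\<Phi> y)"
    \<comment> \<open>Old and new coordinates differ only in the \<open>i\<close>-th, so
      \<open>D \<Phi>\<close> changes basis vectors by multiples of \<open>ax i\<close>. Beside the
      argument \<open>ax i\<close> these multiples are absorbed, while \<open>ax i\<close> itself is
      divided by \<open>f\<close>, which cancels the component.\<close>
    define c where "c a = ?D \<Phi> y (ax a) $ i - ?D F (\<Phi> y) (?D \<Phi> y (ax a))" for a
    have Da: "?D \<Phi> y (ax a) = ax a + c a *\<^sub>R ?e" for a
      using inv[OF y, of "ax a"] unfolding d\<Psi>[OF \<Phi>y(1)] c_def by (simp add: algebra_simps)
    have "?D F (\<Phi> y) ((1 / ?f) *\<^sub>R ?e) = 1"
      using linear_cmul[OF linear_frechet[OF sF \<Phi>y(1)], of "1 / ?f" ?e] dFi[OF \<Phi>y(1)] f0[OF \<Phi>y(2)] by simp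
    then have "?D \<Psi> (\<Phi> y) ((1 / ?f) *\<^sub>R ?e) = ?e"
      unfolding d\<Psi>[OF \<Phi>y(1)] by (simp add: scaleR_left_distrib[symmetric])
    then have "?D \<Psi> (\<Phi> y) ((1 / ?f) *\<^sub>R ?e) = ?D \<Psi> (\<Phi> y) (?D \<Phi> y ?e)" using inv[OF y] by simp
    then have De: "?D \<Phi> y ?e = (1 / ?f) *\<^sub>R ?e" using inj[OF y] by (simp add: inj_eq)
    have "pb \<Phi> \<omega> y (map ax is0) = \<omega> (\<Phi> y) ([] @ ((1 / ?f) *\<^sub>R ?e) # map (\<lambda>a. ax a + c a *\<^sub>R ?e) as)"
      unfolding pb_def is0_eq list.map map_map comp_def De by (simp add: Da)
    also have "\<dots> = (1 / ?f) * \<omega> (\<Phi> y) ([] @ ?e # map (\<lambda>a. ax a + c a *\<^sub>R ?e) as)"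
      using len0 is0_eq by (intro altf_scale[OF alt[OF \<Phi>y(2)]]) simp
    also have "\<omega> (\<Phi> y) ([] @ ?e # map (\<lambda>a. ax a + c a *\<^sub>R ?e) as) = ?f"
      using altf_absorb[OF alt[OF \<Phi>y(2)], of "[]" as ?e ax c] len0 is0_eq by (simp add: f_def)
    finally show ?thesis using f0[OF \<Phi>y(2)] by simp
  qed
  show ?thesis
  proof (rule that[OF W(1) W_V W(2)], intro ballI allI impI)
    fix x y "is" assume x: "x \<in> W" and y: "y \<in> W" and len: "length (is :: 'n list) = q"
    obtain \<epsilon> where \<epsilon>: "\<And>w. altf q w \<Longrightarrow> \<forall>j\<in>J. ax j \<in> kern q w \<Longrightarrow> w (map ax is) = \<epsilon> * w (map ax is0)"
      using top_form_component[OF is0(2,1) len0 len] by blast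
    show "pb \<Phi> \<omega> x (map ax is) = pb \<Phi> \<omega> y (map ax is)"
      using \<epsilon>[OF altW[OF x] kernW[OF x]] \<epsilon>[OF altW[OF y] kernW[OF y]] one[OF x] one[OF y] by simp
  qed
qed

section \<open>The size of the kernel in degrees 1 and n - 1\<close>

lemma kern_1_dim:
  fixes w :: "(real ^ 'n) list \<Rightarrow> real"
  assumes w: "altf 1 w" and nz: "w [u] \<noteq> 0"
  shows "dim (kern 1 w) + 1 = CARD('n)"
proof -
  define a where "a = (\<chi> i. w [ax i])"
  have wa: "w [v] = a \<bullet> v" for v
    using altf_expand[OF w, of "[]" "[]" v] by (simp add: a_def inner_vec_def mult.commute)
  then have "kern 1 w = {v. a \<bullet> v = 0}" by (auto simp: kern_def)
  moreover have "a \<noteq> 0" using wa[of u] nz by auto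
  ultimately show ?thesis using dim_hyperplane[of a] by simp
qed

text \<open>An (n - 1)-form is the contraction of a volume form with a vector, and that vector lies
  in the kernel. It is found here from a nonzero component, whose only missing index is
  \<open>l\<close>.\<close>

lemma kern_codim_1_nontrivial:
  fixes w :: "(real ^ 'n) list \<Rightarrow> real"
  assumes w: "altf q w" and q: "Suc q = CARD('n)" "0 < q"
    and nz: "length vs = q" "w vs \<noteq> 0"
  shows "0 < dim (kern q w)"
proof -
  obtain "is" where len: "length is = q" and w_is: "w (map ax is) \<noteq> 0"
    using altf_eq_0I[OF w _ nz(1)] nz(2) by blast
  have dist: "distinct is" using altfD(2)[OF w, of "map ax is"] len w_is by (auto simp: distinct_map)
  have "card (- set is) = 1"
    using distinct_card[OF dist] len q by (simp add: Compl_eq_Diff_UNIV card_Diff_subset)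
  then obtain l where l: "- set is = {l}" by (auto simp: card_1_singleton_iff)
  then have set_is: "set is = - {l}" by auto
  obtain q' where q': "q = Suc q'" using q(2) by (cases q) auto
  let ?R = "\<lambda>a. map ax (remove1 a is)"
  have wa: "w (ax a # ?R a) \<noteq> 0" if a: "a \<noteq> l" for a
  proof -
    have a': "a \<in> set is" using a set_is by auto
    then have "mset is = mset (a # remove1 a is)" by simp
    then have "mset (map ax is) = mset (map ax (a # remove1 a is))" by (simp only: mset_map)
    from altf_mset[OF this] obtain \<epsilon> where
      "\<And>w. altf (length (map ax (a # remove1 a is))) w \<Longrightarrow> w (map ax is) = \<epsilon> * w (map ax (a # remove1 a is))"
      by blast
    moreover have "length (map ax (a # remove1 a is)) = q"
      using len length_remove1[of a "is"] a' q' by simp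
    ultimately have "w (map ax is) = \<epsilon> * w (map ax (a # remove1 a is))" using w by metis
    then show ?thesis using w_is by auto
  qed
  \<comment> \<open>Next to the arguments \<open>?R a\<close> only the indices \<open>l\<close> and
    \<open>a\<close> are not repeated, so this is the coefficient that makes
    \<open>w (v # ?R a)\<close> vanish.\<close>
  define \<gamma> where "\<gamma> a = - w (ax l # ?R a) / w (ax a # ?R a)" for a
  define v where "v = ax l + (\<Sum>b\<in>-{l}. \<gamma> b *\<^sub>R ax b)"
  have sv: "w (v # map ax js) = 0" if js: "length js = q'" "l \<notin> set js" for js
  proof (cases "distinct js")
    case False
    then show ?thesis using altfD(2)[OF w, of "v # map ax js"] js q' by (simp add: distinct_map)
  next
    case True
    have "card (- {l} - set js) = 1"
      using q q' js distinct_card[OF True] by (subst card_Diff_subset) (auto simp: card_Diff_subset Compl_eq_Diff_UNIV)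
    then obtain a where a: "- {l} - set js = {a}" by (auto simp: card_1_singleton_iff)
    then have al: "a \<noteq> l" and ajs: "a \<notin> set js" by auto
    have "set (remove1 a is) = set js" using a js set_is set_remove1_eq[OF dist, of a] by auto
    then have "mset js = mset (remove1 a is)"
      using set_eq_iff_mset_eq_distinct[of js "remove1 a is"] True dist by simp
    then have "mset (map ax js) = mset (?R a)" by simp
    from altf_mset[OF this] obtain \<epsilon> where \<epsilon>: "\<And>w'. altf (length (?R a)) w' \<Longrightarrow> w' (map ax js) = \<epsilon> * w' (?R a)" by blast
    have lenR: "length (?R a) = q'" using \<open>mset js = mset (remove1 a is)\<close> js by (metis length_map size_mset)
    have \<epsilon>': "w (x # map ax js) = \<epsilon> * w (x # ?R a)" for x
      by (rule \<epsilon>[of "\<lambda>l. w (x # l)"]) (use w q' lenR in \<open>auto intro: altf_Cons\<close>)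
    have "w ([] @ v # map ax js) = w ([] @ ax l # map ax js) + w ([] @ (\<Sum>b\<in>-{l}. \<gamma> b *\<^sub>R ax b) # map ax js)"
      unfolding v_def using js q' by (intro altf_add[OF w]) simp
    also have "w ([] @ (\<Sum>b\<in>-{l}. \<gamma> b *\<^sub>R ax b) # map ax js) = (\<Sum>b\<in>-{l}. \<gamma> b * w ([] @ ax b # map ax js))"
      using js q' by (intro altf_sum[OF w]) simp_all
    also have "\<dots> = (\<Sum>b\<in>{a}. \<gamma> b * w ([] @ ax b # map ax js))"
    proof (rule sum.mono_neutral_right)
      show "\<forall>b\<in>- {l} - {a}. \<gamma> b * w ([] @ ax b # map ax js) = 0"
      proof
        fix b assume "b \<in> - {l} - {a}"
        then have "b \<in> set js" using a by blast
        then show "\<gamma> b * w ([] @ ax b # map ax js) = 0"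
          using altfD(2)[OF w, of "ax b # map ax js"] js q' by simp
      qed
    qed (use al in auto)
    finally show ?thesis using wa[OF al] by (simp add: \<epsilon>' \<gamma>_def)
  qed
  have "v \<in> kern q w"
  proof (rule kern_basisI[OF w])
    fix js :: "'n list" assume js: "Suc (length js) = q"
    show "w (v # map ax js) = 0"
    proof (cases "distinct js \<and> l \<in> set js")
      case False
      then consider "\<not> distinct js" | "l \<notin> set js" by blast
      then show ?thesis
      proof cases
        case 1
        then show ?thesis using altfD(2)[OF w, of "v # map ax js"] js by (simp add: distinct_map)
      next
        case 2
        then show ?thesis using sv js q' by simp
      qed
    next
      case True
      \<comment> \<open>Putting \<open>v\<close> in place of \<open>ax l\<close> repeats the
        argument \<open>v\<close>, so the value is 0. Expanding the second \<open>v\<close> gives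
        the wanted term and terms without \<open>ax l\<close>, which vanish by
        \<open>sv\<close>.\<close>
      then obtain xs ys where xy: "js = xs @ l # ys" by (auto dest: split_list)
      let ?xs = "v # map ax xs" and ?ys = "map ax ys"
      have lq: "Suc (length ?xs + length ?ys) = q" using js xy by simp
      have "0 = w (?xs @ v # ?ys)" using altfD(2)[OF w, of "?xs @ v # ?ys"] js xy by simp
      also have "\<dots> = w (?xs @ ax l # ?ys) + w (?xs @ (\<Sum>b\<in>-{l}. \<gamma> b *\<^sub>R ax b) # ?ys)"
        using altf_add[OF w lq, of "ax l" "\<Sum>b\<in>-{l}. \<gamma> b *\<^sub>R ax b"] unfolding v_def[symmetric] .
      also have "w (?xs @ (\<Sum>b\<in>-{l}. \<gamma> b *\<^sub>R ax b) # ?ys) = (\<Sum>b\<in>-{l}. \<gamma> b * w (?xs @ ax b # ?ys))"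
        by (rule altf_sum[OF w lq]) simp
      also have "\<dots> = 0"
      proof (rule sum.neutral, rule ballI)
        fix b assume "b \<in> - {l}"
        then have "w (v # map ax (xs @ b # ys)) = 0"
          using True xy js q' by (intro sv) auto
        then show "\<gamma> b * w (?xs @ ax b # ?ys) = 0" by simp
      qed
      finally show ?thesis by (simp add: xy)
    qed
  qed
  moreover have "v \<noteq> 0"
  proof
    assume "v = 0"
    then have "v $ l = 0" by simp
    moreover have "(\<Sum>b\<in>-{l}. \<gamma> b * ax b $ l) = 0" by (intro sum.neutral) (auto simp: axis_def)
    ultimately show False by (simp add: v_def)
  qed
  ultimately have "\<not> kern q w \<subseteq> {0}" by blast
  then show ?thesis using dim_eq_0[of "kern q w"] by auto
qed

section \<open>Closed 2-forms\<close>

lemma altf_2I: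
  fixes w :: "'v::real_vector list \<Rightarrow> real"
  assumes "\<And>a b s t u. w [s *\<^sub>R a + t *\<^sub>R b, u] = s * w [a, u] + t * w [b, u]"
    and anti: "\<And>a b. w [a, b] = - w [b, a]"
  shows "altf 2 w"
  unfolding altf_def
proof (intro conjI allI impI)
  fix xs ys :: "'v list" and v v' :: 'v and s t assume "Suc (length xs + length ys) = 2"
  then consider u where "xs = []" "ys = [u]" | u where "xs = [u]" "ys = []"
    by (cases xs; cases ys) auto
  then show "w (xs @ (s *\<^sub>R v + t *\<^sub>R v') # ys) = s * w (xs @ v # ys) + t * w (xs @ v' # ys)"
  proof cases
    case 1
    then show ?thesis using assms(1) by simp
  next
    case 2
    then show ?thesis using assms(1)[of s v t v' u] anti[of u] by simp
  qed
next
  fix vs :: "'v list" assume "length vs = 2" "\<not> distinct vs"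
  then obtain a where "vs = [a, a]" by (auto simp: numeral_2_eq_2 length_Suc_conv)
  then show "w vs = 0" using anti[of a a] by simp
qed

lemma altf_2D:
  assumes "altf 2 w"
  shows "w [a, b] = - w [b, a]" "w [a, a] = 0"
    and "w [s *\<^sub>R a + t *\<^sub>R b, u] = s * w [a, u] + t * w [b, u]"
  using altf_swap[OF assms, of "[]" "[]" a b] altfD(2)[OF assms, of "[a, a]"]
    altfD(1)[OF assms, of "[]" "[u]" s a t b] by simp_all

lemma altf_2_linear:
  assumes "altf 2 w"
  shows "linear (\<lambda>u. w [a, u])"
  using altf_add[OF assms, of "[a]" "[]"] altf_scale[OF assms, of "[a]" "[]"] by (intro linearI) simp_all

lemma kern_2: "v \<in> kern 2 w \<longleftrightarrow> (\<forall>u. w [v, u] = 0)"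
proof -
  have "v \<in> kern 2 w \<longleftrightarrow> (\<forall>vs. length vs = 1 \<longrightarrow> w (v # vs) = 0)" by (simp add: kern_def)
  also have "\<dots> \<longleftrightarrow> (\<forall>u. w [v, u] = 0)" by (auto simp: length_Suc_conv)
  finally show ?thesis .
qed

section \<open>The closed 2-forms \<open>df \<and> dg\<close>\<close>

definition wedge :: "('e::euclidean_space \<Rightarrow> real) \<Rightarrow> ('e \<Rightarrow> real) \<Rightarrow> 'e \<Rightarrow> 'e list \<Rightarrow> real"
  where "wedge f g x vs =
    frechet_derivative f (at x) (vs ! 0) * frechet_derivative g (at x) (vs ! 1) -
    frechet_derivative f (at x) (vs ! 1) * frechet_derivative g (at x) (vs ! 0)"

lemma altf_wedge:
  assumes "smooth_on f U" "smooth_on g U" "x \<in> U"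
  shows "altf 2 (wedge f g x)"
  using linear_frechet[OF assms(1,3)] linear_frechet[OF assms(2,3)]
  by (intro altf_2I) (simp_all add: wedge_def linear_add linear_cmul algebra_simps)

text \<open>After the product rule each second derivative occurs twice with opposite signs, once the
  order of differentiation is disregarded.\<close>

lemma euclidean_d_wedge:
  fixes f g :: "real ^ 'n \<Rightarrow> real"
  assumes U: "open U" and f: "smooth_on f U" and g: "smooth_on g U" and x: "x \<in> U" and len: "length ws = 3"
  shows "euclidean_d (wedge f g) x ws = 0"
proof -
  obtain a b c where ws: "ws = [a, b, c]" using len by (auto simp: numeral_3_eq_3 length_Suc_conv)
  let ?D = "\<lambda>f x. frechet_derivative f (at x)"
  let ?H = "\<lambda>f v w. ?D (\<lambda>x. ?D f x v) x w"
  have d: "((\<lambda>x. ?D f x v) has_derivative ?H f v) (at x)" if "smooth_on f U" for f :: "real ^ 'n \<Rightarrow> real" and v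
    by (rule smooth_on_deriv(1)[OF smooth_on_deriv(2)[OF that] x])
  have hsym: "?H f v w = ?H f w v" if "smooth_on f U" for f :: "real ^ 'n \<Rightarrow> real" and v w
    by (rule symmetric_second_derivative[OF U that x])
  have D: "?D (\<lambda>y. wedge f g y [v, w]) x u =
      (?D f x v * ?H g w u + ?H f v u * ?D g x w) - (?D f x w * ?H g v u + ?H f w u * ?D g x v)" for u v w
  proof -
    have "((\<lambda>y. ?D f y v * ?D g y w - ?D f y w * ?D g y v) has_derivative
      (\<lambda>u. (?D f x v * ?H g w u + ?H f v u * ?D g x w) - (?D f x w * ?H g v u + ?H f w u * ?D g x v))) (at x)"
      by (intro has_derivative_diff has_derivative_mult d f g)
    then have "((\<lambda>y. wedge f g y [v, w]) has_derivative
      (\<lambda>u. (?D f x v * ?H g w u + ?H f v u * ?D g x w) - (?D f x w * ?H g v u + ?H f w u * ?D g x v))) (at x)"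
      by (simp add: wedge_def)
    from fun_cong[OF frechet_derivative_at[OF this], of u] show ?thesis by (rule sym)
  qed
  show ?thesis
    unfolding ws euclidean_d_def
    by (simp add: D numeral_3_eq_3 lessThan_Suc hsym[OF f, of b a] hsym[OF f, of c a] hsym[OF f, of c b]
        hsym[OF g, of b a] hsym[OF g, of c a] hsym[OF g, of c b])
qed

lemma pb_wedge:
  assumes P: "param V \<Phi>" "\<Phi> ` V \<subseteq> U" and f: "smooth_on f U" and g: "smooth_on g U"
    and x: "x \<in> V" and len: "length vs = 2"
  shows "pb \<Phi> (wedge f g) x vs = wedge (f \<circ> \<Phi>) (g \<circ> \<Phi>) x vs"
proof -
  have \<Phi>x: "\<Phi> x \<in> U" using P(2) x by blast
  have "frechet_derivative (h \<circ> \<Phi>) (at x) v = frechet_derivative h (at (\<Phi> x)) (frechet_derivative \<Phi> (at x) v)"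
    if "smooth_on h U" for h :: "real ^ 'a \<Rightarrow> real" and v
    using frechet_derivative_at[OF diff_chain_at[OF paramD(6)[OF P(1) x] smooth_on_deriv(1)[OF that \<Phi>x]]]
    by (metis comp_apply)
  then show ?thesis using f g len by (simp add: pb_def wedge_def)
qed

lemma smooth_on_comp_param:
  assumes "param V \<Phi>" "\<Phi> ` V \<subseteq> U" "open U" "smooth_on (f :: real ^ 'n \<Rightarrow> real) U"
  shows "smooth_on (f \<circ> \<Phi>) V"
  unfolding comp_def by (rule smooth_on_compose[OF paramD(1)[OF assms(1)] assms(3,4) paramD(2)[OF assms(1)] assms(2)])

text \<open>A pullback of \<open>df \<and> dg\<close> is again of this shape, with
  \<open>f \<circ> \<Phi>\<close> and \<open>g \<circ> \<Phi>\<close>, so the computation in one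
  coordinate system covers all.\<close>

lemma closed_lform_wedge:
  fixes f g :: "real ^ 'n \<Rightarrow> real"
  assumes U: "open U" and f: "smooth_on f U" and g: "smooth_on g U"
  shows "closed_lform 2 U (wedge f g)"
  unfolding closed_lform_def
proof (intro conjI ballI allI impI; (elim conjE)?)
  show "altf 2 (wedge f g x)" if "x \<in> U" for x by (rule altf_wedge[OF f g that])
  fix V \<Phi> assume P: "param V \<Phi>" "\<Phi> ` V \<subseteq> U"
  note oV = paramD(1)[OF P(1)]
  have sf: "smooth_on (f \<circ> \<Phi>) V" and sg: "smooth_on (g \<circ> \<Phi>) V"
    using smooth_on_comp_param[OF P U] f g by blast+
  show "smooth_on (\<lambda>x. pb \<Phi> (wedge f g) x (map ax is)) V" if "length is = 2" for "is"
  proof (rule smooth_on_cong[OF oV])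
    show "wedge (f \<circ> \<Phi>) (g \<circ> \<Phi>) x (map ax is) = pb \<Phi> (wedge f g) x (map ax is)" if "x \<in> V" for x
      using pb_wedge[OF P f g that, of "map ax is"] \<open>length is = 2\<close> by simp
    show "smooth_on (\<lambda>x. wedge (f \<circ> \<Phi>) (g \<circ> \<Phi>) x (map ax is)) V"
      unfolding wedge_def by (intro smooth_on_diff smooth_on_mult smooth_on_deriv(2) sf sg oV)
  qed
  show "euclidean_d (pb \<Phi> (wedge f g)) x (map ax is) = 0" if x: "x \<in> V" and len: "length is = Suc 2" for x "is"
  proof -
    have "euclidean_d (pb \<Phi> (wedge f g)) x (map ax is) = euclidean_d (wedge (f \<circ> \<Phi>) (g \<circ> \<Phi>)) x (map ax is)"
      unfolding euclidean_d_def
    proof (intro sum.cong refl arg_cong2[of _ _ _ _ "(*)"] fun_cong[OF frechet_derivative_cong[OF oV x]])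
      fix i y assume i: "i \<in> {..<length (map ax is)}" and y: "y \<in> V"
      show "pb \<Phi> (wedge f g) y (take i (map ax is) @ drop (Suc i) (map ax is)) =
          wedge (f \<circ> \<Phi>) (g \<circ> \<Phi>) y (take i (map ax is) @ drop (Suc i) (map ax is))"
        by (rule pb_wedge[OF P f g y]) (use i len in auto)
    qed
    also have "\<dots> = 0" by (rule euclidean_d_wedge[OF oV sf sg x]) (use len in simp)
    finally show ?thesis .
  qed
qed (rule U)

lemma closed_lform_add:
  assumes \<omega>: "closed_lform q U \<omega>" and \<eta>: "closed_lform q U \<eta>"
  shows "closed_lform q U (\<lambda>x vs. \<omega> x vs + \<eta> x vs)"
  unfolding closed_lform_def
proof (intro conjI ballI allI impI; (elim conjE)?)
  show "open U" by (rule closed_lformD(1)[OF \<omega>])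
  show "altf q (\<lambda>vs. \<omega> x vs + \<eta> x vs)" if "x \<in> U" for x
    using closed_lformD(2)[OF \<omega> that] closed_lformD(2)[OF \<eta> that]
    unfolding altf_def by (auto simp: algebra_simps)
  fix V \<Phi> assume P: "param V \<Phi>" "\<Phi> ` V \<subseteq> U"
  note oV = paramD(1)[OF P(1)]
  note 1 = closed_lform_pb[OF \<omega> P] and 2 = closed_lform_pb[OF \<eta> P]
  have eq: "pb \<Phi> (\<lambda>x vs. \<omega> x vs + \<eta> x vs) = (\<lambda>x vs. pb \<Phi> \<omega> x vs + pb \<Phi> \<eta> x vs)"
    by (simp add: pb_def fun_eq_iff)
  show "smooth_on (\<lambda>x. pb \<Phi> (\<lambda>x vs. \<omega> x vs + \<eta> x vs) x (map ax is)) V" if "length is = q" for "is"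
    unfolding eq by (intro smooth_on_add oV closed_lformD(3)[OF 1 that] closed_lformD(3)[OF 2 that])
  show "euclidean_d (pb \<Phi> (\<lambda>x vs. \<omega> x vs + \<eta> x vs)) x (map ax is) = 0" if x: "x \<in> V" and len: "length is = Suc q" for x "is"
  proof -
    have "euclidean_d (\<lambda>x vs. pb \<Phi> \<omega> x vs + pb \<Phi> \<eta> x vs) x (map ax is) =
        euclidean_d (pb \<Phi> \<omega>) x (map ax is) + euclidean_d (pb \<Phi> \<eta>) x (map ax is)"
      unfolding euclidean_d_def sum.distrib[symmetric]
    proof (rule sum.cong[OF refl])
      fix i assume i: "i \<in> {..<length (map ax is)}"
      let ?js = "take i is @ drop (Suc i) is"
      have js: "take i (map ax is) @ drop (Suc i) (map ax is) = map ax ?js" by (simp add: take_map drop_map)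
      have "length ?js = q" using i len by simp
      note d = smooth_on_deriv(1)[OF closed_lformD(3)[OF 1 this] x] smooth_on_deriv(1)[OF closed_lformD(3)[OF 2 this] x]
      show "(-1) ^ i * frechet_derivative (\<lambda>y. pb \<Phi> \<omega> y (take i (map ax is) @ drop (Suc i) (map ax is)) +
            pb \<Phi> \<eta> y (take i (map ax is) @ drop (Suc i) (map ax is))) (at x) (map ax is ! i) =
          (-1) ^ i * frechet_derivative (\<lambda>y. pb \<Phi> \<omega> y (take i (map ax is) @ drop (Suc i) (map ax is))) (at x) (map ax is ! i) +
          (-1) ^ i * frechet_derivative (\<lambda>y. pb \<Phi> \<eta> y (take i (map ax is) @ drop (Suc i) (map ax is))) (at x) (map ax is ! i)"
        unfolding js fun_cong[OF frechet_derivative_at[OF has_derivative_add[OF d]], symmetric]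
        by (simp add: distrib_left)
    qed
    then show ?thesis unfolding eq using closed_lformD(4)[OF 1 x len] closed_lformD(4)[OF 2 x len] by simp
  qed
qed

section \<open>Linear algebra of degenerate 2-forms\<close>

lemma dim_span_ax: "dim (span (ax ` J :: (real ^ 'n) set)) = card J"
proof -
  have "ax ` J \<subseteq> (Basis :: (real ^ 'n) set)" by (auto simp: Basis_vec_def)
  then have "independent (ax ` J :: (real ^ 'n) set)" using independent_Basis by (rule independent_mono[rotated])
  then have "dim (ax ` J :: (real ^ 'n) set) = card (ax ` J :: (real ^ 'n) set)" by (rule dim_eq_card_independent)
  then show ?thesis by (simp add: dim_span card_image inj_on_subset[OF inj_ax])
qed

lemma kern_eq_coordinates:
  fixes w :: "(real ^ 'n) list \<Rightarrow> real"
  assumes w: "altf q w" and J: "\<forall>j\<in>J. ax j \<in> kern q w" "dim (kern q w) = card J"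
  shows "v \<in> kern q w \<longleftrightarrow> (\<forall>a. a \<notin> J \<longrightarrow> v $ a = 0)"
proof -
  have "span (ax ` J) \<subseteq> kern q w" using J(1) by (intro span_minimal subspace_kern[OF w]) auto
  then have K: "kern q w = span (ax ` J)"
    using subspace_dim_equal[of "span (ax ` J)" "kern q w"] subspace_kern[OF w] J(2) dim_span_ax[of J] by auto
  show ?thesis
  proof
    assume "v \<in> kern q w"
    then have "v \<in> span (ax ` J)" using K by simp
    moreover have "span (ax ` J) \<subseteq> {v :: real ^ 'n. \<forall>a. a \<notin> J \<longrightarrow> v $ a = 0}"
    proof (rule span_minimal)
      show "ax ` J \<subseteq> {v :: real ^ 'n. \<forall>a. a \<notin> J \<longrightarrow> v $ a = 0}" by (auto simp: axis_def)
      show "subspace {v :: real ^ 'n. \<forall>a. a \<notin> J \<longrightarrow> v $ a = 0}" by (auto simp: subspace_def)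
    qed
    ultimately show "\<forall>a. a \<notin> J \<longrightarrow> v $ a = 0" by blast
  next
    assume v: "\<forall>a. a \<notin> J \<longrightarrow> v $ a = 0"
    have "(\<Sum>a\<in>UNIV. (v $ a) *\<^sub>R ax a) \<in> kern q w"
    proof (rule subspace_sum[OF subspace_kern[OF w]])
      fix a
      show "(v $ a) *\<^sub>R ax a \<in> kern q w"
        using v J(1) subspace_scale[OF subspace_kern[OF w]] subspace_0[OF subspace_kern[OF w]]
        by (cases "a \<in> J") auto
    qed
    then show "v \<in> kern q w" by (simp add: vec_expansion)
  qed
qed

text \<open>
  If \<open>w\<close> is nondegenerate in the coordinates outside \<open>J\<close> and \<open>J\<close> spans its kernel, this matrix
  represents \<open>v \<mapsto> w (v, -)\<close> made invertible by the identity on \<open>J\<close>.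
\<close>

definition symp_matrix :: "'n set \<Rightarrow> ((real ^ 'n) list \<Rightarrow> real) \<Rightarrow> real ^ 'n ^ 'n"
  where "symp_matrix J w = (\<chi> a b. w [ax b, ax a] + (if a = b \<and> a \<in> J then 1 else 0))"

text \<open>For \<open>i\<close> outside \<open>J\<close> the solution \<open>X\<close> is the
  Hamiltonian vector of the \<open>i\<close>-th coordinate, \<open>w (X, -) = dx\<^sub>i\<close>.
  Such a vector is determined modulo the kernel only; the identity block selects the one without
  components in \<open>J\<close>.\<close>

lemma symp_matrix:
  fixes w :: "(real ^ 'n) list \<Rightarrow> real"
  assumes w: "altf 2 w" and K: "\<And>v. v \<in> kern 2 w \<longleftrightarrow> (\<forall>a. a \<notin> J \<longrightarrow> v $ a = 0)"
  shows "det (symp_matrix J w) \<noteq> 0"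
    and "i \<notin> J \<Longrightarrow> symp_matrix J w *v X = ax i \<Longrightarrow> w [X, u] = u $ i"
    and "i \<notin> J \<Longrightarrow> symp_matrix J w *v X = ax i \<Longrightarrow> j \<in> J \<Longrightarrow> X $ j = 0"
proof -
  have Mv: "(symp_matrix J w *v v) $ a = w [v, ax a] + (if a \<in> J then v $ a else 0)" for v a
  proof -
    have "(symp_matrix J w *v v) $ a =
        (\<Sum>b\<in>UNIV. v $ b * w [ax b, ax a]) + (\<Sum>b\<in>UNIV. if a = b then (if a \<in> J then v $ b else 0) else 0)"
      unfolding sum.distrib[symmetric] symp_matrix_def matrix_vector_mult_def
      by (auto intro!: sum.cong simp: distrib_right)
    then show ?thesis using altf_expand[OF w, of "[]" "[ax a]" v] by simp
  qed
  have J0: "w [v, ax a] = 0" if "a \<in> J" for v a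
  proof -
    have "ax a \<in> kern 2 w" unfolding K using that by (auto simp: axis_def)
    then show ?thesis using altf_2D(1)[OF w, of v "ax a"] by (simp add: kern_2)
  qed
  have ext: "w [v, u] = (\<Sum>a\<in>UNIV. u $ a * w [v, ax a])" for v u
    using altf_expand[OF w, of "[v]" "[]" u] by simp
  show "det (symp_matrix J w) \<noteq> 0"
    unfolding det_nonzero_iff
  proof (intro allI impI)
    fix v assume v: "symp_matrix J w *v v = 0"
    have "w [v, ax a] = 0" for a using Mv[of v a] J0[of a v] v by (cases "a \<in> J") auto
    then have "w [v, u] = 0" for u by (subst ext) simp
    then have "v \<in> kern 2 w" by (simp add: kern_2)
    then have "v $ a = 0" if "a \<notin> J" for a using K that by blast
    moreover have "v $ a = 0" if "a \<in> J" for a using Mv[of v a] J0[OF that, of v] v that by simp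
    ultimately show "v = 0" by (auto simp: vec_eq_iff)
  qed
  assume i: "i \<notin> J" and X: "symp_matrix J w *v X = ax i"
  show XJ: "X $ j = 0" if "j \<in> J" for j
    using Mv[of X j] J0[OF that, of X] X that i by (auto simp: axis_def split: if_splits)
  have "w [X, ax a] = ax i $ a" for a using Mv[of X a] XJ[of a] X by auto
  then show "w [X, u] = u $ i" unfolding ext[of X u]
    by (simp add: axis_def if_distrib[of "\<lambda>x. _ * x"] cong: if_cong)
qed

text \<open>Here \<open>w' = w + \<alpha> \<and> \<beta>\<close> with \<open>\<alpha> = w (e, -)\<close> and \<open>\<beta> = w (Y, -)\<close>: the kernel gains exactly \<open>e\<close> and \<open>Y\<close>.\<close>

lemma kern_2_step:
  fixes w w' :: "'v::euclidean_space list \<Rightarrow> real"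
  assumes w: "altf 2 w" and w': "altf 2 w'" and "w [Y, e] = 1"
    and eq: "\<And>v u. w' [v, u] = w [v, u] + w [e, v] * w [Y, u] - w [e, u] * w [Y, v]"
  shows "dim (kern 2 w') = dim (kern 2 w) + 2"
proof -
  let ?K = "kern 2 w"
  have eY: "w [e, Y] = -1" using altf_2D(1)[OF w, of e Y] assms(3) by simp
  have K: "w [a, k] = 0" if "k \<in> ?K" for a k
    using that altf_2D(1)[OF w, of a k] by (simp add: kern_2)
  have "span (insert Y (insert e ?K)) \<subseteq> kern 2 w'"
  proof (rule span_minimal[OF _ subspace_kern[OF w']])
    show "insert Y (insert e ?K) \<subseteq> kern 2 w'"
      using K assms(3) eY altf_2D(2)[OF w] by (auto simp: kern_2 eq)
  qed
  moreover have "kern 2 w' \<subseteq> span (insert Y (insert e ?K))"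
  proof
    fix v assume v: "v \<in> kern 2 w'"
    \<comment> \<open>The part of \<open>v\<close> that is \<open>w\<close>-orthogonal to
      \<open>e\<close> and \<open>Y\<close>. It satisfies \<open>w (k, -) = w' (v, -)\<close>, so
      \<open>v\<close> in the kernel of \<open>w'\<close> puts \<open>k\<close> in the kernel of
      \<open>w\<close>.\<close>
    define k where "k = v - (w [Y, v] *\<^sub>R e - w [e, v] *\<^sub>R Y)"
    have "w [k, u] = 0" for u
    proof -
      let ?z = "w [Y, v] *\<^sub>R e + (- w [e, v]) *\<^sub>R Y"
      have "k = 1 *\<^sub>R v + (-1) *\<^sub>R ?z" by (simp add: k_def)
      then have "w [k, u] = 1 * w [v, u] + (-1) * w [?z, u]"
        using altf_2D(3)[OF w, of 1 v "-1" ?z u] by (simp only:)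
      also have "w [?z, u] = w [Y, v] * w [e, u] + (- w [e, v]) * w [Y, u]"
        by (rule altf_2D(3)[OF w])
      finally show ?thesis using v eq[of v u] by (simp add: kern_2 mult.commute)
    qed
    then have "k \<in> ?K" by (simp add: kern_2)
    moreover have "v = k + (w [Y, v] *\<^sub>R e - w [e, v] *\<^sub>R Y)" by (simp add: k_def)
    ultimately show "v \<in> span (insert Y (insert e ?K))"
      by (metis insertCI span_add span_base span_diff span_scale)
  qed
  ultimately have "dim (kern 2 w') = dim (insert Y (insert e ?K))" by (metis dim_span subset_antisym)
  moreover have "e \<notin> span ?K"
  proof
    have "span ?K = ?K" by (rule span_eq_iff[THEN iffD2, OF subspace_kern[OF w]])
    moreover assume "e \<in> span ?K"
    ultimately have "w [e, Y] = 0" using kern_2[of e w] by blast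
    then show False using eY by simp
  qed
  moreover have "Y \<notin> span (insert e ?K)"
  proof
    assume Y: "Y \<in> span (insert e ?K)"
    have "span (insert e ?K) \<subseteq> {u. w [e, u] = 0}"
    proof (rule span_minimal)
      show "insert e ?K \<subseteq> {u. w [e, u] = 0}" using K altf_2D(2)[OF w] by auto
      show "subspace {u. w [e, u] = 0}"
        using linear_subspace_kernel[OF altf_2_linear[OF w]] .
    qed
    then show False using Y eY by auto
  qed
  ultimately show ?thesis by (simp add: dim_insert)
qed

text \<open>Here \<open>\<phi>\<close> is the old coordinate \<open>x\<^sub>i\<close> and
  \<open>\<psi>\<close> the new \<open>x\<^sub>l\<close> in the flow box of its Hamiltonian field
  \<open>X\<close>. As \<open>X\<close> has become \<open>ax l\<close>, \<open>d\<phi>\<close> is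
  the contraction of the form with \<open>ax l\<close>, and \<open>d\<psi>\<close> is the
  contraction with a vector \<open>Y\<close>; so \<open>kern_2_step\<close> applies. The field is
  constant in the directions \<open>J\<close>, hence its flow box keeps them in the kernel.\<close>

lemma darboux_step:
  fixes \<omega> :: "real ^ 'n \<Rightarrow> (real ^ 'n) list \<Rightarrow> real"
  assumes \<omega>: "closed_lform 2 V \<omega>" and p: "p \<in> V"
    and J: "\<forall>x\<in>V. \<forall>j\<in>J. ax j \<in> kern 2 (\<omega> x)" "card J < CARD('n)"
    and dim: "\<And>x. x \<in> V \<Longrightarrow> dim (kern 2 (\<omega> x)) = card J"
  obtains W \<Psi> \<phi> \<psi> where "param W \<Psi>" "\<Psi> ` W \<subseteq> V" "p \<in> \<Psi> ` W" "smooth_on \<phi> W" "smooth_on \<psi> W"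
    "\<forall>x\<in>W. dim (kern 2 (\<lambda>vs. pb \<Psi> \<omega> x vs + wedge \<phi> \<psi> x vs)) = card J + 2"
proof -
  let ?D = "\<lambda>f x. frechet_derivative f (at x)"
  note alt = closed_lformD(2)[OF \<omega>]
  note oV = closed_lformD(1)[OF \<omega>]
  have "J \<noteq> UNIV" using J(2) by auto
  then obtain i where i: "i \<notin> J" by blast
  have K: "v \<in> kern 2 (\<omega> x) \<longleftrightarrow> (\<forall>a. a \<notin> J \<longrightarrow> v $ a = 0)" if "x \<in> V" for x v
    using kern_eq_coordinates[OF alt[OF that] _ dim[OF that]] J(1) that by blast
  let ?M = "\<lambda>x. symp_matrix J (\<omega> x)"
  have M: "?M x $ a $ b = \<omega> x (map ax [b, a]) + (if a = b \<and> a \<in> J then 1 else 0)" for x a b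
    by (simp add: symp_matrix_def)
  have sM: "smooth_on (\<lambda>x. ?M x $ a $ b) V" for a b
    unfolding M by (intro smooth_on_add smooth_on_const oV closed_lformD(3)[OF \<omega>]) simp
  have det: "det (?M x) \<noteq> 0" if "x \<in> V" for x
    by (rule symp_matrix(1)[OF alt[OF that] K[OF that]])
  obtain X where X: "smooth_on X V" "\<And>x. x \<in> V \<Longrightarrow> ?M x *v X x = ax i"
    using smooth_solution[OF oV sM smooth_on_const[OF oV] det] by blast
  have XJ: "X x $ j = 0" if "x \<in> V" "j \<in> J" for x j
    using symp_matrix(3)[OF alt[OF that(1)] K[OF that(1)] i X(2)[OF that(1)] that(2)] .
  have Xw: "\<omega> x [X x, u] = u $ i" if "x \<in> V" for x u
    using symp_matrix(2)[OF alt[OF that] K[OF that] i X(2)[OF that]] .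
  have DX: "\<forall>x\<in>V. ?D X x (ax j) = 0" if j: "j \<in> J" for j
  proof
    fix x assume x: "x \<in> V"
    show "?D X x (ax j) = 0"
    proof (rule solution_deriv_zero[OF oV sM X x det[OF x]])
      fix a b :: 'n
      have len: "length [b, a] = 2" by simp
      have "((\<lambda>x. ?M x $ a $ b) has_derivative (\<lambda>h. ?D (\<lambda>x. \<omega> x (map ax [b, a])) x h + 0)) (at x)"
        unfolding M by (intro has_derivative_add has_derivative_const smooth_on_deriv(1)[OF closed_lformD(3)[OF \<omega> len] x])
      from fun_cong[OF frechet_derivative_at[OF this], of "ax j"]
      show "?D (\<lambda>x. ?M x $ a $ b) x (ax j) = 0"
        using kern_coordinate_invariant[OF \<omega> _ x len, of j] J(1) j by simp
    qed
  qed
  have "X p \<noteq> 0" using Xw[OF p, of "ax i"] altf_zero[OF alt[OF p], of "[]" "[ax i]"] by auto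
  then obtain l where l: "X p $ l \<noteq> 0" by (auto simp: vec_eq_iff)
  \<comment> \<open>Since \<open>X\<close> has no components in \<open>J\<close>, the coordinate
    \<open>x\<^sub>l\<close> is transversal, so \<open>d\<psi>\<close> vanishes on the kernel and is
    a contraction of the form.\<close>
  have lJ: "l \<notin> J" using XJ[OF p] l by blast
  show ?thesis
  proof (rule straighten[OF oV p X(1) l])
    fix W \<Psi>
    assume P: "param W \<Psi>" "p \<in> W" "\<Psi> ` W \<subseteq> V" "\<Psi> p = p"
      and along: "\<And>x. x \<in> W \<Longrightarrow> ?D \<Psi> x (ax l) = X (\<Psi> x)"
      and across: "\<And>j x. j \<noteq> l \<Longrightarrow> \<forall>z\<in>V. ?D X z (ax j) = 0 \<Longrightarrow> x \<in> W \<Longrightarrow> ?D \<Psi> x (ax j) = ax j"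
    note oW = paramD(1)[OF P(1)]
    define \<phi> where "\<phi> x = \<Psi> x $ i" for x
    define \<psi> where "\<psi> x = x $ l" for x :: "real ^ 'n"
    have s\<phi>: "smooth_on \<phi> W" unfolding \<phi>_def by (rule smooth_on_vec_nth[OF oW paramD(2)[OF P(1)]])
    have s\<psi>: "smooth_on \<psi> W" unfolding \<psi>_def by (rule smooth_on_vec_nth[OF oW smooth_on_ident[OF oW]])
    have d\<phi>: "?D \<phi> x u = ?D \<Psi> x u $ i" if "x \<in> W" for x u
    proof -
      have "(\<phi> has_derivative (\<lambda>u. ?D \<Psi> x u $ i)) (at x)"
        unfolding \<phi>_def[abs_def]
        by (rule bounded_linear.has_derivative[OF bounded_linear_vec_nth paramD(6)[OF P(1) that]])
      from fun_cong[OF frechet_derivative_at[OF this], of u] show ?thesis by (rule sym)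
    qed
    have d\<psi>: "?D \<psi> x u = u $ l" for x u
    proof -
      have "(\<psi> has_derivative (\<lambda>u. u $ l)) (at x)"
        unfolding \<psi>_def[abs_def] by (rule bounded_linear_imp_has_derivative[OF bounded_linear_vec_nth])
      from fun_cong[OF frechet_derivative_at[OF this], of u] show ?thesis by (rule sym)
    qed
    note cl = closed_lform_pb[OF \<omega> P(1,3)]
    note cl' = closed_lform_add[OF cl closed_lform_wedge[OF oW s\<phi> s\<psi>]]
    show ?thesis
    proof (rule that[OF P(1,3) _ s\<phi> s\<psi>])
      show "p \<in> \<Psi> ` W" using P(2,4) by (metis imageI)
      show "\<forall>x\<in>W. dim (kern 2 (\<lambda>vs. pb \<Psi> \<omega> x vs + wedge \<phi> \<psi> x vs)) = card J + 2"
      proof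
        fix x assume x: "x \<in> W"
        have \<Psi>x: "\<Psi> x \<in> V" using P(3) x by blast
        let ?w = "pb \<Psi> \<omega> x"
        have w: "altf 2 ?w" by (rule closed_lformD(2)[OF cl x])
        have dimw: "dim (kern 2 ?w) = card J" using kern_pb(2)[OF P(1) x] dim[OF \<Psi>x] by simp
        have "ax j \<in> kern 2 ?w" if j: "j \<in> J" for j
        proof -
          have "j \<noteq> l" using lJ j by blast
          then have "?D \<Psi> x (ax j) = ax j" using DX[OF j] x by (rule across)
          then show ?thesis unfolding kern_pb(1)[OF P(1) x] using J(1) j \<Psi>x by simp
        qed
        then have Kw: "v \<in> kern 2 ?w \<longleftrightarrow> (\<forall>a. a \<notin> J \<longrightarrow> v $ a = 0)" for v
          using kern_eq_coordinates[OF w _ dimw] by blast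
        \<comment> \<open>This vector is needed only at the single point \<open>x\<close>, for the
          dimension count, so it need not depend smoothly on \<open>x\<close>.\<close>
        obtain Y where "symp_matrix J ?w *v Y = ax l"
          using cramer[OF symp_matrix(1)[OF w Kw], THEN iffD2, OF refl] by blast
        then have Y: "?w [Y, u] = u $ l" for u by (rule symp_matrix(2)[OF w Kw lJ])
        have e: "?w [ax l, u] = ?D \<phi> x u" for u
          using Xw[OF \<Psi>x] by (simp add: pb_def along[OF x] d\<phi>[OF x])
        have "dim (kern 2 (\<lambda>vs. ?w vs + wedge \<phi> \<psi> x vs)) = dim (kern 2 ?w) + 2"
        proof (rule kern_2_step[OF w closed_lformD(2)[OF cl' x]])
          show "?w [Y, ax l] = 1" by (simp add: Y)
          show "?w [v, u] + wedge \<phi> \<psi> x [v, u] =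
              ?w [v, u] + ?w [ax l, v] * ?w [Y, u] - ?w [ax l, u] * ?w [Y, v]" for v u
            by (simp add: wedge_def e Y d\<psi>)
        qed
        then show "dim (kern 2 (\<lambda>vs. ?w vs + wedge \<phi> \<psi> x vs)) = card J + 2" using dimw by simp
      qed
    qed
  qed
qed

text \<open>Induction on the rank \<open>CARD('n) - d\<close>. Independence of the functions is not
  carried along: the count \<open>2 * m + d = CARD('n)\<close> suffices for
  \<open>darboux_coordinates\<close>.\<close>

lemma darboux_functions:
  fixes \<omega> :: "real ^ 'n \<Rightarrow> (real ^ 'n) list \<Rightarrow> real"
  assumes "closed_lform 2 U \<omega>" "p \<in> U" "\<forall>x\<in>U. dim (kern 2 (\<omega> x)) = d"
  shows "\<exists>V \<Phi> m f g. param V \<Phi> \<and> \<Phi> ` V \<subseteq> U \<and> p \<in> \<Phi> ` V \<and> 2 * m + d = CARD('n) \<and>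
    (\<forall>k<m. smooth_on (f k) V \<and> smooth_on (g k) V) \<and>
    (\<forall>x\<in>V. \<forall>v w. pb \<Phi> \<omega> x [v, w] = (\<Sum>k<(m::nat). wedge (f k) (g k) x [v, w]))"
  using assms
proof (induction "CARD('n) - d" arbitrary: U \<omega> p d rule: less_induct)
  case less
  obtain V \<Phi> J where P: "param V \<Phi>" "\<Phi> ` V \<subseteq> U" "p \<in> \<Phi> ` V" and J: "card J = d"
    "\<forall>x\<in>V. \<forall>j\<in>J. ax j \<in> kern 2 (pb \<Phi> \<omega> x)"
    by (rule kernel_straightening[OF less.prems(1,2) less.prems(3)[THEN bspec]])
  have dCARD: "d \<le> CARD('n)" using card_mono[OF finite_class.finite_UNIV subset_UNIV, of J] J(1) by simp
  note cl = closed_lform_pb[OF less.prems(1) P(1,2)]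
  have dim: "dim (kern 2 (pb \<Phi> \<omega> x)) = card J" if "x \<in> V" for x
    using kern_pb(2)[OF P(1) that] less.prems(3) P(2) that J(1) by auto
  show ?case
  proof (cases "d = CARD('n)")
    case True
    then have "J = UNIV" using J(1) by (metis card_eq_UNIV_imp_eq_UNIV finite_class.finite_UNIV)
    then have "v \<in> kern 2 (pb \<Phi> \<omega> x)" if "x \<in> V" for x v
      using kern_eq_coordinates[OF closed_lformD(2)[OF cl that] _ dim[OF that]] J(2) that by blast
    then have "pb \<Phi> \<omega> x [v, w] = 0" if "x \<in> V" for x v w using that kern_2 by blast
    then show ?thesis using P True by (intro exI[of _ V] exI[of _ \<Phi>] exI[of _ 0]) auto
  next
    case False
    then have lt: "card J < CARD('n)" using dCARD J(1) by simp
    obtain p' where p': "p' \<in> V" "p = \<Phi> p'" using P(3) by blast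
    obtain W \<Psi> \<phi> \<psi> where W: "param W \<Psi>" "\<Psi> ` W \<subseteq> V" "p' \<in> \<Psi> ` W" and s: "smooth_on \<phi> W" "smooth_on \<psi> W"
      and dimW: "\<forall>x\<in>W. dim (kern 2 (\<lambda>vs. pb \<Psi> (pb \<Phi> \<omega>) x vs + wedge \<phi> \<psi> x vs)) = card J + 2"
      by (rule darboux_step[OF cl p'(1) J(2) lt dim])
    obtain p'' where p'': "p'' \<in> W" "p' = \<Psi> p''" using W(3) by blast
    note oW = paramD(1)[OF W(1)]
    let ?\<eta> = "\<lambda>x vs. pb \<Psi> (pb \<Phi> \<omega>) x vs + wedge \<phi> \<psi> x vs"
    have cl\<eta>: "closed_lform 2 W ?\<eta>"
      by (rule closed_lform_add[OF closed_lform_pb[OF cl W(1,2)] closed_lform_wedge[OF oW s]])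
    have "CARD('n) - (card J + 2) < CARD('n) - d" using lt J(1) by simp
    from less.hyps[OF this cl\<eta> p''(1) dimW]
    obtain V' \<Theta> m f g where T: "param V' \<Theta>" "\<Theta> ` V' \<subseteq> W" "p'' \<in> \<Theta> ` V'" "2 * m + (card J + 2) = CARD('n)"
      and fg: "\<forall>k<m. smooth_on (f k) V' \<and> smooth_on (g k) V'"
      and eq: "\<forall>x\<in>V'. \<forall>v w. pb \<Theta> ?\<eta> x [v, w] = (\<Sum>k<(m::nat). wedge (f k) (g k) x [v, w])"
      by blast
    \<comment> \<open>The two functions change places: \<open>d\<phi> \<and> d\<psi>\<close> was
      added to the form, so the form itself gets the opposite sign,
      \<open>d\<psi> \<and> d\<phi>\<close>.\<close>
    define f' where "f' = f(m := \<psi> \<circ> \<Theta>)"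
    define g' where "g' = g(m := \<phi> \<circ> \<Theta>)"
    have c: "param W (\<Phi> \<circ> \<Psi>)" "(\<Phi> \<circ> \<Psi>) ` W \<subseteq> U"
      using param_compose[OF P(1) W(1,2)] W(2) P(2) by auto
    have c': "param V' (\<Phi> \<circ> \<Psi> \<circ> \<Theta>)" "(\<Phi> \<circ> \<Psi> \<circ> \<Theta>) ` V' \<subseteq> U"
      using param_compose[OF c(1) T(1,2)] T(2) c(2) by auto
    have pb_eq: "pb (\<Phi> \<circ> \<Psi> \<circ> \<Theta>) \<omega> x vs = pb \<Theta> (pb \<Psi> (pb \<Phi> \<omega>)) x vs" if "x \<in> V'" for x vs
    proof -
      have "\<Theta> x \<in> W" using T(2) that by blast
      then have "pb \<Theta> (pb \<Psi> (pb \<Phi> \<omega>)) x vs = pb \<Theta> (pb (\<Phi> \<circ> \<Psi>) \<omega>) x vs"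
        unfolding pb_def[of \<Theta>] by (simp add: pb_compose[OF P(1) W(1,2)])
      then show ?thesis using pb_compose[OF c(1) T(1,2) that, of \<omega>] by simp
    qed
    have "pb (\<Phi> \<circ> \<Psi> \<circ> \<Theta>) \<omega> x [v, w] = (\<Sum>k<Suc m. wedge (f' k) (g' k) x [v, w])" if x: "x \<in> V'" for x v w
    proof -
      have "pb \<Theta> ?\<eta> x [v, w] = pb \<Theta> (pb \<Psi> (pb \<Phi> \<omega>)) x [v, w] + pb \<Theta> (wedge \<phi> \<psi>) x [v, w]"
        by (simp add: pb_def)
      moreover have "pb \<Theta> (wedge \<phi> \<psi>) x [v, w] = wedge (\<phi> \<circ> \<Theta>) (\<psi> \<circ> \<Theta>) x [v, w]"
        by (rule pb_wedge[OF T(1,2) s x]) simp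
      moreover have "wedge (\<phi> \<circ> \<Theta>) (\<psi> \<circ> \<Theta>) x [v, w] = - wedge (\<psi> \<circ> \<Theta>) (\<phi> \<circ> \<Theta>) x [v, w]"
        by (simp add: wedge_def)
      moreover have "(\<Sum>k<Suc m. wedge (f' k) (g' k) x [v, w]) =
          (\<Sum>k<m. wedge (f k) (g k) x [v, w]) + wedge (\<psi> \<circ> \<Theta>) (\<phi> \<circ> \<Theta>) x [v, w]"
        by (simp add: f'_def g'_def)
      ultimately show ?thesis using eq x pb_eq[OF x, of "[v, w]"] by simp
    qed
    moreover have "smooth_on (f' k) V' \<and> smooth_on (g' k) V'" if "k < Suc m" for k
      using fg that smooth_on_comp_param[OF T(1,2) oW s(1)] smooth_on_comp_param[OF T(1,2) oW s(2)]
      by (cases "k = m") (auto simp: f'_def g'_def)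
    moreover have "p \<in> (\<Phi> \<circ> \<Psi> \<circ> \<Theta>) ` V'" using T(3) p''(2) p'(2) by auto
    moreover have "2 * Suc m + d = CARD('n)" using T(4) J(1) by simp
    ultimately show ?thesis using c' by (intro exI[of _ V'] exI[of _ "\<Phi> \<circ> \<Psi> \<circ> \<Theta>"] exI[of _ "Suc m"]) blast
  qed
qed

text \<open>The given functions are completed to coordinates by linear functions on the common null
  space of their differentials at \<open>p\<close>. In these coordinates the differentials are fixed
  linear forms, so the components of \<open>\<omega>\<close> are constant.\<close>

lemma darboux_coordinates:
  fixes \<omega> :: "real ^ 'n \<Rightarrow> (real ^ 'n) list \<Rightarrow> real" and f g :: "nat \<Rightarrow> real ^ 'n \<Rightarrow> real"
  assumes U: "open U" "p \<in> U"
    and fg: "\<And>k. k < m \<Longrightarrow> smooth_on (f k) U" "\<And>k. k < m \<Longrightarrow> smooth_on (g k) U"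
    and eq: "\<And>x v w. x \<in> U \<Longrightarrow> \<omega> x [v, w] = (\<Sum>k<m. wedge (f k) (g k) x [v, w])"
    and dim: "2 * m + dim (kern 2 (\<omega> p)) = CARD('n)"
  obtains W \<Phi> where "param W \<Phi>" "\<Phi> ` W \<subseteq> U" "p \<in> \<Phi> ` W"
    "\<forall>x\<in>W. \<forall>y\<in>W. \<forall>v w. pb \<Phi> \<omega> x [v, w] = pb \<Phi> \<omega> y [v, w]"
proof -
  let ?D = "\<lambda>f x. frechet_derivative f (at x)"
  define h where "h k = (if k < m then f k else g (k - m))" for k
  have sh: "smooth_on (h k) U" if "k < 2 * m" for k using fg that by (simp add: h_def)
  define a where "a k = (\<chi> i. ?D (h k) p (ax i))" for k
  have Dh: "?D (h k) p v = a k \<bullet> v" if "k < 2 * m" for k v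
  proof -
    have lin: "linear (?D (h k) p)" by (rule linear_frechet[OF sh[OF that] U(2)])
    have "?D (h k) p v = ?D (h k) p (\<Sum>i\<in>UNIV. (v $ i) *\<^sub>R ax i)" by (simp add: vec_expansion)
    also have "\<dots> = (\<Sum>i\<in>UNIV. v $ i * ?D (h k) p (ax i))"
      by (simp add: linear_sum[OF lin] linear_cmul[OF lin])
    finally show ?thesis by (simp add: a_def inner_vec_def mult.commute)
  qed
  let ?S = "a ` {..<2 * m}"
  define T where "T = {y. \<forall>x\<in>span ?S. orthogonal x y}"
  have dimT: "dim T + dim ?S = CARD('n)"
    using dim_subspace_orthogonal_to_vectors[of "span ?S" "UNIV :: (real ^ 'n) set"] by (simp add: T_def dim_span)
  have Ta: "a k \<bullet> v = 0" if "v \<in> T" "k < 2 * m" for v k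
    using that by (auto simp: T_def orthogonal_def span_base)
  have "T \<subseteq> kern 2 (\<omega> p)"
  proof
    fix v assume v: "v \<in> T"
    have "?D (f k) p v = 0 \<and> ?D (g k) p v = 0" if "k < m" for k
      using Dh[of k v] Dh[of "m + k" v] Ta[OF v, of k] Ta[OF v, of "m + k"] that by (simp add: h_def)
    then show "v \<in> kern 2 (\<omega> p)" by (simp add: kern_2 eq[OF U(2)] wedge_def)
  qed
  then have "dim T \<le> dim (kern 2 (\<omega> p))" by (rule dim_subset)
  \<comment> \<open>The null space \<open>T\<close> of the differentials lies in the kernel of
    \<open>\<omega> p\<close>, whose dimension is \<open>CARD('n) - 2 * m\<close>. So the
    \<open>2 * m\<close> gradients span at least \<open>2 * m\<close> dimensions and must be
    independent.\<close>
  then have "2 * m \<le> dim ?S" using dimT dim by linarith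
  moreover have "dim ?S \<le> card ?S" by (rule dim_le_card') simp
  moreover have "card ?S \<le> 2 * m" using card_image_le[of "{..<2 * m}" a] by simp
  ultimately have card: "card ?S = 2 * m" "dim ?S = 2 * m" by linarith+
  have inj_a: "inj_on a {..<2 * m}" by (rule eq_card_imp_inj_on) (simp_all add: card)
  have indep: "independent ?S"
    by (rule card_le_dim_spanning[of _ "span ?S"]) (auto simp: span_superset card dim_span)
  have subT: "subspace T"
    unfolding T_def by (rule subspace_orthogonal_to_vectors)
  obtain C where C: "C \<subseteq> T" "pairwise orthogonal C" "\<And>x. x \<in> C \<Longrightarrow> norm x = 1" "independent C" "span C = T"
    using orthonormal_basis_subspace[OF subT] by metis
  have finC: "finite C" using C(4) by (rule independent_imp_finite)
  define \<pi> where "\<pi> v = (\<Sum>c\<in>C. (v \<bullet> c) *\<^sub>R c)" for v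
  have lin\<pi>: "linear \<pi>" unfolding \<pi>_def
    by (intro linearI) (simp_all add: inner_add_left scaleR_add_left sum.distrib scaleR_sum_right)
  have \<pi>T: "\<pi> v = v" if "v \<in> T" for v
    unfolding \<pi>_def by (rule orthonormal_basis_expand[OF C(2,3) _ finC]) (use C(5) that in auto)
  have \<pi>_in: "\<pi> v \<in> T" for v
    unfolding \<pi>_def C(5)[symmetric] by (intro span_sum span_scale span_base)
  have \<pi>a: "\<pi> (a k) = 0" if "k < 2 * m" for k
    unfolding \<pi>_def using Ta[OF _ that] C(1) by (intro sum.neutral) auto
  have "\<exists>B. linear B \<and> (\<forall>x\<in>?S. B x = (if x = a k then 1 else 0 :: real))" for k
    by (rule linear_independent_extend[OF indep])
  then have "\<forall>k. \<exists>B. linear B \<and> (\<forall>x\<in>?S. B x = (if x = a k then 1 else 0 :: real))" by blast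
  from choice[OF this] obtain B where B: "\<And>k. linear (B k)" "\<And>k x. x \<in> ?S \<Longrightarrow> B k x = (if x = a k then 1 else 0 :: real)"
    by blast
  \<comment> \<open>The functional \<open>B k\<close> is prescribed on the gradients only; removing
    the part in \<open>T\<close> makes \<open>b k\<close> vanish there. Thus \<open>b\<close> is
    dual to \<open>a\<close> and recovers \<open>d (h k)\<close> from the derivative of
    \<open>\<Psi>\<close>.\<close>
  define b where "b k v = B k (v - \<pi> v)" for k v
  have linb: "linear (b k)" for k
    unfolding b_def using linear_compose[OF linear_compose_sub[OF linear_id lin\<pi>] B(1)[of k]] by (simp add: comp_def id_def)
  have b\<pi>: "b k (\<pi> v) = 0" for k v
    using linear_0[OF B(1)[of k]] by (simp add: b_def \<pi>T[OF \<pi>_in])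
  have ba: "b k (a j) = (if j = k then 1 else 0)" if "j < 2 * m" "k < 2 * m" for j k
    using B(2)[of "a j" k] inj_onD[OF inj_a, of j k] that by (auto simp: b_def \<pi>a)
  \<comment> \<open>The gradients \<open>a k\<close> at \<open>p\<close> serve as fixed vectors
    carrying the functions \<open>h k\<close>, and \<open>\<pi>\<close> supplies the complementary
    directions in \<open>T\<close>.\<close>
  define \<Psi> where "\<Psi> x = (\<Sum>k<2 * m. h k x *\<^sub>R a k) + \<pi> x" for x
  have s\<pi>: "smooth_on \<pi> U"
    using smooth_on_bounded_linear[OF linear_conv_bounded_linear[THEN iffD1, OF lin\<pi>] U(1) smooth_on_ident[OF U(1)]] .
  have s\<Psi>: "smooth_on \<Psi> U"
    unfolding \<Psi>_def[abs_def]
    by (intro smooth_on_add smooth_on_sum smooth_on_scaleR smooth_on_const s\<pi> U(1)) (auto intro: sh)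
  have d\<Psi>: "?D \<Psi> x v = (\<Sum>k<2 * m. ?D (h k) x v *\<^sub>R a k) + \<pi> v" if x: "x \<in> U" for x v
  proof -
    have "(\<Psi> has_derivative (\<lambda>v. (\<Sum>k<2 * m. ?D (h k) x v *\<^sub>R a k) + \<pi> v)) (at x)"
      unfolding \<Psi>_def[abs_def]
      by (intro has_derivative_add has_derivative_sum has_derivative_scaleR_left linear_imp_has_derivative lin\<pi>)
        (rule smooth_on_deriv(1)[OF sh x], simp)
    from fun_cong[OF frechet_derivative_at[OF this], of v] show ?thesis by (rule sym)
  qed
  have b\<Psi>: "b k (?D \<Psi> x v) = ?D (h k) x v" if "x \<in> U" "k < 2 * m" for x v k
  proof -
    have "b k (?D \<Psi> x v) = (\<Sum>j<2 * m. ?D (h j) x v * b k (a j)) + b k (\<pi> v)"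
      unfolding d\<Psi>[OF that(1)] by (simp add: linear_add[OF linb] linear_sum[OF linb] linear_cmul[OF linb])
    also have "\<dots> = (\<Sum>j<2 * m. if j = k then ?D (h j) x v else 0)"
      unfolding b\<pi> add_0_right by (intro sum.cong refl) (simp add: ba that(2))
    also have "\<dots> = ?D (h k) x v" using that(2) by simp
    finally show ?thesis .
  qed
  have "inj (?D \<Psi> p)"
  proof (rule linear_injective_0[OF linear_frechet[OF s\<Psi> U(2)], THEN iffD2], intro allI impI)
    fix v assume v: "?D \<Psi> p v = 0"
    have "?D (h k) p v = 0" if "k < 2 * m" for k
      using b\<Psi>[OF U(2) that, of v] v linear_0[OF linb] by simp
    then have av: "a k \<bullet> v = 0" if "k < 2 * m" for k using Dh[OF that, of v] that by simp
    have "\<pi> v = 0" using v d\<Psi>[OF U(2), of v] Dh av by simp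
    moreover have "v \<in> T"
    proof -
      have "orthogonal v x" if "x \<in> span ?S" for x
        by (rule orthogonal_to_span[OF that]) (auto simp: orthogonal_def inner_commute[of v] av)
      then show ?thesis by (auto simp: T_def orthogonal_commute)
    qed
    ultimately show "v = 0" using \<pi>T by simp
  qed
  then obtain W \<Phi> where W: "param W \<Phi>" "p \<in> \<Phi> ` W" "\<Phi> ` W \<subseteq> U"
    and inv: "\<forall>y\<in>W. inj (?D \<Psi> (\<Phi> y)) \<and> (\<forall>v. ?D \<Psi> (\<Phi> y) (?D \<Phi> y v) = v)"
    by (rule param_of_coordinates[OF U s\<Psi>])
  have const: "pb \<Phi> \<omega> y [v, w] = (\<Sum>k<m. b k v * b (m + k) w - b k w * b (m + k) v)" if y: "y \<in> W" for y v w
  proof -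
    have \<Phi>y: "\<Phi> y \<in> U" using W(3) y by blast
    have "?D (f k) (\<Phi> y) (?D \<Phi> y u) = b k u" "?D (g k) (\<Phi> y) (?D \<Phi> y u) = b (m + k) u" if "k < m" for k u
      using b\<Psi>[OF \<Phi>y, of k "?D \<Phi> y u"] b\<Psi>[OF \<Phi>y, of "m + k" "?D \<Phi> y u"] inv y that by (simp_all add: h_def)
    then show ?thesis by (simp add: pb_def eq[OF \<Phi>y] wedge_def)
  qed
  show ?thesis by (rule that[OF W(1,3,2)]) (simp add: const)
qed

lemma darboux_normal_form:
  fixes \<omega> :: "real ^ 'n \<Rightarrow> (real ^ 'n) list \<Rightarrow> real"
  assumes \<omega>: "closed_lform 2 U \<omega>" and p: "p \<in> U" and dim: "\<forall>x\<in>U. dim (kern 2 (\<omega> x)) = d"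
  obtains W \<Phi> where "param W \<Phi>" "\<Phi> ` W \<subseteq> U" "p \<in> \<Phi> ` W"
    "\<forall>x\<in>W. \<forall>y\<in>W. \<forall>is. length is = 2 \<longrightarrow> pb \<Phi> \<omega> x (map ax is) = pb \<Phi> \<omega> y (map ax is)"
proof -
  obtain V \<Phi> m f g where P: "param V \<Phi>" "\<Phi> ` V \<subseteq> U" "p \<in> \<Phi> ` V" and m: "2 * m + d = CARD('n)"
    and fg: "\<forall>k<m. smooth_on (f k) V \<and> smooth_on (g k) V"
    and eq: "\<forall>x\<in>V. \<forall>v w. pb \<Phi> \<omega> x [v, w] = (\<Sum>k<(m::nat). wedge (f k) (g k) x [v, w])"
    using darboux_functions[OF assms] by blast
  obtain p' where p': "p' \<in> V" "p = \<Phi> p'" using P(3) by blast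
  have "dim (kern 2 (pb \<Phi> \<omega> p')) = d" using kern_pb(2)[OF P(1) p'(1)] dim p p'(2) by simp
  then have m': "2 * m + dim (kern 2 (pb \<Phi> \<omega> p')) = CARD('n)" using m by simp
  have f': "smooth_on (f k) V" and g': "smooth_on (g k) V" if "k < m" for k
    using fg that by blast+
  have eq': "pb \<Phi> \<omega> x [v, w] = (\<Sum>k<m. wedge (f k) (g k) x [v, w])" if "x \<in> V" for x v w
    using eq that by blast
  obtain W \<Theta> where W: "param W \<Theta>" "\<Theta> ` W \<subseteq> V" "p' \<in> \<Theta> ` W"
    and const: "\<forall>x\<in>W. \<forall>y\<in>W. \<forall>v w. pb \<Theta> (pb \<Phi> \<omega>) x [v, w] = pb \<Theta> (pb \<Phi> \<omega>) y [v, w]"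
    by (rule darboux_coordinates[OF paramD(1)[OF P(1)] p'(1) f' g' eq' m'])
  show ?thesis
  proof (rule that[of W "\<Phi> \<circ> \<Theta>"])
    show "param W (\<Phi> \<circ> \<Theta>)" by (rule param_compose[OF P(1) W(1,2)])
    show "(\<Phi> \<circ> \<Theta>) ` W \<subseteq> U" using W(2) P(2) by auto
    show "p \<in> (\<Phi> \<circ> \<Theta>) ` W" using W(3) p'(2) by auto
    show "\<forall>x\<in>W. \<forall>y\<in>W. \<forall>is. length is = 2 \<longrightarrow>
        pb (\<Phi> \<circ> \<Theta>) \<omega> x (map ax is) = pb (\<Phi> \<circ> \<Theta>) \<omega> y (map ax is)"
    proof (intro ballI allI impI)
      fix x y "is" assume x: "x \<in> W" and y: "y \<in> W" and "length (is :: 'n list) = 2"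
      then obtain i j where ij: "map ax is = [ax i, ax j]" by (auto simp: numeral_2_eq_2 length_Suc_conv)
      show "pb (\<Phi> \<circ> \<Theta>) \<omega> x (map ax is) = pb (\<Phi> \<circ> \<Theta>) \<omega> y (map ax is)"
        unfolding ij pb_compose[OF P(1) W(1,2) x, symmetric] pb_compose[OF P(1) W(1,2) y, symmetric]
        using const x y by blast
    qed
  qed
qed

text \<open>Outside degree 2 the form is either zero, when \<open>d = CARD('n)\<close>, or nonzero
  everywhere with \<open>d + q = CARD('n)\<close>, so that it has top degree in the directions
  transversal to the kernel.\<close>

lemma local_normal_form:
  fixes \<omega> :: "real ^ 'n \<Rightarrow> (real ^ 'n) list \<Rightarrow> real"
  assumes \<omega>: "closed_lform q U \<omega>" and p: "p \<in> U" and dim: "\<forall>x\<in>U. dim (kern q (\<omega> x)) = d"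
    and q: "0 < q" "q \<in> {0, 1, 2, CARD('n) - 1, CARD('n)}"
  obtains W \<Phi> where "param W \<Phi>" "\<Phi> ` W \<subseteq> U" "p \<in> \<Phi> ` W"
    "\<forall>x\<in>W. \<forall>y\<in>W. \<forall>is. length is = q \<longrightarrow> pb \<Phi> \<omega> x (map ax is) = pb \<Phi> \<omega> y (map ax is)"
proof (cases "q = 2")
  case True
  then show ?thesis using darboux_normal_form[OF _ p, of \<omega> d] \<omega> dim that by blast
next
  case q2: False
  note alt = closed_lformD(2)[OF \<omega>]
  show ?thesis
  proof (cases "d = CARD('n)")
    case True
    have "\<omega> x vs = 0" if "x \<in> U" "length vs = q" for x vs
    proof -
      have "kern q (\<omega> x) = UNIV"
        using subspace_dim_equal[OF subspace_kern[OF alt[OF that(1)]] subspace_UNIV subset_UNIV] dim that(1) True by simp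
      then show ?thesis using kernD[of "hd vs" q "\<omega> x" "tl vs"] that(2) q(1) by (cases vs) auto
    qed
    then show ?thesis using p
      by (intro that[OF param_id[OF closed_lformD(1)[OF \<omega>]]]) auto
  next
    case False

    obtain V \<Phi> J where P: "param V \<Phi>" "\<Phi> ` V \<subseteq> U" "p \<in> \<Phi> ` V" and J: "card J = d"
      "\<forall>x\<in>V. \<forall>j\<in>J. ax j \<in> kern q (pb \<Phi> \<omega> x)"
      by (rule kernel_straightening[OF \<omega> p dim[THEN bspec]])
    obtain p' where p': "p' \<in> V" "p = \<Phi> p'" using P(3) by blast
    note cl = closed_lform_pb[OF \<omega> P(1,2)]
    have dim': "dim (kern q (pb \<Phi> \<omega> x)) = d" if "x \<in> V" for x
      using kern_pb(2)[OF P(1) that] dim P(2) that by auto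
    have nz': "\<exists>vs. length vs = q \<and> pb \<Phi> \<omega> x vs \<noteq> 0" if "x \<in> V" for x
    proof (rule ccontr)
      assume "\<not> ?thesis"
      then have "kern q (pb \<Phi> \<omega> x) = UNIV" by (auto simp: kern_def)
      then show False using dim'[OF that] False by simp
    qed
    obtain vs where vs: "length vs = q" "pb \<Phi> \<omega> p' vs \<noteq> 0" using nz'[OF p'(1)] by blast
    note altp = closed_lformD(2)[OF cl p'(1)]
    \<comment> \<open>The indices of a nonzero component are distinct and avoid \<open>J\<close>,
      because a kernel vector among the arguments gives 0; this yields
      \<open>d + q \<le> CARD('n)\<close>.\<close>
    obtain js where js: "length js = q" "pb \<Phi> \<omega> p' (map ax js) \<noteq> 0"
      using altf_eq_0I[OF altp _ vs(1)] vs(2) by blast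
    have "distinct js" using altfD(2)[OF altp, of "map ax js"] js by (auto simp: distinct_map)
    moreover have "set js \<subseteq> - J"
    proof
      fix j assume "j \<in> set js"
      then show "j \<in> - J" using kern_in_set[OF altp, of "ax j" "map ax js"] J(2) p'(1) js by auto
    qed
    ultimately have "q \<le> card (- J)" using distinct_card[of js] js(1) card_mono[of "- J" "set js"] by simp
    moreover have "card (- J) = CARD('n) - d" using J(1) by (simp add: Compl_eq_Diff_UNIV card_Diff_subset)
    ultimately have le: "d + q \<le> CARD('n)" using q(1) by linarith
    \<comment> \<open>This inequality depends on the degree: the kernel of a nonzero 1-form is a
      hyperplane, and in degree n - 1 the kernel is at least a line.\<close>
    have "CARD('n) \<le> d + q"
    proof -
      consider "q = 1" | "q = CARD('n)" | "Suc q = CARD('n)" using q q2 by auto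
      then show ?thesis
      proof cases
        case 1
        then obtain u where "vs = [u]" using vs(1) by (auto simp: length_Suc_conv)
        then show ?thesis using kern_1_dim[of "pb \<Phi> \<omega> p'" u] altp vs(2) dim'[OF p'(1)] 1 by simp
      next
        case 2
        then show ?thesis by simp
      next
        case 3
        then show ?thesis using kern_codim_1_nontrivial[OF altp 3 q(1) vs] dim'[OF p'(1)] by simp
      qed
    qed
    with le have cardJ: "card J + q = CARD('n)" using J(1) by simp
    obtain W \<Theta> where W: "param W \<Theta>" "\<Theta> ` W \<subseteq> V" "p' \<in> \<Theta> ` W"
      and const: "\<forall>x\<in>W. \<forall>y\<in>W. \<forall>is. length is = q \<longrightarrow>
        pb \<Theta> (pb \<Phi> \<omega>) x (map ax is) = pb \<Theta> (pb \<Phi> \<omega>) y (map ax is)"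
      by (rule volume_normal_form[OF cl p'(1) J(2) cardJ q(1)]) (use nz' in blast)+
    show ?thesis
    proof (rule that[of W "\<Phi> \<circ> \<Theta>"])
      show "param W (\<Phi> \<circ> \<Theta>)" by (rule param_compose[OF P(1) W(1,2)])
      show "(\<Phi> \<circ> \<Theta>) ` W \<subseteq> U" using W(2) P(2) by auto
      show "p \<in> (\<Phi> \<circ> \<Theta>) ` W" using W(3) p'(2) by auto
      show "\<forall>x\<in>W. \<forall>y\<in>W. \<forall>is. length is = q \<longrightarrow>
          pb (\<Phi> \<circ> \<Theta>) \<omega> x (map ax is) = pb (\<Phi> \<circ> \<Theta>) \<omega> y (map ax is)"
      proof (intro ballI allI impI)
        fix x y "is" assume x: "x \<in> W" and y: "y \<in> W" and len: "length (is :: 'n list) = q"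
        show "pb (\<Phi> \<circ> \<Theta>) \<omega> x (map ax is) = pb (\<Phi> \<circ> \<Theta>) \<omega> y (map ax is)"
          unfolding pb_compose[OF P(1) W(1,2) x, symmetric] pb_compose[OF P(1) W(1,2) y, symmetric]
          using const x y len by blast
      qed
    qed
  qed
qed

section \<open>Transfer to manifolds\<close>

lemma chart_map_inv:
  assumes "u \<in> chart_map c ` chart_dom c"
  shows "chart_map c (chart_inv c u) = u" "chart_inv c u \<in> chart_dom c"
  using f_inv_into_f[OF assms] inv_into_into[OF assms] by (simp_all add: chart_inv_def)

text \<open>The chart with inverse \<open>chart_inv c \<circ> \<Phi>\<close>; its domain shrinks to
  the part of \<open>c\<close> that \<open>\<Phi>\<close> reaches.\<close>

definition param_chart :: "('a, 'n::finite) chart \<Rightarrow> (real ^ 'n) set \<Rightarrow> (real ^ 'n \<Rightarrow> real ^ 'n) \<Rightarrow> ('a, 'n) chart"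
  where "param_chart c V \<Phi> = ({x \<in> chart_dom c. chart_map c x \<in> \<Phi> ` V}, inv_into V \<Phi> \<circ> chart_map c)"

locale chart_param =
  fixes X :: "'a topology" and A :: "('a, 'n::finite) chart set" and c :: "('a, 'n) chart"
    and V :: "(real ^ 'n) set" and \<Phi> :: "real ^ 'n \<Rightarrow> real ^ 'n"
  assumes S: "smooth_structure X A" and c: "c \<in> A"
    and P: "param V \<Phi>" and im: "\<Phi> ` V \<subseteq> chart_map c ` chart_dom c"
begin

abbreviation c' :: "('a, 'n) chart" where "c' \<equiv> param_chart c V \<Phi>"

lemma chart_c: "is_chart X c"
  by (rule smooth_structure_chart[OF S c])

lemma inv_\<Phi> [simp]: "u \<in> V \<Longrightarrow> inv_into V \<Phi> (\<Phi> u) = u"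
  using paramD(3)[OF P] by simp

lemma dom_c': "x \<in> chart_dom c' \<longleftrightarrow> x \<in> chart_dom c \<and> chart_map c x \<in> \<Phi> ` V"
  by (simp add: param_chart_def)

lemma map_c': "chart_map c' x = inv_into V \<Phi> (chart_map c x)"
  by (simp add: param_chart_def)

lemma point:
  assumes "u \<in> V"
  shows "chart_inv c (\<Phi> u) \<in> chart_dom c'" "chart_map c' (chart_inv c (\<Phi> u)) = u"
    "chart_map c (chart_inv c (\<Phi> u)) = \<Phi> u"
proof -
  have "\<Phi> u \<in> chart_map c ` chart_dom c" using im assms by blast
  then show "chart_inv c (\<Phi> u) \<in> chart_dom c'" "chart_map c' (chart_inv c (\<Phi> u)) = u"
    "chart_map c (chart_inv c (\<Phi> u)) = \<Phi> u"
    using assms by (simp_all add: dom_c' map_c' chart_map_inv)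
qed

lemma map_c'_in: "x \<in> chart_dom c' \<Longrightarrow> chart_map c' x \<in> V \<and> \<Phi> (chart_map c' x) = chart_map c x"
  unfolding dom_c' map_c' by (auto simp: f_inv_into_f inv_into_into)

lemma image_c': "chart_map c' ` chart_dom c' = V"
proof
  show "chart_map c' ` chart_dom c' \<subseteq> V" using map_c'_in by blast
  show "V \<subseteq> chart_map c' ` chart_dom c'"
  proof
    fix u assume "u \<in> V"
    from point[OF this] show "u \<in> chart_map c' ` chart_dom c'" by (metis imageI)
  qed
qed

lemma open_image: "open (\<Phi> ` V)"
  by (rule param_open_image[OF P paramD(1)[OF P] subset_refl])

lemma is_chart_c': "is_chart X c'"
  unfolding is_chart_def image_c'
proof (intro conjI)
  let ?T = "top_of_set (chart_map c ` chart_dom c)"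
  have hom: "homeomorphic_map (subtopology X (chart_dom c)) ?T (chart_map c)" and op: "openin X (chart_dom c)"
    using chart_c by (simp_all add: is_chart_def)
  have top: "topspace (subtopology X (chart_dom c)) = chart_dom c"
    using openin_subset[OF op] by (simp add: Int_absorb1)
  have "openin ?T (\<Phi> ` V)"
    using open_image im by (metis inf.absorb_iff2 openin_open_Int)
  from openin_continuous_map_preimage[OF homeomorphic_imp_continuous_map[OF hom] this]
  have "openin (subtopology X (chart_dom c)) {x \<in> chart_dom c. chart_map c x \<in> \<Phi> ` V}"
    unfolding top .
  then have "openin X {x \<in> chart_dom c. chart_map c x \<in> \<Phi> ` V}"
    using op by (rule openin_trans_full)
  then show "openin X (chart_dom c')" by (simp add: param_chart_def)
  show "open V" by (rule paramD(1)[OF P])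
  have img: "chart_map c ` (chart_dom c \<inter> chart_dom c') = chart_map c ` chart_dom c \<inter> \<Phi> ` V"
    using im by (auto simp: dom_c')
  have "homeomorphic_map (subtopology (subtopology X (chart_dom c)) (chart_dom c'))
      (subtopology ?T (\<Phi> ` V)) (chart_map c)"
    by (rule homeomorphic_map_subtopologies[OF hom]) (simp only: top img topspace_euclidean_subtopology)
  moreover have "chart_dom c \<inter> chart_dom c' = chart_dom c'" by (auto simp: dom_c')
  moreover have "chart_map c ` chart_dom c \<inter> \<Phi> ` V = \<Phi> ` V" using im by blast
  ultimately have 1: "homeomorphic_map (subtopology X (chart_dom c')) (top_of_set (\<Phi> ` V)) (chart_map c)"
    by (simp add: subtopology_subtopology)
  have "homeomorphic_maps (top_of_set (\<Phi> ` V)) (top_of_set V) (inv_into V \<Phi>) \<Phi>"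
    unfolding homeomorphic_maps_def
    using smooth_on_continuous[OF paramD(2)[OF P]] smooth_on_continuous[OF paramD(2)[OF param_inverse(1)[OF P]]]
    by auto
  then have 2: "homeomorphic_map (top_of_set (\<Phi> ` V)) (top_of_set V) (inv_into V \<Phi>)"
    by (rule homeomorphic_maps_imp_map)
  show "homeomorphic_map (subtopology X (chart_dom c')) (top_of_set V) (chart_map c')"
    using homeomorphic_map_compose[OF 1 2] by (simp add: param_chart_def)
qed

lemma inv_c': "u \<in> V \<Longrightarrow> chart_inv c' u = chart_inv c (\<Phi> u)"
  using chart_inv_map[OF is_chart_c' point(1)] point(2) by metis

lemma compatible_c':
  assumes d: "d \<in> A"
  shows "compatible c' d"
proof -
  have ch: "is_chart X d" by (rule smooth_structure_chart[OF S d])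
  have comp: "smooth_on (transition c d) (chart_map c ` (chart_dom c \<inter> chart_dom d))"
    "smooth_on (transition d c) (chart_map d ` (chart_dom c \<inter> chart_dom d))"
    using smooth_structure_compatible[OF S c d] by (simp_all add: compatible_def)
  have o1: "open (chart_map c' ` (chart_dom c' \<inter> chart_dom d))"
    using open_chart_image[OF is_chart_c'] ch by (simp add: is_chart_def)
  have o2: "open (chart_map d ` (chart_dom d \<inter> chart_dom c'))"
    using open_chart_image[OF ch] is_chart_c' by (simp add: is_chart_def)
  have o3: "open (chart_map c ` (chart_dom c \<inter> chart_dom d))"
    using open_chart_image[OF chart_c] ch by (simp add: is_chart_def)
  let ?W = "chart_map c' ` (chart_dom c' \<inter> chart_dom d)"
  have W: "?W \<subseteq> V" "\<Phi> ` ?W \<subseteq> chart_map c ` (chart_dom c \<inter> chart_dom d)"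
    using map_c'_in by (auto simp: dom_c')
  have "smooth_on (\<lambda>u. transition c d (\<Phi> u)) ?W"
    by (rule smooth_on_compose[OF o1 o3 comp(1) smooth_on_subset[OF paramD(2)[OF P] W(1)] W(2)])
  then have 1: "smooth_on (transition c' d) ?W"
    by (rule smooth_on_cong[OF o1, rotated]) (use W(1) in \<open>auto simp: transition_def inv_c'\<close>)
  let ?Z = "chart_map d ` (chart_dom d \<inter> chart_dom c')"
  have Z: "?Z \<subseteq> chart_map d ` (chart_dom c \<inter> chart_dom d)" by (auto simp: dom_c')
  have Z': "transition d c ` ?Z \<subseteq> \<Phi> ` V"
    using chart_inv_map[OF ch] by (auto simp: transition_def dom_c')
  have "smooth_on (\<lambda>u. inv_into V \<Phi> (transition d c u)) ?Z"
    by (rule smooth_on_compose[OF o2 open_image paramD(2)[OF param_inverse(1)[OF P]] smooth_on_subset[OF comp(2) Z] Z'])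
  then have 2: "smooth_on (transition d c') ?Z"
    by (simp add: transition_def param_chart_def comp_def)
  show ?thesis unfolding compatible_def using 1 2 by (simp add: Int_commute)
qed

text \<open>Maximality of the atlas turns a parametrization of a coordinate domain into a coordinate
  system of the manifold.\<close>

lemma c'_in_A: "c' \<in> A"
proof -
  have "\<forall>c. is_chart X c \<and> (\<forall>d\<in>A. compatible c d) \<longrightarrow> c \<in> A"
    using S unfolding smooth_structure_def by (elim conjE)
  then show ?thesis using is_chart_c' compatible_c' by blast
qed

text \<open>The transition from \<open>c'\<close> to \<open>c\<close> is \<open>\<Phi>\<close>, so
  by the cocycle rule the vector with components \<open>w\<close> in \<open>c'\<close> has
  components \<open>D \<Phi> w\<close> in \<open>c\<close>.\<close>

lemma local_form_c':
  assumes u: "u \<in> V"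
  shows "local_form A \<zeta> c' u = pb \<Phi> (local_form A \<zeta> c) u"
proof -
  let ?x = "chart_inv c (\<Phi> u)"
  have "?x \<in> chart_dom c" using point(1)[OF u] by (simp add: dom_c')
  then have at: "c \<in> charts_at A ?x" "c' \<in> charts_at A ?x"
    using c c'_in_A point(1)[OF u] by (simp_all add: charts_at_def)
  have "frechet_derivative (transition c' c) (at u) = frechet_derivative \<Phi> (at u)"
  proof (rule frechet_derivative_cong[OF paramD(1)[OF P] u])
    show "transition c' c y = \<Phi> y" if "y \<in> V" for y
      using point(3)[OF that] by (simp add: transition_def inv_c' that)
  qed
  note D = this
  have "tangent_of A c' ?x = tangent_of A c ?x \<circ> frechet_derivative \<Phi> (at u)"
  proof (intro ext)
    fix w d
    show "tangent_of A c' ?x w d = (tangent_of A c ?x \<circ> frechet_derivative \<Phi> (at u)) w d"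
      using transition_cocycle[OF S at(2,1), of d] point[OF u] D by (cases "d \<in> charts_at A ?x") (simp_all add: tangent_of_def)
  qed
  then show ?thesis unfolding local_form_def[abs_def] pb_def[abs_def] inv_c'[OF u] map_map[symmetric] by simp
qed

end

section \<open>The form read in a chart\<close>

lemma component_local_form:
  assumes "u \<in> chart_map c ` chart_dom c"
  shows "component A \<zeta> c is (chart_inv c u) = local_form A \<zeta> c u (map ax is)"
  by (simp add: component_def local_form_def coord_vector_def[abs_def] comp_def)

lemma tangent_of_lincomb:
  assumes S: "smooth_structure X A" and c: "c \<in> charts_at A x"
  shows "tangent_of A c x (s *\<^sub>R v + t *\<^sub>R w) = tlincomb s (tangent_of A c x v) t (tangent_of A c x w)"
proof
  fix d
  show "tangent_of A c x (s *\<^sub>R v + t *\<^sub>R w) d = tlincomb s (tangent_of A c x v) t (tangent_of A c x w) d"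
  proof (cases "d \<in> charts_at A x")
    case True
    have "linear (frechet_derivative (transition c d) (at (chart_map c x)))"
      by (rule linear_frechet_derivative[OF transition_differentiable[OF S c True]])
    then show ?thesis using True by (simp add: tangent_of_def tlincomb_def linear_add linear_cmul)
  qed (simp add: tangent_of_def tlincomb_def)
qed

lemma tangent_of_in:
  assumes "smooth_structure X A" "c \<in> charts_at A x"
  shows "tangent_of A c x w \<in> tangent_space A x"
  using bij_betw_imp_surj_on[OF tangent_of_bij[OF assms]] by blast

lemma altf_local_form:
  assumes S: "smooth_structure X A" and c: "c \<in> charts_at A x" and alt: "alternating_at A q x (\<zeta> x)"
  shows "altf q (\<lambda>ws. \<zeta> x (map (tangent_of A c x) ws))"
  unfolding altf_def
proof (intro conjI allI impI)
  let ?T = "tangent_of A c x"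
  have tl: "map ?T ws \<in> tangent_lists A q x" if "length ws = q" for ws
    using that tangent_of_in[OF S c] by (auto simp: tangent_lists_def)
  fix xs ys :: "(real ^ 'b) list" and v v' s t assume len: "Suc (length xs + length ys) = q"
  have "\<forall>vs\<in>tangent_lists A q x. \<forall>i<q. \<forall>v\<in>tangent_space A x. \<forall>w\<in>tangent_space A x. \<forall>s t.
      \<zeta> x (vs[i := tlincomb s v t w]) = s * \<zeta> x (vs[i := v]) + t * \<zeta> x (vs[i := w])"
    using alt unfolding alternating_at_def by (elim conjE)
  from bspec[OF this tl[of "xs @ v # ys"]]
  have "\<zeta> x ((map ?T (xs @ v # ys))[length xs := tlincomb s (?T v) t (?T v')]) =
      s * \<zeta> x ((map ?T (xs @ v # ys))[length xs := ?T v]) + t * \<zeta> x ((map ?T (xs @ v # ys))[length xs := ?T v'])"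
    using len tangent_of_in[OF S c] by simp
  then show "\<zeta> x (map ?T (xs @ (s *\<^sub>R v + t *\<^sub>R v') # ys)) =
      s * \<zeta> x (map ?T (xs @ v # ys)) + t * \<zeta> x (map ?T (xs @ v' # ys))"
    by (simp add: tangent_of_lincomb[OF S c] list_update_append)
next
  let ?T = "tangent_of A c x"
  fix vs :: "(real ^ 'b) list" assume vs: "length vs = q" "\<not> distinct vs"
  then obtain i j where ij: "i < q" "j < q" "i \<noteq> j" "vs ! i = vs ! j" by (auto simp: distinct_conv_nth)
  have mem: "map ?T vs \<in> tangent_lists A q x"
    using vs tangent_of_in[OF S c] by (auto simp: tangent_lists_def)
  have "\<forall>vs\<in>tangent_lists A q x. \<forall>i<q. \<forall>j<q. i \<noteq> j \<and> vs ! i = vs ! j \<longrightarrow> \<zeta> x vs = 0"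
    using alt unfolding alternating_at_def by (elim conjE)
  from bspec[OF this mem] show "\<zeta> x (map ?T vs) = 0"
    using ij vs(1) by auto
qed

text \<open>Every parametrization of the coordinate domain is a chart of the maximal atlas, and
  smoothness and closedness of \<open>\<zeta>\<close> are given in all of its charts.\<close>

lemma closed_lform_local_form:
  assumes S: "smooth_structure X A" and c: "c \<in> A"
    and form: "differential_form X A q \<zeta>" and closed: "closed_form X A q \<zeta>"
  shows "closed_lform q (chart_map c ` chart_dom c) (local_form A \<zeta> c)"
  unfolding closed_lform_def
proof (intro conjI ballI allI impI; (elim conjE)?)
  have ch: "is_chart X c" by (rule smooth_structure_chart[OF S c])
  then show "open (chart_map c ` chart_dom c)" by (simp add: is_chart_def)
  show "altf q (local_form A \<zeta> c u)" if u: "u \<in> chart_map c ` chart_dom c" for u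
  proof -
    have "c \<in> charts_at A (chart_inv c u)" using c chart_map_inv(2)[OF u] by (simp add: charts_at_def)
    moreover have "chart_inv c u \<in> topspace X"
      using chart_map_inv(2)[OF u] ch openin_subset unfolding is_chart_def by blast
    ultimately show ?thesis
      using altf_local_form[OF S] form unfolding differential_form_def local_form_def[abs_def] by blast
  qed
  fix V \<Phi> assume P: "param V \<Phi>" "\<Phi> ` V \<subseteq> chart_map c ` chart_dom c"
  interpret chart_param X A c V \<Phi> by (rule chart_param.intro[OF S c P])
  note oV = paramD(1)[OF P(1)]
  show "smooth_on (\<lambda>u. pb \<Phi> (local_form A \<zeta> c) u (map ax is)) V" if len: "length is = q" for "is"
  proof -
    have "\<forall>c\<in>A. \<forall>is. length is = q \<longrightarrow>
        smooth_on (component A \<zeta> c is \<circ> chart_inv c) (chart_map c ` chart_dom c)"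
      using form unfolding differential_form_def by (elim conjE)
    from bspec[OF this c'_in_A] len have "smooth_on (component A \<zeta> c' is \<circ> chart_inv c') V"
      unfolding image_c' by blast
    then show ?thesis
      by (rule smooth_on_cong[OF oV, rotated]) (simp add: component_local_form image_c' local_form_c')
  qed
  show "euclidean_d (pb \<Phi> (local_form A \<zeta> c)) u (map ax is) = 0" if u: "u \<in> V" and len: "length is = Suc q" for u "is"
  proof -
    have "\<forall>c\<in>A. \<forall>u\<in>chart_map c ` chart_dom c. \<forall>ws. length ws = Suc q \<longrightarrow>
        local_form A (\<lambda>x vs. 0) c u ws = euclidean_d (local_form A \<zeta> c) u ws"
      using closed unfolding closed_form_def is_exterior_derivative_def by (elim conjE)
    from bspec[OF this c'_in_A] u len
    have "local_form A (\<lambda>x vs. 0) c' u (map ax is) = euclidean_d (local_form A \<zeta> c') u (map ax is)"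
      unfolding image_c' by simp
    then have "euclidean_d (local_form A \<zeta> c') u (map ax is) = 0" by (simp add: local_form_def)
    moreover have "euclidean_d (local_form A \<zeta> c') u (map ax is) = euclidean_d (pb \<Phi> (local_form A \<zeta> c)) u (map ax is)"
      by (rule euclidean_d_cong[OF oV u]) (rule local_form_c')
    ultimately show ?thesis by simp
  qed
qed

text \<open>An isomorphism of tangent spaces that matches the forms becomes a linear automorphism of
  coordinate space, under which the kernels correspond.\<close>

lemma dim_kern_local_form:
  assumes S: "smooth_structure X A" and c: "c \<in> A" and const: "algebraically_constant X A q \<zeta>"
    and u: "u \<in> chart_map c ` chart_dom c" and u': "u' \<in> chart_map c ` chart_dom c"
  shows "dim (kern q (local_form A \<zeta> c u)) = dim (kern q (local_form A \<zeta> c u'))"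
proof -
  let ?x = "chart_inv c u" and ?y = "chart_inv c u'"
  have dom: "?x \<in> chart_dom c" "?y \<in> chart_dom c" by (rule chart_map_inv(2)[OF u], rule chart_map_inv(2)[OF u'])
  then have cx: "c \<in> charts_at A ?x" and cy: "c \<in> charts_at A ?y" using c by (simp_all add: charts_at_def)
  have "openin X (chart_dom c)" using smooth_structure_chart[OF S c] by (simp add: is_chart_def)
  from openin_subset[OF this] have top: "?x \<in> topspace X" "?y \<in> topspace X" using dom by blast+
  from const have "\<exists>L. tangent_iso A ?x ?y L \<and> (\<forall>vs\<in>tangent_lists A q ?x. \<zeta> ?y (map L vs) = \<zeta> ?x vs)"
    unfolding algebraically_constant_def using top by blast
  then obtain L where L: "tangent_iso A ?x ?y L" and eq: "\<forall>vs\<in>tangent_lists A q ?x. \<zeta> ?y (map L vs) = \<zeta> ?x vs"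
    by (elim exE conjE)
  let ?T = "tangent_of A c ?x" and ?T' = "tangent_of A c ?y"
  \<comment> \<open>The isomorphism \<open>L\<close>, with the chart \<open>c\<close> identifying
    both tangent spaces with coordinate space.\<close>
  define M where "M w = L (?T w) c" for w
  have Lbij: "bij_betw L (tangent_space A ?x) (tangent_space A ?y)"
    and Llin: "\<And>v w s t. v \<in> tangent_space A ?x \<Longrightarrow> w \<in> tangent_space A ?x \<Longrightarrow>
      L (tlincomb s v t w) = tlincomb s (L v) t (L w)"
    using L unfolding tangent_iso_def by blast+
  have T'c: "?T' w c = w" for w
    using cy transition_refl[OF S cy] by (simp add: tangent_of_def)
  have T'M: "?T' (M w) = L (?T w)" for w
  proof -
    have "L (?T w) \<in> tangent_space A ?y" using bij_betwE[OF Lbij] tangent_of_in[OF S cx] by blast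
    then obtain w' where "L (?T w) = ?T' w'"
      using tangent_of_bij[OF S cy] by (metis bij_betw_imp_surj_on imageE)
    then show ?thesis by (simp add: M_def T'c)
  qed
  have lc: "M (s *\<^sub>R v + t *\<^sub>R w) = s *\<^sub>R M v + t *\<^sub>R M w" for s t v w
    unfolding M_def tangent_of_lincomb[OF S cx] Llin[OF tangent_of_in[OF S cx] tangent_of_in[OF S cx]]
    by (simp add: tlincomb_def)
  have lin: "linear M"
    using lc[of 1 _ 1] lc[of _ _ 0] by (intro linearI) simp_all
  have inj: "inj M"
  proof (rule injI)
    fix v w assume "M v = M w"
    then have "L (?T v) = L (?T w)" using T'M by metis
    then have "?T v = ?T w"
      using bij_betw_imp_inj_on[OF Lbij] tangent_of_in[OF S cx] by (metis inj_onD)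
    then show "v = w" using bij_betw_imp_inj_on[OF tangent_of_bij[OF S cx]] by (metis injD)
  qed
  have "local_form A \<zeta> c u ws = local_form A \<zeta> c u' (map M ws)" if "length ws = q" for ws
  proof -
    have "map ?T ws \<in> tangent_lists A q ?x"
      using that tangent_of_in[OF S cx] by (auto simp: tangent_lists_def)
    with eq have "\<zeta> ?y (map L (map ?T ws)) = \<zeta> ?x (map ?T ws)" by blast
    then show ?thesis by (simp add: local_form_def comp_def T'M)
  qed
  then have "kern q (local_form A \<zeta> c u) = kern q (\<lambda>ws. local_form A \<zeta> c u' (map M ws))"
    unfolding kern_def by auto
  then show ?thesis using dim_kern_map(2)[OF lin inj, of q "local_form A \<zeta> c u'"] by simp
qed

theorem propositionD:
  fixes X :: "'a topology"
    and A :: "('a, 'n::finite) chart set"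
    and q :: nat
    and \<zeta> :: "('a, 'n) form"
  assumes "smooth_manifold X A"
    and "connected_space X"
    and "q \<in> {0, 1, 2, CARD('n) - 1, CARD('n)}"
    and "differential_form X A q \<zeta>"
    and "algebraically_constant X A q \<zeta>"
    and "closed_form X A q \<zeta>"
  shows "locally_constant_form X A q \<zeta>"
  unfolding locally_constant_form_def
proof
  have S: "smooth_structure X A" using assms(1) by (simp add: smooth_manifold_def)
  fix p assume p: "p \<in> topspace X"
  have "(\<Union>c\<in>A. chart_dom c) = topspace X" using S unfolding smooth_structure_def by (elim conjE)
  then have "p \<in> (\<Union>c\<in>A. chart_dom c)" using p by (simp only:)
  then obtain c where c: "c \<in> A" "p \<in> chart_dom c" by (rule UN_E)
  show "\<exists>c\<in>charts_at A p. \<forall>is. length is = q \<longrightarrow>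
      (\<forall>x\<in>chart_dom c. \<forall>y\<in>chart_dom c. component A \<zeta> c is x = component A \<zeta> c is y)"
  \<comment> \<open>In degree 0 the kernel is the whole space and carries no information. There
    algebraic constancy is used directly: evaluated on the empty list it says that the function is
    constant.\<close>
  proof (cases "q = 0")
    case True
    have "openin X (chart_dom c)" using smooth_structure_chart[OF S c(1)] by (simp add: is_chart_def)
    then have sub: "chart_dom c \<subseteq> topspace X" by (rule openin_subset)
    have "component A \<zeta> c [] x = component A \<zeta> c [] y" if xy: "x \<in> chart_dom c" "y \<in> chart_dom c" for x y
    proof -
      have "x \<in> topspace X" "y \<in> topspace X" using xy sub by blast+
      with assms(5) have "\<exists>L. tangent_iso A x y L \<and> (\<forall>vs\<in>tangent_lists A q x. \<zeta> y (map L vs) = \<zeta> x vs)"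
        unfolding algebraically_constant_def by blast
      then obtain L where L: "\<forall>vs\<in>tangent_lists A q x. \<zeta> y (map L vs) = \<zeta> x vs" by (elim exE conjE)
      have "[] \<in> tangent_lists A q x" using True by (simp add: tangent_lists_def)
      from bspec[OF L this] show ?thesis by (simp add: component_def)
    qed
    then have "\<forall>is. length is = q \<longrightarrow>
        (\<forall>x\<in>chart_dom c. \<forall>y\<in>chart_dom c. component A \<zeta> c is x = component A \<zeta> c is y)"
      unfolding True length_0_conv by blast
    moreover have "c \<in> charts_at A p" using c by (simp add: charts_at_def)
    ultimately show ?thesis by (rule bexI)
  next
    case False
    let ?U = "chart_map c ` chart_dom c" and ?\<omega> = "local_form A \<zeta> c"
    have pU: "chart_map c p \<in> ?U" using c(2) by blast
    have dim: "\<forall>u\<in>?U. dim (kern q (?\<omega> u)) = dim (kern q (?\<omega> (chart_map c p)))"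
      using dim_kern_local_form[OF S c(1) assms(5) _ pU] by blast
    have "0 < q" using False by simp
    note pc = c(2)
    obtain W \<Phi> where W: "param W \<Phi>" "\<Phi> ` W \<subseteq> ?U" "chart_map c p \<in> \<Phi> ` W"
      and const: "\<forall>x\<in>W. \<forall>y\<in>W. \<forall>is. length is = q \<longrightarrow> pb \<Phi> ?\<omega> x (map ax is) = pb \<Phi> ?\<omega> y (map ax is)"
      by (rule local_normal_form[OF closed_lform_local_form[OF S c(1) assms(4,6)] pU dim \<open>0 < q\<close> assms(3)])
    interpret chart_param X A c W \<Phi> by (rule chart_param.intro[OF S c(1) W(1,2)])
    have "c' \<in> charts_at A p" using c'_in_A pc W(3) by (simp add: charts_at_def dom_c')
    have comp: "component A \<zeta> c' is x = pb \<Phi> ?\<omega> (chart_map c' x) (map ax is)" if x: "x \<in> chart_dom c'" for "is" x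
      using component_local_form[of "chart_map c' x" c' A \<zeta> "is"] chart_inv_map[OF is_chart_c' x] x map_c'_in[OF x]
      by (simp add: local_form_c')
    have eq: "component A \<zeta> c' is x = component A \<zeta> c' is y"
      if "x \<in> chart_dom c'" "y \<in> chart_dom c'" "length is = q" for "is" x y
      unfolding comp[OF that(1)] comp[OF that(2)] using const map_c'_in that by blast
    then have "\<forall>is. length is = q \<longrightarrow>
        (\<forall>x\<in>chart_dom c'. \<forall>y\<in>chart_dom c'. component A \<zeta> c' is x = component A \<zeta> c' is y)"
      by (intro allI impI ballI)
    then show ?thesis using \<open>c' \<in> charts_at A p\<close> by (rule bexI)
  qed
qed

end
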